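(* Let $n\ge 1$ and $k\in\{1,\dots,n\}$. Then the map \[ \varphi_3:\mathrm{V}(k,n)/\mathrm{O}(k)\to\{Q\in \mathrm{O}(n): Q^{\mathsf T}=Q,\ \operatorname{tr}(Q)=2k-n\},\qquad \varphi_3([Y])=2YY^{\mathsf T}-I, \] is a (well-defined) diffeomorphism, with inverse $\varphi_3^{-1}(Q)=[Y_Q]$.
   Context: $\mathrm{V}(k,n)=\{Y\in\mathbb{R}^{n\times k}:Y^{\mathsf T}Y=I\}$ is the Stiefel manifold, on which $\mathrm{O}(k)$ acts by right multiplication; $[Y]=\{YQ:Q\in\mathrm{O}(k)\}$ is the class of $Y$ in the quotient manifold $\mathrm{V}(k,n)/\mathrm{O}(k)$. The target set carries the smooth structure of an embedded submanifold of $\mathrm{O}(n)$; each $Q$ in it is symmetric with eigenvalue $1$ of multiplicity $k$ and $-1$ of multiplicity $n-k$, and $Y_Q\in \mathrm{V}(k,n)$ denotes any matrix whose columns form an orthonormal basis of the $1$-eigenspace of $Q$. *)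

theory Defs
  imports "HOL-Analysis.Analysis"
begin

section \<open>Smooth maps in Euclidean spaces\<close>

text \<open>\<open>Ck_on k U f\<close>: \<open>f\<close> is of class \<open>C\<^sup>k\<close> on the open set \<open>U\<close>. In finite dimension this can be
  said through the directional derivatives \<open>x \<mapsto> Df(x)v\<close>.\<close>

primrec Ck_on :: "nat \<Rightarrow> 'a::euclidean_space set \<Rightarrow> ('a \<Rightarrow> 'b::real_normed_vector) \<Rightarrow> bool" where
  "Ck_on 0 U f \<longleftrightarrow> continuous_on U f"
| "Ck_on (Suc k) U f \<longleftrightarrow> (\<forall>x\<in>U. f differentiable (at x)) \<and>
     (\<forall>v. Ck_on k U (\<lambda>x. frechet_derivative f (at x) v))"

text \<open>Smoothness on an arbitrary subset means local extendability to a smooth function on an open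
  set. It is used below for relatively open subsets of a linear subspace, where it is
  ordinary smoothness on an open subset of that vector space.\<close>

definition smooth_on :: "'a::euclidean_space set \<Rightarrow> ('a \<Rightarrow> 'b::real_normed_vector) \<Rightarrow> bool" where
  "smooth_on A f \<longleftrightarrow>
     (\<forall>x\<in>A. \<exists>U g. open U \<and> x \<in> U \<and> (\<forall>k. Ck_on k U g) \<and> (\<forall>y\<in>A \<inter> U. g y = f y))"


section \<open>Smooth manifolds\<close>

text \<open>The dimension of a manifold is a number (possibly 0) rather than a type. Hence \<open>\<real>\<^sup>d\<close> is represented
  by a \<open>d\<close>-dimensional linear subspace of a Euclidean space \<open>'e\<close>, the third component of a chart,
  in which the image of the chart is open.\<close>

datatype ('a, 'e) chart =
  Chart (chart_dom: "'a set") (chart_map: "'a \<Rightarrow> 'e") (chart_model: "'e set")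

datatype ('a, 'e) manifold =
  Manifold (mtop: "'a topology") (atlas: "('a, 'e) chart set")

abbreviation mcarrier :: "('a, 'e) manifold \<Rightarrow> 'a set" where
  "mcarrier M \<equiv> topspace (mtop M)"

definition chart_on :: "'a topology \<Rightarrow> ('a, 'e::euclidean_space) chart \<Rightarrow> bool" where
  "chart_on X c \<longleftrightarrow>
     openin X (chart_dom c) \<and>
     subspace (chart_model c) \<and>
     openin (top_of_set (chart_model c)) (chart_map c ` chart_dom c) \<and>
     homeomorphic_map (subtopology X (chart_dom c)) (top_of_set (chart_map c ` chart_dom c))
       (chart_map c)"

definition chart_inv :: "('a, 'e) chart \<Rightarrow> 'e \<Rightarrow> 'a" where
  "chart_inv c = inv_into (chart_dom c) (chart_map c)"

text \<open>The representation of \<open>f\<close> in the charts \<open>b\<close> and \<open>c\<close>, and the set on which it is meaningful.\<close>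

definition coord_rep ::
  "('a \<Rightarrow> 'b) \<Rightarrow> ('a, 'e) chart \<Rightarrow> ('b, 'f) chart \<Rightarrow> 'e \<Rightarrow> 'f" where
  "coord_rep f b c = chart_map c \<circ> f \<circ> chart_inv b"

definition coord_dom ::
  "('a \<Rightarrow> 'b) \<Rightarrow> ('a, 'e) chart \<Rightarrow> ('b, 'f) chart \<Rightarrow> 'e set" where
  "coord_dom f b c = chart_map b ` (chart_dom b \<inter> f -` chart_dom c)"

definition smooth_in_charts ::
  "('a \<Rightarrow> 'b) \<Rightarrow> ('a, 'e::euclidean_space) chart \<Rightarrow> ('b, 'f::euclidean_space) chart \<Rightarrow> bool" where
  "smooth_in_charts f b c \<longleftrightarrow> smooth_on (coord_dom f b c) (coord_rep f b c)"

definition compatible ::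
  "('a, 'e::euclidean_space) chart \<Rightarrow> ('a, 'e) chart \<Rightarrow> bool" where
  "compatible b c \<longleftrightarrow> smooth_in_charts id b c \<and> smooth_in_charts id c b"

definition smooth_manifold :: "('a, 'e::euclidean_space) manifold \<Rightarrow> bool" where
  "smooth_manifold M \<longleftrightarrow>
     Hausdorff_space (mtop M) \<and> second_countable (mtop M) \<and>
     (\<forall>c\<in>atlas M. chart_on (mtop M) c) \<and>
     (\<Union>c\<in>atlas M. chart_dom c) = mcarrier M \<and>
     (\<forall>b\<in>atlas M. \<forall>c\<in>atlas M. compatible b c) \<and>
     (\<exists>d. \<forall>c\<in>atlas M. chart_dom c \<noteq> {} \<longrightarrow> dim (chart_model c) = d)"

definition maximal_atlas :: "('a, 'e::euclidean_space) manifold \<Rightarrow> ('a, 'e) chart set" where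
  "maximal_atlas M = {c. chart_on (mtop M) c \<and> (\<forall>b\<in>atlas M. compatible b c)}"

definition smooth_map ::
  "('a, 'e::euclidean_space) manifold \<Rightarrow> ('b, 'f::euclidean_space) manifold \<Rightarrow> ('a \<Rightarrow> 'b) \<Rightarrow> bool"
  where
  "smooth_map M N f \<longleftrightarrow> continuous_map (mtop M) (mtop N) f \<and>
     (\<forall>b\<in>atlas M. \<forall>c\<in>atlas N. smooth_in_charts f b c)"

definition diffeomorphism ::
  "('a, 'e::euclidean_space) manifold \<Rightarrow> ('b, 'f::euclidean_space) manifold \<Rightarrow> ('a \<Rightarrow> 'b) \<Rightarrow> bool"
  where
  "diffeomorphism M N f \<longleftrightarrow>
     smooth_manifold M \<and> smooth_manifold N \<and> bij_betw f (mcarrier M) (mcarrier N) \<and>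
     smooth_map M N f \<and> smooth_map N M (inv_into (mcarrier M) f)"

definition euclidean_manifold :: "('e, 'e::euclidean_space) manifold" where
  "euclidean_manifold = Manifold euclidean {Chart UNIV id UNIV}"


subsection \<open>Embedded submanifolds\<close>

text \<open>\<open>S\<close> is an embedded submanifold of \<open>M\<close> iff \<open>smooth_manifold (submanifold M S)\<close>, in
  particular iff charts of the maximal atlas of \<open>M\<close> that straighten \<open>S\<close> exist around all points of
  \<open>S\<close>; the restrictions of such slice charts form the atlas of \<open>S\<close>.\<close>

definition slice_chart ::
  "('a, 'e::euclidean_space) manifold \<Rightarrow> 'a set \<Rightarrow> ('a, 'e) chart \<Rightarrow> 'e set \<Rightarrow> bool" where
  "slice_chart M S c F \<longleftrightarrow>
     c \<in> maximal_atlas M \<and> subspace F \<and> F \<subseteq> chart_model c \<and>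
     chart_map c ` (chart_dom c \<inter> S) = chart_map c ` chart_dom c \<inter> F"

definition submanifold ::
  "('a, 'e::euclidean_space) manifold \<Rightarrow> 'a set \<Rightarrow> ('a, 'e) manifold" where
  "submanifold M S =
     Manifold (subtopology (mtop M) S)
       {Chart (chart_dom c \<inter> S) (chart_map c) F | c F. slice_chart M S c F}"


subsection \<open>Submersions and quotient manifolds\<close>

text \<open>The tangent spaces at the two points are represented in the charts by the model
  spaces, so the differential of \<open>f\<close> is onto iff the derivative \<open>D\<close> of the coordinate representation
  maps \<open>chart_model b\<close> onto \<open>chart_model c\<close>. As a derivative within an open
  subset of \<open>chart_model b\<close>, \<open>D\<close> is unique on \<open>chart_model b\<close>.\<close>

definition submersive_in_charts ::
  "('a \<Rightarrow> 'b) \<Rightarrow> ('a, 'e::euclidean_space) chart \<Rightarrow> ('b, 'f::euclidean_space) chart \<Rightarrow> bool" where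
  "submersive_in_charts f b c \<longleftrightarrow>
     smooth_in_charts f b c \<and>
     (\<forall>x\<in>coord_dom f b c. \<exists>D.
        (coord_rep f b c has_derivative D) (at x within coord_dom f b c) \<and>
        D ` chart_model b = chart_model c)"

definition submersion ::
  "('a, 'e::euclidean_space) manifold \<Rightarrow> ('b, 'f::euclidean_space) manifold \<Rightarrow> ('a \<Rightarrow> 'b) \<Rightarrow> bool"
  where
  "submersion M N f \<longleftrightarrow> continuous_map (mtop M) (mtop N) f \<and>
     (\<forall>b\<in>atlas M. \<forall>c\<in>atlas N. submersive_in_charts f b c)"

definition quotient_topology :: "'a topology \<Rightarrow> ('a \<Rightarrow> 'b) \<Rightarrow> 'b topology" where
  "quotient_topology X p =
     topology (\<lambda>U. U \<subseteq> p ` topspace X \<and> openin X {x \<in> topspace X. p x \<in> U})"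

lemma openin_quotient_topology:
  "openin (quotient_topology X p) U \<longleftrightarrow>
     U \<subseteq> p ` topspace X \<and> openin X {x \<in> topspace X. p x \<in> U}"
proof -
  let ?L = "\<lambda>U. U \<subseteq> p ` topspace X \<and> openin X {x \<in> topspace X. p x \<in> U}"
  have "istopology ?L"
    unfolding istopology_def
  proof (intro conjI allI impI)
    fix S T assume S: "?L S" and T: "?L T"
    show "S \<inter> T \<subseteq> p ` topspace X" using S by blast
    have "{x \<in> topspace X. p x \<in> S \<inter> T} =
        {x \<in> topspace X. p x \<in> S} \<inter> {x \<in> topspace X. p x \<in> T}"
      by blast
    then show "openin X {x \<in> topspace X. p x \<in> S \<inter> T}" using S T by auto
  next
    fix K assume K: "\<forall>S\<in>K. ?L S"
    show "\<Union>K \<subseteq> p ` topspace X" using K by blast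
    have "{x \<in> topspace X. p x \<in> \<Union>K} = (\<Union>S\<in>K. {x \<in> topspace X. p x \<in> S})" by blast
    then show "openin X {x \<in> topspace X. p x \<in> \<Union>K}" using K by auto
  qed
  then show ?thesis by (simp add: quotient_topology_def topology_inverse')
qed

lemma topspace_quotient_topology: "topspace (quotient_topology X p) = p ` topspace X"
proof
  show "topspace (quotient_topology X p) \<subseteq> p ` topspace X"
    using openin_topspace[of "quotient_topology X p"] unfolding openin_quotient_topology by blast
  have "{x \<in> topspace X. p x \<in> p ` topspace X} = topspace X" by blast
  then have "openin (quotient_topology X p) (p ` topspace X)"
    by (simp add: openin_quotient_topology)
  then show "p ` topspace X \<subseteq> topspace (quotient_topology X p)" by (rule openin_subset)
qed

text \<open>The quotient manifold carries the quotient topology and the smooth structure for which the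
  projection \<open>p\<close> is a submersion. There is at most one such structure, and
  its maximal atlas consists of all charts in which \<open>p\<close> is submersive. The lemma after the definition
  shows that the atlas chosen here contains every atlas making \<open>p\<close> a submersion.\<close>

definition quotient_manifold ::
  "('a, 'e::euclidean_space) manifold \<Rightarrow> ('a \<Rightarrow> 'b) \<Rightarrow> ('b, 'e) manifold" where
  "quotient_manifold M p =
     Manifold (quotient_topology (mtop M) p)
       {c. chart_on (quotient_topology (mtop M) p) c \<and>
           (\<forall>b\<in>atlas M. submersive_in_charts p b c)}"

lemma quotient_manifold_greatest:
  assumes "smooth_manifold N" "mtop N = quotient_topology (mtop M) p" "submersion M N p"
  shows "atlas N \<subseteq> atlas (quotient_manifold M p)"
  using assms by (auto simp: quotient_manifold_def smooth_manifold_def submersion_def)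


section \<open>The two models\<close>

definition stiefel :: "(real^'k^'n) set" where
  "stiefel = {Y. transpose Y ** Y = mat 1}"

definition stiefel_class :: "real^'k^'n \<Rightarrow> (real^'k^'n) set" where
  "stiefel_class Y = {Y ** Q | Q. orthogonal_matrix Q}"

definition stiefel_manifold :: "(real^'k^'n, real^'k^'n) manifold" where
  "stiefel_manifold = submanifold euclidean_manifold stiefel"

definition stiefel_quotient :: "((real^'k^'n) set, real^'k^'n) manifold" where
  "stiefel_quotient = quotient_manifold stiefel_manifold stiefel_class"

definition orthogonal_manifold :: "(real^'n^'n, real^'n^'n) manifold" where
  "orthogonal_manifold = submanifold euclidean_manifold {Q. orthogonal_matrix Q}"

definition involution_model :: "nat \<Rightarrow> (real^'n^'n) set" where
  "involution_model k =
     {Q. orthogonal_matrix Q \<and> transpose Q = Q \<and> trace Q = 2 * real k - real CARD('n)}"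

definition involution_manifold :: "nat \<Rightarrow> (real^'n^'n, real^'n^'n) manifold" where
  "involution_manifold k = submanifold orthogonal_manifold (involution_model k)"

text \<open>The common value of \<open>2YY\<^sup>T - I\<close> over all representatives \<open>Y\<close> of the class \<open>C\<close>; it is meaningful
  only if there is exactly one such value.\<close>

definition phi3 :: "(real^'k^'n) set \<Rightarrow> real^'n^'n" where
  "phi3 C = the_elem ((\<lambda>Y. 2 *\<^sub>R (Y ** transpose Y) - mat 1) ` C)"

definition one_eigenbasis :: "real^'n^'n \<Rightarrow> real^'k^'n \<Rightarrow> bool" where
  "one_eigenbasis Q Y \<longleftrightarrow>
     (\<forall>i j. column i Y \<bullet> column j Y = (if i = j then 1 else 0)) \<and>
     span (columns Y) = {v. Q *v v = v}"

end

theory Submission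
  imports Defs
begin

text \<open>The map \<open>Y \<mapsto> 2YY\<^sup>T - I\<close> sends \<open>V(k,n)\<close> onto the set \<open>S\<close> of symmetric orthogonal matrices of trace \<open>2k - n\<close>,
  and its fibres are the classes \<open>[Y]\<close>. It has smooth local sections: orthonormalize the projections of
  the columns of \<open>Y\<close> onto the 1-eigenspace of a nearby \<open>Q\<close>. Composing with these sections shows that the
  charts of \<open>V(k,n)/O(k)\<close>, that is, the charts in which the projection is a submersion, are exactly the
  charts of the submanifold \<open>S\<close> transported along \<open>\<phi>\<^sub>3\<close>; one direction uses local sections of the
  projection in charts, which the inverse function theorem provides. That \<open>S\<close> is an embedded
  submanifold of \<open>O(n)\<close> is seen in the charts \<open>A \<mapsto> cayley (QA)\<close>, which map \<open>S\<close> into the linear space of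
  skew matrices anticommuting with \<open>Q\<close>.\<close>

section \<open>Calculus of \<open>C\<^sup>k\<close> maps\<close>

text \<open>The atlas of \<open>quotient_manifold\<close> is not chosen: it consists of all charts
  in which the projection is submersive, so every such chart has to be analysed, and exhibiting one
  convenient atlas would not settle the smoothness of \<open>phi3\<close>. The arguments therefore
  run through the ambient matrix spaces: a chart is called embedded if it and its inverse are smooth
  as maps between subsets of Euclidean spaces, and compatibility of embedded charts is then mere
  composition. Two features of the encoding leave traces. Charts of the quotient take values in n x
  k matrices and those of the target in n x n matrices; for a frame \<open>Y\<close> the injection
  \<open>B \<mapsto> B ** Y\<close> carries the model spaces of the target into the other type.
  Moreover all charts of a manifold need models of one dimension. Instead of counting k(n-k), the
  proof uses that O(n) acts transitively on frames, which makes the models conjugate. The trace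
  condition adds no equation to the slices: inverse Cayley charts, restricted to the anticommuting
  matrices, produce conjugates of the centre \<open>Q\<close>.\<close>

lemma Ck_on_subset:
  assumes "Ck_on k U f" "V \<subseteq> U"
  shows "Ck_on k V f"
  using assms by (induction k arbitrary: f) (auto intro: continuous_on_subset)

lemma Ck_on_cong:
  assumes "open U" "\<And>x. x \<in> U \<Longrightarrow> f x = g x" "Ck_on k U f"
  shows "Ck_on k U g"
  using assms(2,3)
proof (induction k arbitrary: f g)
  case 0
  then show ?case by (simp cong: continuous_on_cong)
next
  case (Suc k)
  have "(g has_derivative frechet_derivative f (at x)) (at x)" if "x \<in> U" for x
  proof (rule has_derivative_transform_within_open[OF _ assms(1) that])
    show "(f has_derivative frechet_derivative f (at x)) (at x)"
      unfolding frechet_derivative_works[symmetric] using Suc.prems that by simp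
  qed (use Suc.prems in simp)
  then have "g differentiable (at x)" "frechet_derivative g (at x) = frechet_derivative f (at x)"
    if "x \<in> U" for x
    using that differentiableI frechet_derivative_at by metis+
  with Suc.IH[of "\<lambda>x. frechet_derivative f (at x) v" "\<lambda>x. frechet_derivative g (at x) v" for v]
    Suc.prems(2)
  show ?case by simp
qed

lemma Ck_on_SucD: "Ck_on (Suc k) U f \<Longrightarrow> Ck_on k U f"
proof (induction k arbitrary: f)
  case 0
  then show ?case
    by (auto intro!: continuous_at_imp_continuous_on differentiable_imp_continuous_within)
qed (metis Ck_on.simps(2))

lemma Ck_on_imp_continuous_on: "Ck_on k U f \<Longrightarrow> continuous_on U f"
proof (induction k)
  case (Suc k)
  then show ?case using Ck_on_SucD by blast
qed simp

text \<open>Frees later proofs from the choice hidden in \<open>frechet_derivative\<close>: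
  derivatives at a point are unique, so any family of them may be supplied.\<close>

lemma Ck_on_SucI:
  assumes "open U" "\<And>x. x \<in> U \<Longrightarrow> (f has_derivative f' x) (at x)"
    and "\<And>v. Ck_on k U (\<lambda>x. f' x v)"
  shows "Ck_on (Suc k) U f"
proof -
  have "f' x = frechet_derivative f (at x)" if "x \<in> U" for x
    using assms(2)[OF that] by (rule frechet_derivative_at)
  then have "Ck_on k U (\<lambda>x. frechet_derivative f (at x) v)" for v
    by (intro Ck_on_cong[OF assms(1) _ assms(3)[of v]]) simp
  then show ?thesis
    using assms(2) by (auto simp: differentiable_def)
qed

lemma Ck_on_Suc_derivative:
  assumes "Ck_on (Suc k) U f"
  obtains f' where "\<And>x. x \<in> U \<Longrightarrow> (f has_derivative f' x) (at x)" "\<And>v. Ck_on k U (\<lambda>x. f' x v)"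
  using assms unfolding Ck_on.simps frechet_derivative_works
  by (intro that[of "\<lambda>x. frechet_derivative f (at x)"]) auto

lemma Ck_on_const: "open U \<Longrightarrow> Ck_on k U (\<lambda>x. c)"
proof (induction k arbitrary: c)
  case (Suc k)
  then show ?case
    by (intro Ck_on_SucI[where f' = "\<lambda>_ _. 0"]) auto
qed simp

lemma Ck_on_bounded_linear:
  assumes "bounded_linear h" "open U"
  shows "Ck_on k U h"
proof (cases k)
  case 0
  then show ?thesis using assms by (simp add: linear_continuous_on)
next
  case (Suc k)
  then show ?thesis
    using assms
    by (auto intro!: Ck_on_SucI[where f' = "\<lambda>_. h"] bounded_linear_imp_has_derivative Ck_on_const
        simp del: Ck_on.simps(2))
qed

lemma Ck_on_bounded_linear_compose:
  assumes "bounded_linear h" "open U" "Ck_on k U f"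
  shows "Ck_on k U (\<lambda>x. h (f x))"
  using assms(3)
proof (induction k arbitrary: f)
  case 0
  then show ?case using bounded_linear.continuous_on[OF assms(1)] by auto
next
  case (Suc k)
  obtain f' where "\<And>x. x \<in> U \<Longrightarrow> (f has_derivative f' x) (at x)" "\<And>v. Ck_on k U (\<lambda>x. f' x v)"
    using Suc.prems by (rule Ck_on_Suc_derivative) blast
  then show ?case
    by (intro Ck_on_SucI[where f' = "\<lambda>x v. h (f' x v)"])
      (auto intro!: assms Suc.IH bounded_linear.has_derivative[OF assms(1)])
qed

lemma Ck_on_add:
  assumes "open U" "Ck_on k U f" "Ck_on k U g"
  shows "Ck_on k U (\<lambda>x. f x + g x)"
  using assms(2,3)
proof (induction k arbitrary: f g)
  case (Suc k)
  obtain f' where "\<And>x. x \<in> U \<Longrightarrow> (f has_derivative f' x) (at x)" "\<And>v. Ck_on k U (\<lambda>x. f' x v)"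
    using Suc.prems(1) by (rule Ck_on_Suc_derivative) blast
  moreover obtain g' where "\<And>x. x \<in> U \<Longrightarrow> (g has_derivative g' x) (at x)" "\<And>v. Ck_on k U (\<lambda>x. g' x v)"
    using Suc.prems(2) by (rule Ck_on_Suc_derivative) blast
  ultimately show ?case
    by (intro Ck_on_SucI[where f' = "\<lambda>x v. f' x v + g' x v"])
      (auto intro!: assms Suc.IH has_derivative_add)
qed (auto intro: continuous_on_add)

lemma Ck_on_sum:
  assumes "open U" "\<And>i. i \<in> I \<Longrightarrow> Ck_on k U (f i)"
  shows "Ck_on k U (\<lambda>x. \<Sum>i\<in>I. f i x)"
  using assms by (induction I rule: infinite_finite_induct) (simp_all add: Ck_on_const Ck_on_add)

lemma Ck_on_bilinear:
  assumes "bounded_bilinear p" "open U" "Ck_on k U f" "Ck_on k U g"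
  shows "Ck_on k U (\<lambda>x. p (f x) (g x))"
  using assms(3,4)
proof (induction k arbitrary: f g)
  case 0
  then show ?case using bounded_bilinear.continuous_on[OF assms(1)] by auto
next
  case (Suc k)
  note less = Suc.prems[THEN Ck_on_SucD]
  obtain f' where "\<And>x. x \<in> U \<Longrightarrow> (f has_derivative f' x) (at x)" "\<And>v. Ck_on k U (\<lambda>x. f' x v)"
    using Suc.prems(1) by (rule Ck_on_Suc_derivative) blast
  moreover obtain g' where "\<And>x. x \<in> U \<Longrightarrow> (g has_derivative g' x) (at x)" "\<And>v. Ck_on k U (\<lambda>x. g' x v)"
    using Suc.prems(2) by (rule Ck_on_Suc_derivative) blast
  ultimately show ?case
    using less by (intro Ck_on_SucI[where f' = "\<lambda>x v. p (f x) (g' x v) + p (f' x v) (g x)"])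
      (auto intro!: assms Suc.IH bounded_bilinear.FDERIV[OF assms(1)] Ck_on_add)
qed

section \<open>Chain rule, inversion of operator families, inverse function theorem\<close>

lemma linear_eq_sum_Basis:
  assumes "linear h"
  shows "h v = (\<Sum>b\<in>Basis. (v \<bullet> b) *\<^sub>R h b)"
proof -
  have "h v = h (\<Sum>b\<in>Basis. (v \<bullet> b) *\<^sub>R b)" by (simp add: euclidean_representation)
  also have "\<dots> = (\<Sum>b\<in>Basis. (v \<bullet> b) *\<^sub>R h b)"
    using assms by (simp add: linear_sum linear_scale)
  finally show ?thesis .
qed

text \<open>In the chain rule \<open>g' (f x) (f' x v)\<close> the direction varies with
  \<open>x\<close>, while the induction hypothesis speaks of \<open>x \<mapsto> g' (f x) b\<close>
  for a fixed \<open>b\<close> only. Expanding \<open>f' x v\<close> in the basis separates the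
  two.\<close>

lemma Ck_on_compose:
  fixes f :: "'a::euclidean_space \<Rightarrow> 'b::euclidean_space"
  assumes "open U" "open V" "f ` U \<subseteq> V" "Ck_on k U f" "Ck_on k V g"
  shows "Ck_on k U (\<lambda>x. g (f x))"
  using assms(4,5)
proof (induction k arbitrary: g)
  case 0
  then show ?case using assms(3) by (auto intro: continuous_on_compose2)
next
  case (Suc k)
  note less = Suc.prems(1)[THEN Ck_on_SucD]
  obtain f' where f': "\<And>x. x \<in> U \<Longrightarrow> (f has_derivative f' x) (at x)" "\<And>v. Ck_on k U (\<lambda>x. f' x v)"
    using Suc.prems(1) by (rule Ck_on_Suc_derivative) blast
  obtain g' where g': "\<And>x. x \<in> V \<Longrightarrow> (g has_derivative g' x) (at x)" "\<And>v. Ck_on k V (\<lambda>x. g' x v)"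
    using Suc.prems(2) by (rule Ck_on_Suc_derivative) blast
  show ?case
  proof (rule Ck_on_SucI[OF assms(1)])
    fix x assume x: "x \<in> U"
    have "((\<lambda>x. g (f x)) has_derivative (\<lambda>v. g' (f x) (f' x v))) (at x)"
      using has_derivative_compose[OF f'(1)[OF x] g'(1)] x assms(3) by auto
    moreover have "linear (g' (f x))"
      using x assms(3) g'(1) has_derivative_linear by blast
    ultimately show "((\<lambda>x. g (f x)) has_derivative
        (\<lambda>v. \<Sum>b\<in>Basis. (f' x v \<bullet> b) *\<^sub>R g' (f x) b)) (at x)"
      by (simp only: linear_eq_sum_Basis[of "g' (f x)" "f' x v" for v])
  next
    fix v
    show "Ck_on k U (\<lambda>x. \<Sum>b\<in>Basis. (f' x v \<bullet> b) *\<^sub>R g' (f x) b)"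
      by (intro Ck_on_sum Ck_on_bilinear[OF bounded_bilinear_scaleR]
          Ck_on_bilinear[OF bounded_bilinear_inner] Suc.IH[OF less, of "\<lambda>y. g' y b" for b]
          assms(1) f' g' Ck_on_const)
  qed
qed

text \<open>A product rule in which \<open>b\<close> is merely continuous; it holds because
  \<open>q\<close> vanishes at \<open>x\<close>. It serves to differentiate an inverse operator
  whose differentiability is still to be shown.\<close>

lemma has_derivative_scaleR_zero:
  fixes q :: "'a::real_normed_vector \<Rightarrow> real"
  assumes q: "(q has_derivative D) (at x)" "q x = 0" and b: "isCont b x"
  shows "((\<lambda>y. q y *\<^sub>R b y) has_derivative (\<lambda>h. D h *\<^sub>R b x)) (at x)"
proof -
  interpret D: bounded_linear D using q(1) by (rule has_derivative_bounded_linear)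
  obtain K where K: "K > 0" "\<And>h. norm (D h) \<le> norm h * K"
    using D.pos_bounded by blast
  show ?thesis
    unfolding has_derivative_at_alt
  proof (intro conjI allI impI)
    show "bounded_linear (\<lambda>h. D h *\<^sub>R b x)"
      using D.bounded_linear_axioms by (rule bounded_linear_scaleR_const)
    fix e :: real assume e: "e > 0"
    \<comment> \<open>\<open>e1\<close> controls the linearization error of \<open>q\<close> and
      \<open>e2\<close> the oscillation of \<open>b\<close>; each will contribute at most
      \<open>e / 2\<close>. The summand 1 in \<open>e1\<close> keeps the denominator positive if
      \<open>b x = 0\<close>.\<close>
    define e1 where "e1 = e / (2 * (norm (b x) + 1))"
    define e2 where "e2 = min 1 (e / (2 * (norm (b x) + K + 1)))"
    have e1: "e1 > 0" and e2: "e2 > 0"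
      using e K(1) by (auto simp: e1_def e2_def intro!: divide_pos_pos add_nonneg_pos mult_pos_pos)
    from q(1) obtain d1 where d1: "d1 > 0"
      "\<And>y. norm (y - x) < d1 \<Longrightarrow> norm (q y - q x - D (y - x)) \<le> min 1 e1 * norm (y - x)"
      unfolding has_derivative_at_alt using e1 by (metis min_less_iff_conj zero_less_one)
    from b obtain d2 where d2: "d2 > 0" "\<And>y. norm (y - x) < d2 \<Longrightarrow> norm (b y - b x) < e2 / 1"
      unfolding continuous_at_eps_delta using e2 by (auto simp: dist_norm)
    show "\<exists>d>0. \<forall>y. norm (y - x) < d \<longrightarrow>
        norm (q y *\<^sub>R b y - q x *\<^sub>R b x - D (y - x) *\<^sub>R b x) \<le> e * norm (y - x)"
    proof (intro exI[of _ "min d1 d2"] conjI allI impI)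
      fix y assume y: "norm (y - x) < min d1 d2"
      let ?n = "norm (y - x)"
      have r: "\<bar>q y - D (y - x)\<bar> \<le> min 1 e1 * ?n"
        using d1(2)[of y] y q(2) by simp
      have r1: "\<bar>q y - D (y - x)\<bar> \<le> e1 * ?n"
        using r mult_right_mono[of "min 1 e1" e1 ?n] by simp
      have "\<bar>q y\<bar> \<le> \<bar>q y - D (y - x)\<bar> + \<bar>D (y - x)\<bar>" by simp
      also have "\<dots> \<le> ?n + ?n * K"
        using r K(2)[of "y - x"] mult_right_mono[of "min 1 e1" 1 ?n] by auto
      finally have qy: "\<bar>q y\<bar> \<le> (1 + K) * ?n" by (simp add: algebra_simps)
      have "norm (q y *\<^sub>R b y - q x *\<^sub>R b x - D (y - x) *\<^sub>R b x)
          = norm (q y *\<^sub>R (b y - b x) + (q y - D (y - x)) *\<^sub>R b x)"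
        using q(2) by (simp add: algebra_simps)
      also have "\<dots> \<le> \<bar>q y\<bar> * norm (b y - b x) + \<bar>q y - D (y - x)\<bar> * norm (b x)"
        by (metis norm_scaleR norm_triangle_ineq)
      also have "\<dots> \<le> ((1 + K) * ?n) * e2 + (e1 * ?n) * norm (b x)"
        using d2(2)[of y] y qy r1 K(1) by (intro add_mono mult_mono) auto
      also have "\<dots> = ((1 + K) * e2 + e1 * norm (b x)) * ?n" by (simp add: algebra_simps)
      also have "\<dots> \<le> e * ?n"
      proof (rule mult_right_mono)
        have "(1 + K) * e2 \<le> (norm (b x) + K + 1) * (e / (2 * (norm (b x) + K + 1)))"
          using K(1) e2 by (intro mult_mono) (auto simp: e2_def)
        also have "\<dots> = e / 2"
        proof -
          have "norm (b x) + K + 1 \<noteq> 0" using K(1) norm_ge_zero[of "b x"] by linarith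
          moreover have "n * (e / (2 * n)) = e / 2" if "n \<noteq> 0" for n :: real using that by simp
          ultimately show ?thesis by blast
        qed
        finally have A: "(1 + K) * e2 \<le> e / 2" .
        have "e1 * norm (b x) \<le> e1 * (norm (b x) + 1)" using e1 by simp
        also have "\<dots> = e / 2" 
        proof -
          have "norm (b x) + 1 \<noteq> 0" using norm_ge_zero[of "b x"] by linarith
          moreover have "e / (2 * n) * n = e / 2" if "n \<noteq> 0" for n :: real using that by simp
          ultimately show ?thesis unfolding e1_def by blast
        qed
        finally show "(1 + K) * e2 + e1 * norm (b x) \<le> e" using A by simp
      qed simp
      finally show "norm (q y *\<^sub>R b y - q x *\<^sub>R b x - D (y - x) *\<^sub>R b x) \<le> e * ?n" .
    qed (use d1 d2 in auto)
  qed
qed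

text \<open>\<open>A x\<close> is bounded below by some \<open>m > 0\<close>. For \<open>y\<close>
  near \<open>x\<close> the operators differ by at most \<open>m / 2\<close>, so \<open>A y\<close>
  is bounded below by \<open>m / 2\<close>, and the inverses are bounded uniformly.\<close>

lemma continuous_inverse_operator:
  fixes A B :: "'a::t2_space \<Rightarrow> 'b::euclidean_space \<Rightarrow> 'b"
  assumes "open U" and lin: "\<And>x. x \<in> U \<Longrightarrow> linear (A x)"
    and AB: "\<And>x v. x \<in> U \<Longrightarrow> A x (B x v) = v" and BA: "\<And>x v. x \<in> U \<Longrightarrow> B x (A x v) = v"
    and A: "\<And>v. continuous_on U (\<lambda>x. A x v)"
  shows "continuous_on U (\<lambda>x. B x v)"
proof (rule continuous_at_imp_continuous_on, intro ballI)
  fix x assume x: "x \<in> U"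
  have "inj (A x)" using BA[OF x] by (metis injI)
  then obtain m where m: "m > 0" "\<And>v. m * norm v \<le> norm (A x v)"
    using linear_inj_bounded_below_pos[OF lin[OF x]] by (metis mult.commute)
  have isA: "((\<lambda>y. A y v) \<longlongrightarrow> A x v) (at x)" for v
    using A[of v] \<open>open U\<close> x by (metis at_within_open continuous_on_def)
  have evU: "\<forall>\<^sub>F y in at x. y \<in> U"
    using \<open>open U\<close> x by (rule eventually_at_in_open')
  have "((\<lambda>y. \<Sum>b\<in>Basis. norm (A y b - A x b)) \<longlongrightarrow> (\<Sum>b\<in>Basis. norm (A x b - A x b))) (at x)"
    by (intro tendsto_intros isA)
  then have evm: "\<forall>\<^sub>F y in at x. (\<Sum>b\<in>Basis. norm (A y b - A x b)) < m / 2"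
    using m(1) by (auto dest: order_tendstoD(2)[where a = "m / 2"])
  have "\<forall>\<^sub>F y in at x. norm (B y v - B x v) \<le> (2 / m) * norm (A x (B x v) - A y (B x v))"
    using evU evm
  proof eventually_elim
    case (elim y)
    define w where "w = B y v - B x v"
    have ly: "linear (\<lambda>u. A y u - A x u)"
      using lin[OF elim(1)] lin[OF x] by (rule linear_compose_sub)
    \<comment> \<open>Both \<open>A y (B y v)\<close> and \<open>A x (B x v)\<close> equal
      \<open>v\<close>; hence \<open>A y\<close> applied to the increment of the inverse is an
      increment of \<open>A\<close> at the fixed vector \<open>B x v\<close>, which tends to
      0.\<close>
    have Ayw: "A y w = A x (B x v) - A y (B x v)"
      using lin[OF elim(1)] by (simp add: w_def linear_diff AB x elim(1))
    have "norm (A y w - A x w) = norm (\<Sum>b\<in>Basis. (w \<bullet> b) *\<^sub>R (A y b - A x b))"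
      using linear_eq_sum_Basis[OF ly, of w] by simp
    also have "\<dots> \<le> (\<Sum>b\<in>Basis. norm w * norm (A y b - A x b))"
      by (rule sum_norm_le) (auto intro!: mult_right_mono Basis_le_norm)
    also have "\<dots> = norm w * (\<Sum>b\<in>Basis. norm (A y b - A x b))"
      by (simp add: sum_distrib_left)
    also have "\<dots> \<le> norm w * (m / 2)" using elim(2) by (intro mult_left_mono) auto
    finally have "norm (A y w - A x w) \<le> norm w * (m / 2)" .
    moreover have "norm (A x w) \<le> norm (A y w) + norm (A y w - A x w)"
      by (metis norm_minus_commute norm_triangle_sub)
    ultimately have "m * norm w - norm w * (m / 2) \<le> norm (A y w)"
      using m(2)[of w] by linarith
    then have "norm w \<le> (2 / m) * norm (A y w)" using m(1) by (simp add: field_simps)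
    then show ?case by (simp add: w_def[symmetric] Ayw)
  qed
  moreover have "((\<lambda>y. (2 / m) * norm (A x (B x v) - A y (B x v))) \<longlongrightarrow>
      (2 / m) * norm (A x (B x v) - A x (B x v))) (at x)"
    by (intro tendsto_intros isA)
  then have "((\<lambda>y. (2 / m) * norm (A x (B x v) - A y (B x v))) \<longlongrightarrow> 0) (at x)"
    by simp
  ultimately have "((\<lambda>y. B y v - B x v) \<longlongrightarrow> 0) (at x)"
    by (rule Lim_null_comparison)
  then show "isCont (\<lambda>x. B x v) x"
    unfolding continuous_at by (rule LIM_zero_cancel)
qed

text \<open>The derivative of \<open>x \<mapsto> (A x)\<inverse>v\<close> in direction \<open>w\<close> is \<open>-(A x)\<inverse>(A'(x)w)(A x)\<inverse>v\<close>; expanding in a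
  basis expresses it through functions of the same kind.\<close>

lemma Ck_on_inverse_operator:
  fixes A B :: "'a::euclidean_space \<Rightarrow> 'b::euclidean_space \<Rightarrow> 'b"
  assumes "open U" and lin: "\<And>x. x \<in> U \<Longrightarrow> linear (A x)"
    and AB: "\<And>x v. x \<in> U \<Longrightarrow> A x (B x v) = v" and BA: "\<And>x v. x \<in> U \<Longrightarrow> B x (A x v) = v"
    and A: "\<And>v. Ck_on k U (\<lambda>x. A x v)"
  shows "Ck_on k U (\<lambda>x. B x v)"
  using A
proof (induction k arbitrary: v)
  case 0
  then show ?case using continuous_inverse_operator[OF assms(1-4)] by simp
next
  case (Suc k)
  have Bk: "Ck_on k U (\<lambda>x. B x v)" for v
    using Suc by (blast intro: Ck_on_SucD)
  have linB: "linear (B x)" if "x \<in> U" for x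
    using that lin AB BA by (metis linear_inverse_left linear_injective_left_inverse
        o_id comp_eq_dest_lhs eq_id_iff inj_on_def injI left_inverse_linear)
  have "\<exists>A'. \<forall>v. (\<forall>x\<in>U. ((\<lambda>x. A x v) has_derivative A' v x) (at x)) \<and> (\<forall>w. Ck_on k U (\<lambda>x. A' v x w))"
    by (rule choice) (metis Ck_on_Suc_derivative[OF Suc.prems])
  then obtain A' where A': "\<And>v x. x \<in> U \<Longrightarrow> ((\<lambda>x. A x v) has_derivative A' v x) (at x)"
    "\<And>v w. Ck_on k U (\<lambda>x. A' v x w)"
    by blast
  have ck: "Ck_on k U (\<lambda>x. A' e x w)" for e w by (rule A')
  have expand: "A u w = (\<Sum>e\<in>Basis. (w \<bullet> e) *\<^sub>R A u e)" if "u \<in> U" for u w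
    using lin[OF that] by (rule linear_eq_sum_Basis)
  define B' where "B' x w = (\<Sum>b\<in>Basis. (- (\<Sum>e\<in>Basis. (B x v \<bullet> e) * (A' e x w \<bullet> b))) *\<^sub>R B x b)" for x w
  have "((\<lambda>y. B y v) has_derivative B' x) (at x)" if x: "x \<in> U" for x
  proof -
    \<comment> \<open>The two leading terms cancel, so \<open>q b y\<close> is the
      \<open>b\<close>-coordinate of \<open>v - A y (B x v)\<close>. It vanishes at
      \<open>y = x\<close>, and \<open>B y v - B x v\<close> is the sum of the
      \<open>q b y *\<^sub>R B y b\<close>; thus continuity of \<open>B\<close> is enough to
      differentiate at \<open>x\<close>.\<close>
    define q where "q b y = (B x (A x v) - B x (A x v) + v - A y (B x v)) \<bullet> b" for b y
    have q: "q b y = (v - (\<Sum>e\<in>Basis. (B x v \<bullet> e) *\<^sub>R A y e)) \<bullet> b" if "y \<in> U" for b y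
      using expand[OF that, of "B x v"] by (simp add: q_def)
    have dq: "(q b has_derivative (\<lambda>w. - (\<Sum>e\<in>Basis. (B x v \<bullet> e) * (A' e x w \<bullet> b)))) (at x)" for b
    proof (rule has_derivative_transform_within_open[OF _ \<open>open U\<close> x])
      show "((\<lambda>y. (v - (\<Sum>e\<in>Basis. (B x v \<bullet> e) *\<^sub>R A y e)) \<bullet> b) has_derivative
          (\<lambda>w. - (\<Sum>e\<in>Basis. (B x v \<bullet> e) * (A' e x w \<bullet> b)))) (at x)"
        by (auto intro!: derivative_eq_intros A'(1)[OF x] simp: inner_sum_left inner_diff_left)
    qed (simp add: q)
    have q0: "q b x = 0" for b by (simp add: q_def AB x)
    have isB: "isCont (\<lambda>y. B y b) x" for b
      using Ck_on_imp_continuous_on[OF Bk[of b]] \<open>open U\<close> x by (simp add: continuous_on_eq_continuous_at)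
    have "((\<lambda>y. \<Sum>b\<in>Basis. q b y *\<^sub>R B y b) has_derivative B' x) (at x)"
      unfolding B'_def by (intro has_derivative_sum has_derivative_scaleR_zero dq q0 isB)
    from has_derivative_add[OF has_derivative_const this]
    have "((\<lambda>y. B x v + (\<Sum>b\<in>Basis. q b y *\<^sub>R B y b)) has_derivative B' x) (at x)"
      by simp
    then show ?thesis
    proof (rule has_derivative_transform_within_open[OF _ \<open>open U\<close> x])
      fix y assume y: "y \<in> U"
      have "(\<Sum>b\<in>Basis. q b y *\<^sub>R B y b) = B y (v - A y (B x v))"
        using linear_eq_sum_Basis[OF linB[OF y], of "v - A y (B x v)"] by (simp add: q_def)
      also have "\<dots> = B y v - B x v"
        using linB[OF y] by (simp add: linear_diff BA y)
      finally show "B x v + (\<Sum>b\<in>Basis. q b y *\<^sub>R B y b) = B y v" by simp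
    qed
  qed
  moreover have "Ck_on k U (\<lambda>x. B' x w)" for w
    unfolding B'_def
    by (intro Ck_on_sum Ck_on_bilinear[OF bounded_bilinear_scaleR] Ck_on_bilinear[OF bounded_bilinear_mult]
        Ck_on_bilinear[OF bounded_bilinear_inner] Ck_on_const Bk ck \<open>open U\<close>
        Ck_on_bounded_linear_compose[OF bounded_linear_minus[OF bounded_linear_ident]])
  ultimately show ?case using \<open>open U\<close> by (intro Ck_on_SucI) auto
qed


text \<open>The classical theorem yields a differentiable local inverse with \<open>g' y\<close> the
  inverse of \<open>f' (g y)\<close>. If \<open>g\<close> is of class \<open>C\<^sup>k\<close>, so
  is this operator family, hence also its inverse; therefore \<open>g\<close> is of class
  \<open>C\<^sup>k\<^sup>+\<^sup>1\<close>, and the induction runs through all orders.\<close>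

theorem smooth_inverse_function:
  fixes f :: "'a::euclidean_space \<Rightarrow> 'a"
  assumes U: "open U" "x0 \<in> U" and ck: "\<And>k. Ck_on k U f"
    and D: "(f has_derivative D) (at x0)" "inj D"
  obtains U' V g where "open U'" "U' \<subseteq> U" "x0 \<in> U'" "open V" "f x0 \<in> V"
    "homeomorphism U' V f g" "\<And>k. Ck_on k V g"
proof -
  define f' where "f' x = Blinfun (frechet_derivative f (at x))" for x
  have der: "(f has_derivative frechet_derivative f (at x)) (at x)" if "x \<in> U" for x
    using ck[of "Suc 0"] that unfolding Ck_on.simps frechet_derivative_works by blast
  then have f': "blinfun_apply (f' x) = frechet_derivative f (at x)" if "x \<in> U" for x
    using that unfolding f'_def
    by (intro bounded_linear_Blinfun_apply) (auto dest: has_derivative_bounded_linear)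
  have derf: "(f has_derivative blinfun_apply (f' x)) (at x)" if "x \<in> U" for x
    using der[OF that] f'[OF that] by simp
  have ckf': "Ck_on k U (\<lambda>x. blinfun_apply (f' x) v)" for k v
  proof (rule Ck_on_cong[OF U(1)])
    show "Ck_on k U (\<lambda>x. frechet_derivative f (at x) v)"
      using ck[of "Suc k"] by simp
  qed (simp add: f')
  have contf: "continuous_on U f'"
    by (intro continuous_on_blinfun_componentwise Ck_on_imp_continuous_on ckf')
  have "blinfun_apply (f' x0) = D"
    using derf[OF U(2)] D(1) by (rule has_derivative_unique)
  moreover obtain B where "linear B" and BD: "B \<circ> D = id"
    using linear_injective_left_inverse[OF has_derivative_linear[OF D(1)] D(2)] by blast
  ultimately have "Blinfun B o\<^sub>L f' x0 = id_blinfun"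
    by (intro blinfun_eqI)
      (simp add: bounded_linear_Blinfun_apply linear_conv_bounded_linear o_def fun_eq_iff)
  then obtain U' V g g' where "open U'" "U' \<subseteq> U" "x0 \<in> U'" and V: "open V" "f x0 \<in> V"
    and hom: "homeomorphism U' V f g"
    and dg: "\<And>y. y \<in> V \<Longrightarrow> (g has_derivative g' y) (at y)"
    and g': "\<And>y. y \<in> V \<Longrightarrow> g' y = inv (blinfun_apply (f' (g y)))"
    and bij: "\<And>y. y \<in> V \<Longrightarrow> bij (blinfun_apply (f' (g y)))"
    using inverse_function_theorem[OF U(1) derf contf U(2)] by metis
  have gV: "g ` V \<subseteq> U"
    using homeomorphism_image2[OF hom] \<open>U' \<subseteq> U\<close> by simp
  have "Ck_on k V g" for k
  proof (induction k)
    case 0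
    then show ?case using homeomorphism_cont2[OF hom] by simp
  next
    case (Suc k)
    show ?case
    proof (rule Ck_on_SucI[OF V(1) dg])
      fix v
      show "Ck_on k V (\<lambda>y. g' y v)"
      proof (rule Ck_on_inverse_operator[OF V(1), of "\<lambda>y. blinfun_apply (f' (g y))"])
        show "Ck_on k V (\<lambda>y. blinfun_apply (f' (g y)) v)" for v
          by (rule Ck_on_compose[OF V(1) U(1) gV Suc ckf'])
      qed (simp_all add: g' bij bij_is_inj bij_is_surj surj_f_inv_f bounded_linear.linear
          blinfun.bounded_linear_right)
    qed
  qed
  with \<open>open U'\<close> \<open>U' \<subseteq> U\<close> \<open>x0 \<in> U'\<close> V hom show thesis by (intro that)
qed


section \<open>Calculus of smooth maps on arbitrary sets\<close>

lemma smooth_onD: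
  assumes "smooth_on A f" "x \<in> A"
  shows "\<exists>U g. open U \<and> x \<in> U \<and> (\<forall>k. Ck_on k U g) \<and> (\<forall>y\<in>A \<inter> U. g y = f y)"
  using assms unfolding smooth_on_def by (rule bspec)

lemma smooth_on_open: "open U \<Longrightarrow> (\<And>k. Ck_on k U f) \<Longrightarrow> smooth_on U f"
  unfolding smooth_on_def by (intro ballI exI[of _ U] exI[of _ f]) auto

lemma smooth_on_subset:
  assumes "smooth_on B f" "A \<subseteq> B"
  shows "smooth_on A f"
  unfolding smooth_on_def
proof
  fix x assume "x \<in> A"
  with assms(2) have "x \<in> B" by blast
  from smooth_onD[OF assms(1) this] obtain U g where
    "open U" "x \<in> U" "\<And>k. Ck_on k U g" "\<And>y. y \<in> B \<Longrightarrow> y \<in> U \<Longrightarrow> g y = f y"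
    by blast
  then show "\<exists>U g. open U \<and> x \<in> U \<and> (\<forall>k. Ck_on k U g) \<and> (\<forall>y\<in>A \<inter> U. g y = f y)"
    using assms(2) by (intro exI[of _ U] exI[of _ g]) auto
qed

lemma smooth_on_cong:
  assumes "smooth_on A f" "\<And>x. x \<in> A \<Longrightarrow> f x = g x"
  shows "smooth_on A g"
  unfolding smooth_on_def
proof
  fix x assume "x \<in> A"
  from smooth_onD[OF assms(1) this] obtain U h where
    "open U" "x \<in> U" "\<And>k. Ck_on k U h" "\<And>y. y \<in> A \<Longrightarrow> y \<in> U \<Longrightarrow> h y = f y"
    by blast
  then show "\<exists>U h. open U \<and> x \<in> U \<and> (\<forall>k. Ck_on k U h) \<and> (\<forall>y\<in>A \<inter> U. h y = g y)"
    using assms(2) by (intro exI[of _ U] exI[of _ h]) auto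
qed

lemma smooth_on_local:
  assumes "\<And>x. x \<in> A \<Longrightarrow> \<exists>B. openin (top_of_set A) B \<and> x \<in> B \<and> smooth_on B f"
  shows "smooth_on A f"
  unfolding smooth_on_def
proof
  fix x assume x: "x \<in> A"
  then obtain T where T: "open T" "x \<in> T" "smooth_on (A \<inter> T) f"
    using assms[OF x] unfolding openin_open by blast
  then obtain U g where g: "open U" "x \<in> U" "\<And>k. Ck_on k U g" "\<And>y. y \<in> A \<inter> T \<Longrightarrow> y \<in> U \<Longrightarrow> g y = f y"
    using smooth_onD[OF T(3), of x] x by blast
  then show "\<exists>U g. open U \<and> x \<in> U \<and> (\<forall>k. Ck_on k U g) \<and> (\<forall>y\<in>A \<inter> U. g y = f y)"
    using T by (intro exI[of _ "U \<inter> T"] exI[of _ g]) (auto intro: Ck_on_subset)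
qed

lemma smooth_on_imp_continuous_on:
  assumes "smooth_on A f"
  shows "continuous_on A f"
  unfolding continuous_on_eq_continuous_within
proof
  fix x assume x: "x \<in> A"
  obtain U g where g: "open U" "x \<in> U" "\<And>k. Ck_on k U g" "\<And>y. y \<in> A \<Longrightarrow> y \<in> U \<Longrightarrow> g y = f y"
    using smooth_onD[OF assms x] by blast
  then have "continuous_on (A \<inter> U) f"
    using continuous_on_subset[OF Ck_on_imp_continuous_on[OF g(3)] inf_le2]
    by (intro continuous_on_eq[of "A \<inter> U" g f]) auto
  then have "continuous (at x within A \<inter> U) f"
    using g(2) x by (simp add: continuous_on_eq_continuous_within)
  moreover have "at x within A \<inter> U = at x within A"
    using at_within_nhd[OF g(2,1), of "A \<inter> U" A] by blast
  ultimately show "continuous (at x within A) f" by simp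
qed

lemma smooth_on_compose:
  fixes f :: "'a::euclidean_space \<Rightarrow> 'b::euclidean_space"
  assumes "smooth_on A f" "smooth_on B g" "f ` A \<subseteq> B"
  shows "smooth_on A (\<lambda>x. g (f x))"
  unfolding smooth_on_def
proof
  fix x assume x: "x \<in> A"
  obtain U f0 where f0: "open U" "x \<in> U" "\<And>k. Ck_on k U f0" "\<And>y. y \<in> A \<Longrightarrow> y \<in> U \<Longrightarrow> f0 y = f y"
    using smooth_onD[OF assms(1) x] by blast
  have fx: "f x \<in> B" using x assms(3) by auto
  obtain V g0 where g0: "open V" "f x \<in> V" "\<And>k. Ck_on k V g0" "\<And>y. y \<in> B \<Longrightarrow> y \<in> V \<Longrightarrow> g0 y = g y"
    using smooth_onD[OF assms(2) fx] by blast
  define W where "W = U \<inter> f0 -` V"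
  have W: "open W" unfolding W_def
    using Ck_on_imp_continuous_on[OF f0(3)] f0(1) g0(1) by (intro continuous_open_preimage)
  have "Ck_on k W (\<lambda>x. g0 (f0 x))" for k
    using W g0(1) by (rule Ck_on_compose[OF _ _ _ Ck_on_subset[OF f0(3)] g0(3)]) (auto simp: W_def)
  moreover have "x \<in> W" using f0(2,4) g0(2) x by (simp add: W_def)
  moreover have "g0 (f0 y) = g (f y)" if "y \<in> A \<inter> W" for y
    using that f0(4) g0(4) assms(3) by (auto simp: W_def image_subset_iff)
  ultimately show "\<exists>U h. open U \<and> x \<in> U \<and> (\<forall>k. Ck_on k U h) \<and> (\<forall>y\<in>A \<inter> U. h y = g (f y))"
    using W by blast
qed

lemma smooth_on_bilinear:
  assumes p: "bounded_bilinear p" and "smooth_on A f" "smooth_on A g"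
  shows "smooth_on A (\<lambda>x. p (f x) (g x))"
  unfolding smooth_on_def
proof
  fix x assume x: "x \<in> A"
  obtain U f0 where f0: "open U" "x \<in> U" "\<And>k. Ck_on k U f0" "\<And>y. y \<in> A \<Longrightarrow> y \<in> U \<Longrightarrow> f0 y = f y"
    using smooth_onD[OF assms(2) x] by blast
  obtain V g0 where g0: "open V" "x \<in> V" "\<And>k. Ck_on k V g0" "\<And>y. y \<in> A \<Longrightarrow> y \<in> V \<Longrightarrow> g0 y = g y"
    using smooth_onD[OF assms(3) x] by blast
  show "\<exists>U h. open U \<and> x \<in> U \<and> (\<forall>k. Ck_on k U h) \<and> (\<forall>y\<in>A \<inter> U. h y = p (f y) (g y))"
    using f0 g0
    by (intro exI[of _ "U \<inter> V"] exI[of _ "\<lambda>x. p (f0 x) (g0 x)"])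
      (auto intro!: Ck_on_bilinear[OF p] intro: Ck_on_subset)
qed

lemma smooth_on_add:
  assumes "smooth_on A f" "smooth_on A g"
  shows "smooth_on A (\<lambda>x. f x + g x)"
  unfolding smooth_on_def
proof
  fix x assume x: "x \<in> A"
  obtain U f0 where f0: "open U" "x \<in> U" "\<And>k. Ck_on k U f0" "\<And>y. y \<in> A \<Longrightarrow> y \<in> U \<Longrightarrow> f0 y = f y"
    using smooth_onD[OF assms(1) x] by blast
  obtain V g0 where g0: "open V" "x \<in> V" "\<And>k. Ck_on k V g0" "\<And>y. y \<in> A \<Longrightarrow> y \<in> V \<Longrightarrow> g0 y = g y"
    using smooth_onD[OF assms(2) x] by blast
  show "\<exists>U h. open U \<and> x \<in> U \<and> (\<forall>k. Ck_on k U h) \<and> (\<forall>y\<in>A \<inter> U. h y = f y + g y)"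
    using f0 g0
    by (intro exI[of _ "U \<inter> V"] exI[of _ "\<lambda>x. f0 x + g0 x"])
      (auto intro!: Ck_on_add intro: Ck_on_subset)
qed

lemma smooth_on_const: "smooth_on A (\<lambda>x. c)"
  by (rule smooth_on_subset[OF smooth_on_open[OF open_UNIV Ck_on_const[OF open_UNIV]] subset_UNIV])

lemma smooth_on_bounded_linear: "bounded_linear h \<Longrightarrow> smooth_on A h"
  by (rule smooth_on_subset[OF smooth_on_open[OF open_UNIV Ck_on_bounded_linear[OF _ open_UNIV]]
        subset_UNIV])

lemma smooth_on_ident: "smooth_on A (\<lambda>x. x)"
  by (rule smooth_on_bounded_linear) (rule bounded_linear_ident)

lemma smooth_on_bounded_linear_compose:
  fixes f :: "'a::euclidean_space \<Rightarrow> 'b::euclidean_space"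
  shows "bounded_linear h \<Longrightarrow> smooth_on A f \<Longrightarrow> smooth_on A (\<lambda>x. h (f x))"
  using smooth_on_compose[of A f UNIV h] smooth_on_bounded_linear[of h UNIV] by simp

lemma smooth_on_diff:
  fixes f g :: "'a::euclidean_space \<Rightarrow> 'b::euclidean_space"
  assumes "smooth_on A f" "smooth_on A g"
  shows "smooth_on A (\<lambda>x. f x - g x)"
  using smooth_on_add[OF assms(1) smooth_on_bounded_linear_compose[OF
        bounded_linear_minus[OF bounded_linear_ident] assms(2)]]
  by (simp only: diff_conv_add_uminus)

lemma smooth_on_scaleR:
  fixes f :: "'a::euclidean_space \<Rightarrow> 'b::euclidean_space"
  shows "smooth_on A f \<Longrightarrow> smooth_on A (\<lambda>x. c *\<^sub>R f x)"
  by (rule smooth_on_bounded_linear_compose[OF bounded_linear_scaleR_right])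

lemma smooth_on_derivative:
  assumes "smooth_on A f" "x \<in> A"
  obtains D where "(f has_derivative D) (at x within A)"
proof -
  obtain U g where g: "open U" "x \<in> U" "\<And>k. Ck_on k U g" "\<And>y. y \<in> A \<Longrightarrow> y \<in> U \<Longrightarrow> g y = f y"
    using smooth_onD[OF assms] by blast
  obtain g' where "\<And>x. x \<in> U \<Longrightarrow> (g has_derivative g' x) (at x)"
    using g(3)[of "Suc 0"] by (rule Ck_on_Suc_derivative) blast
  then have "(g has_derivative g' x) (at x within A)"
    using g(2) has_derivative_at_withinI by blast
  moreover obtain d where "d > 0" "ball x d \<subseteq> U"
    using g(1,2) openE by blast
  ultimately have "(f has_derivative g' x) (at x within A)"
    using assms(2) g(4) by (intro has_derivative_transform_within[of g _ x A d f])
      (auto simp: subset_iff dist_commute)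
  then show thesis by (rule that)
qed


subsection \<open>Derivatives along relatively open subsets of subspaces\<close>

text \<open>The line \<open>t \<mapsto> x + t *\<^sub>R v\<close> stays in \<open>A\<close> for
  small \<open>t\<close>, which reduces the claim to uniqueness of derivatives in one real
  variable.\<close>

lemma has_derivative_unique_on_subspace:
  assumes A: "openin (top_of_set S) A" "subspace S" "x \<in> A"
    and D: "(f has_derivative D) (at x within A)" "(f has_derivative D') (at x within A)"
    and v: "v \<in> S"
  shows "D v = D' v"
proof -
  obtain T where T: "open T" "A = S \<inter> T" using A(1) by (auto simp: openin_open)
  define I where "I = (\<lambda>t::real. x + t *\<^sub>R v) -` T"
  have "open I" unfolding I_def by (intro open_vimage T continuous_intros)
  have "0 \<in> I" using A(3) T by (simp add: I_def)
  have im: "(\<lambda>t::real. x + t *\<^sub>R v) ` I \<subseteq> A"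
    using A(2,3) v T by (auto simp: I_def intro!: subspace_add subspace_scale)
  have "((\<lambda>t. f (x + t *\<^sub>R v)) has_derivative (\<lambda>t. E (t *\<^sub>R v))) (at 0)"
    if E: "(f has_derivative E) (at x within A)" for E
  proof -
    have "((\<lambda>t::real. x + t *\<^sub>R v) has_derivative (\<lambda>t. 0 + t *\<^sub>R v)) (at 0 within I)"
      by (intro has_derivative_add has_derivative_const has_derivative_scaleR_left has_derivative_ident)
    then have "((\<lambda>t::real. x + t *\<^sub>R v) has_derivative (\<lambda>t. t *\<^sub>R v)) (at 0 within I)"
      by simp
    moreover have "(f has_derivative E) (at (x + 0 *\<^sub>R v) within (\<lambda>t::real. x + t *\<^sub>R v) ` I)"
      using has_derivative_subset[OF E im] by simp
    ultimately show ?thesis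
      using diff_chain_within[of "\<lambda>t::real. x + t *\<^sub>R v" "\<lambda>t. t *\<^sub>R v" 0 I f E]
      unfolding o_def at_within_open[OF \<open>0 \<in> I\<close> \<open>open I\<close>] by blast
  qed
  from has_derivative_unique[OF this[OF D(1)] this[OF D(2)]]
  have "D (1 *\<^sub>R v) = D' (1 *\<^sub>R v)" by (rule fun_cong)
  then show ?thesis by simp
qed

text \<open>If \<open>L\<close> is a right inverse of \<open>D\<close>, then \<open>z \<mapsto> f (x + L z)\<close> is a local diffeomorphism of \<open>T\<close>
  at \<open>0\<close>; it is extended to the whole space by the identity on a complement of \<open>T\<close>.\<close>

theorem smooth_local_section:
  fixes f :: "'e::euclidean_space \<Rightarrow> 'f::euclidean_space"
  assumes A: "openin (top_of_set S) A" and S: "subspace S" and T: "subspace T"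
    and f: "smooth_on A f" "f ` A \<subseteq> T" and x: "x \<in> A"
    and D: "(f has_derivative D) (at x within A)" "D ` S = T"
  obtains V s where "openin (top_of_set T) V" "f x \<in> V" "smooth_on V s" "s ` V \<subseteq> A"
    "s (f x) = x" "\<And>y. y \<in> V \<Longrightarrow> f (s y) = y"
proof -
  obtain O1 where O1: "open O1" "A = S \<inter> O1" using A by (auto simp: openin_open)
  obtain W g where W: "open W" "x \<in> W" and g: "\<And>k. Ck_on k W g" "\<And>y. y \<in> A \<Longrightarrow> y \<in> W \<Longrightarrow> g y = f y"
    using smooth_onD[OF f(1) x] by blast
  obtain g' where g': "\<And>x. x \<in> W \<Longrightarrow> (g has_derivative g' x) (at x)"
    using g(1)[of "Suc 0"] by (rule Ck_on_Suc_derivative) blast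
  obtain d where d: "d > 0" "ball x d \<subseteq> W" using W openE by blast
  have "(g has_derivative D) (at x within A)"
    using d g(2) x by (intro has_derivative_transform_within[OF D(1) d(1)])
      (auto simp: subset_iff dist_commute)
  \<comment> \<open>\<open>g'\<close> belongs to an extension of \<open>f\<close> and may differ
    from \<open>D\<close> off \<open>S\<close>. Agreement on \<open>S\<close> suffices because
    \<open>L\<close> takes values in \<open>S\<close>.\<close>
  then have gD: "g' x v = D v" if "v \<in> S" for v
    using has_derivative_unique_on_subspace[OF A S x _ _ that] g'[OF W(2)]
      has_derivative_at_withinI by metis
  obtain L where L: "range L \<subseteq> S" "linear L" "\<And>v. v \<in> T \<Longrightarrow> D (L v) = v"
    using linear_exists_right_inverse_on[OF has_derivative_linear[OF D(1)] S] D(2) by auto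
  obtain P where P: "range P \<subseteq> T" "linear P" "\<And>v. v \<in> T \<Longrightarrow> P v = v"
    using linear_exists_left_inverse_on[OF linear_id T] by auto
  define h where "h z = x + L (P z)" for z
  define G where "G z = g (h z) + (z - P z)" for z
  define U where "U = h -` (W \<inter> O1)"
  have bl: "bounded_linear L" "bounded_linear P" using L P by (simp_all add: linear_conv_bounded_linear)
  have ckh: "Ck_on k UNIV h" for k unfolding h_def
    by (intro Ck_on_add Ck_on_const Ck_on_bounded_linear_compose[OF bl(1)] Ck_on_bounded_linear bl) auto
  have "open U" unfolding U_def
    using W(1) O1(1) Ck_on_imp_continuous_on[OF ckh] by (intro open_vimage) auto
  have h0: "h 0 = x" using L P by (simp add: h_def linear_0)
  then have "0 \<in> U" using W x O1 by (simp add: U_def)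
  have ckG: "Ck_on k U G" for k unfolding G_def diff_conv_add_uminus
    by (intro Ck_on_add Ck_on_compose[OF \<open>open U\<close> W(1) _ _ g(1)] Ck_on_subset[OF ckh] \<open>open U\<close>
        Ck_on_bounded_linear bounded_linear_ident bounded_linear_minus bl) (auto simp: U_def)
  have hd: "(h has_derivative (\<lambda>v. L (P v))) (at 0)"
    unfolding h_def using bounded_linear_compose[OF bl]
    by (auto intro!: derivative_eq_intros bounded_linear_imp_has_derivative)
  have "(g has_derivative g' x) (at (h 0))" using g' W(2) h0 by simp
  from has_derivative_compose[OF hd this]
  have "(G has_derivative (\<lambda>v. g' x (L (P v)) + (v - P v))) (at 0)"
    unfolding G_def by (intro has_derivative_add has_derivative_diff has_derivative_ident
        bounded_linear_imp_has_derivative bl)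
  moreover have "g' x (L (P v)) = P v" for v
  proof -
    have "L (P v) \<in> S" "P v \<in> T" using L(1) P(1) by auto
    then show ?thesis using gD L(3) by simp
  qed
  ultimately have "(G has_derivative (\<lambda>v. v)) (at 0)" by simp
  moreover have "inj (\<lambda>v::'f. v)" by (rule injI)
  ultimately obtain U' V k where U': "open U'" "U' \<subseteq> U" "0 \<in> U'" and V: "open V" "G 0 \<in> V"
    and hom: "homeomorphism U' V G k" and ckk: "\<And>m. Ck_on m V k"
    using smooth_inverse_function[OF \<open>open U\<close> \<open>0 \<in> U\<close> ckG] by metis
  have G0: "G 0 = f x" using P W(2) x h0 g(2) by (simp add: G_def linear_0)
  have hS: "h z \<in> A" if "z \<in> U" for z
    using that x O1 L(1) S by (auto simp: U_def h_def intro!: subspace_add)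
  have kU: "k y \<in> U" if "y \<in> V" for y
    using homeomorphism_image2[OF hom] U'(2) that by blast
  show thesis
  proof (rule that[of "T \<inter> V" "h \<circ> k"])
    show "openin (top_of_set T) (T \<inter> V)" using V(1) by (rule openin_open_Int)
    show "f x \<in> T \<inter> V" using V(2) G0 f(2) x by auto
    have "smooth_on V (\<lambda>y. h (k y))"
      using smooth_on_compose[OF smooth_on_open[OF V(1) ckk] smooth_on_open[OF open_UNIV ckh]] by simp
    then show "smooth_on (T \<inter> V) (h \<circ> k)" unfolding o_def by (rule smooth_on_subset) simp
    show "(h \<circ> k) ` (T \<inter> V) \<subseteq> A" using kU hS by auto
    show "(h \<circ> k) (f x) = x"
      using homeomorphism_apply1[OF hom U'(3)] G0 h0 by simp
    show "f ((h \<circ> k) y) = y" if y: "y \<in> T \<inter> V" for y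
    proof -
      define z where "z = k y"
      have z: "z \<in> U" using kU y by (simp add: z_def)
      have gz: "g (h z) = f (h z)" using g(2) hS[OF z] z by (simp add: U_def)
      have "G z = y" using homeomorphism_apply2[OF hom] y by (simp add: z_def)
      \<comment> \<open>The vector \<open>z - P z\<close> lies in the kernel of the projection
        \<open>P\<close>, and by this equation also in its range \<open>T\<close>, since
        \<open>y\<close> and \<open>f (h z)\<close> do. So it vanishes, which says
        \<open>f (h z) = y\<close>.\<close>
      then have eq: "z - P z = y - f (h z)" by (simp add: G_def gz algebra_simps)
      also have "\<dots> \<in> T" using y f(2) hS[OF z] T by (auto intro!: subspace_diff)
      finally have "z - P z = P (z - P z)" using P(3) by simp
      also have "\<dots> = 0"
      proof -
        have "P (P z) = P z" by (rule P(3)) (use P(1) in auto)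
        then show ?thesis using P(2) by (simp add: linear_diff)
      qed
      finally show ?thesis using eq by (simp add: z_def)
    qed
  qed
qed

text \<open>With a right inverse \<open>L\<close> of \<open>D\<close>, the map \<open>y - L (D y) + L (f y)\<close> has derivative \<open>id\<close> at \<open>x\<close>
  and \<open>D\<close> sends it to \<open>f y\<close>.\<close>

theorem smooth_straightening:
  fixes f :: "'e::euclidean_space \<Rightarrow> 'f::euclidean_space"
  assumes U: "open U" "x \<in> U" and ck: "\<And>k. Ck_on k U f" and fT: "f ` U \<subseteq> range D"
    and D: "(f has_derivative D) (at x)"
  obtains U' V \<psi> g where "open U'" "U' \<subseteq> U" "x \<in> U'" "open V" "homeomorphism U' V \<psi> g"
    "\<And>k. Ck_on k U' \<psi>" "\<And>k. Ck_on k V g" "\<And>y. y \<in> U' \<Longrightarrow> D (\<psi> y) = f y"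
proof -
  have blD: "bounded_linear D" using D by (rule has_derivative_bounded_linear)
  have linD: "linear D" using D by (rule has_derivative_linear)
  obtain L where L: "linear L" "\<And>v. v \<in> range D \<Longrightarrow> D (L v) = v"
    using linear_exists_right_inverse_on[OF linD subspace_UNIV] by auto
  have blL: "bounded_linear L" using L by (simp add: linear_conv_bounded_linear)
  define \<psi> where "\<psi> y = y + L (f y - D y)" for y
  have ck\<psi>: "Ck_on k U \<psi>" for k unfolding \<psi>_def diff_conv_add_uminus
    by (intro Ck_on_add Ck_on_bounded_linear_compose[OF blL] Ck_on_bounded_linear
        bounded_linear_ident bounded_linear_minus blD ck U)
  have "(\<psi> has_derivative (\<lambda>v. v + L (D v - D v))) (at x)"
    unfolding \<psi>_def
    by (intro has_derivative_add has_derivative_diff has_derivative_ident D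
        bounded_linear.has_derivative[OF blL] bounded_linear_imp_has_derivative blD)
  then have "(\<psi> has_derivative (\<lambda>v. v)) (at x)" using L by (simp add: linear_0)
  moreover have "inj (\<lambda>v::'e. v)" by (rule injI)
  ultimately obtain U' V g where 1: "open U'" "U' \<subseteq> U" "x \<in> U'" "open V" "\<psi> x \<in> V"
    "homeomorphism U' V \<psi> g" "\<And>k. Ck_on k V g"
    using smooth_inverse_function[OF U ck\<psi>] by metis
  have "D (\<psi> y) = f y" if "y \<in> U" for y
  proof -
    obtain w where "f y = D w" using fT \<open>y \<in> U\<close> by blast
    then have "f y - D y = D (w - y)" using linD by (simp add: linear_diff)
    then have "D (L (f y - D y)) = f y - D y" by (intro L(2)) simp
    then show ?thesis using linD by (simp add: \<psi>_def linear_add)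
  qed
  with 1 show thesis
    by (intro that[of U' V \<psi> g]) (auto intro: Ck_on_subset[OF ck\<psi>])
qed


subsection \<open>Smoothness of matrix operations\<close>

lemma bounded_bilinear_matrix_mult:
  "bounded_bilinear ((**) :: real^'n^'m \<Rightarrow> real^'k^'n \<Rightarrow> real^'k^'m)"
  unfolding bilinear_conv_bounded_bilinear[symmetric] bilinear_def
  by (intro conjI allI linearI)
    (simp_all add: matrix_matrix_mult_def vec_eq_iff sum.distrib sum_distrib_left algebra_simps)

lemma bounded_linear_transpose: "bounded_linear (transpose :: real^'n^'m \<Rightarrow> real^'m^'n)"
  unfolding linear_conv_bounded_linear[symmetric]
  by (auto intro!: linearI simp: transpose_def vec_eq_iff)

lemmas smooth_on_matrix_mult = smooth_on_bilinear[OF bounded_bilinear_matrix_mult]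
lemmas smooth_on_transpose = smooth_on_bounded_linear_compose[OF bounded_linear_transpose]

lemmas matrix_mult_algebra =
  bounded_bilinear.add_left[OF bounded_bilinear_matrix_mult]
  bounded_bilinear.add_right[OF bounded_bilinear_matrix_mult]
  bounded_bilinear.diff_left[OF bounded_bilinear_matrix_mult]
  bounded_bilinear.diff_right[OF bounded_bilinear_matrix_mult]
  bounded_bilinear.minus_left[OF bounded_bilinear_matrix_mult]
  bounded_bilinear.minus_right[OF bounded_bilinear_matrix_mult]
  bounded_bilinear.scaleR_left[OF bounded_bilinear_matrix_mult]
  bounded_bilinear.scaleR_right[OF bounded_bilinear_matrix_mult]

lemmas transpose_algebra =
  linear_add[OF bounded_linear.linear[OF bounded_linear_transpose]]
  linear_diff[OF bounded_linear.linear[OF bounded_linear_transpose]]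
  linear_neg[OF bounded_linear.linear[OF bounded_linear_transpose]]
  linear_scale[OF bounded_linear.linear[OF bounded_linear_transpose]]
  linear_0[OF bounded_linear.linear[OF bounded_linear_transpose]]
  matrix_transpose_mul transpose_mat transpose_transpose

section \<open>Matrix inversion as a smooth map\<close>

lemma matrix_inv_mult:
  fixes A :: "real^'n^'n"
  assumes "invertible A"
  shows "A ** matrix_inv A = mat 1" "matrix_inv A ** A = mat 1"
  using assms unfolding invertible_def matrix_inv_def by (metis (mono_tags, lifting) someI_ex)+

lemma open_invertible: "open {A :: real^'n^'n. invertible A}"
proof -
  have "continuous_on UNIV (det :: real^'n^'n \<Rightarrow> real)"
    unfolding det_def by (intro continuous_intros)
  then have "open ((det :: real^'n^'n \<Rightarrow> real) -` (- {0}))"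
    by (intro open_vimage) auto
  then show ?thesis by (simp add: invertible_det_nz vimage_def)
qed

text \<open>Left multiplication by \<open>A\<close> is an operator family depending linearly on
  \<open>A\<close>, with inverse family \<open>X \<mapsto> matrix_inv A ** X\<close>. Evaluating the
  latter at \<open>mat 1\<close> recovers \<open>matrix_inv A\<close>.\<close>

lemma smooth_on_matrix_inv:
  fixes f :: "'a::euclidean_space \<Rightarrow> real^'n^'n"
  assumes "smooth_on A f" "\<And>x. x \<in> A \<Longrightarrow> invertible (f x)"
  shows "smooth_on A (\<lambda>x. matrix_inv (f x))"
proof (rule smooth_on_compose[OF assms(1)])
  let ?I = "{A :: real^'n^'n. invertible A}"
  have "Ck_on k ?I (\<lambda>A. matrix_inv A ** mat 1)" for k
  proof (rule Ck_on_inverse_operator[OF open_invertible, of "(**)"])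
    show "Ck_on k ?I (\<lambda>A. A ** X)" for X :: "real^'n^'n"
      by (intro Ck_on_bounded_linear bounded_bilinear.bounded_linear_left[OF bounded_bilinear_matrix_mult]
          open_invertible)
    show "linear ((**) A)" for A :: "real^'n^'n"
      by (intro bounded_linear.linear bounded_bilinear.bounded_linear_right[OF bounded_bilinear_matrix_mult])
  qed (simp_all add: matrix_mul_assoc matrix_inv_mult)
  then show "smooth_on ?I matrix_inv" by (intro smooth_on_open open_invertible) simp
qed (use assms(2) in auto)


section \<open>Embedded charts\<close>

lemma chart_on_dom: "chart_on X c \<Longrightarrow> chart_dom c \<subseteq> topspace X"
  unfolding chart_on_def using openin_subset by blast

lemma chart_on_image: "chart_on X c \<Longrightarrow> chart_map c ` chart_dom c \<subseteq> chart_model c"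
  unfolding chart_on_def using openin_imp_subset by blast

lemma chart_on_inj: "chart_on X c \<Longrightarrow> inj_on (chart_map c) (chart_dom c)"
  using chart_on_dom[of X c] unfolding chart_on_def homeomorphic_map_def
  by (metis inf.absorb_iff2 topspace_subtopology)

lemma chart_inv_map [simp]: "chart_on X c \<Longrightarrow> x \<in> chart_dom c \<Longrightarrow> chart_inv c (chart_map c x) = x"
  unfolding chart_inv_def by (intro inv_into_f_f chart_on_inj)

lemma chart_inv_in_dom: "y \<in> chart_map c ` chart_dom c \<Longrightarrow> chart_inv c y \<in> chart_dom c"
  unfolding chart_inv_def by (rule inv_into_into)

lemma chart_on_open_image:
  assumes c: "chart_on X c" and W: "openin X W" "W \<subseteq> chart_dom c"
  shows "openin (top_of_set (chart_model c)) (chart_map c ` W)"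
proof -
  have "open_map (subtopology X (chart_dom c)) (top_of_set (chart_map c ` chart_dom c)) (chart_map c)"
    using c unfolding chart_on_def by (blast intro: homeomorphic_imp_open_map)
  moreover have "openin (subtopology X (chart_dom c)) W"
    using W by (auto simp: openin_subtopology)
  ultimately have "openin (top_of_set (chart_map c ` chart_dom c)) (chart_map c ` W)"
    unfolding open_map_def by blast
  then show ?thesis
    using c unfolding chart_on_def by (blast intro: openin_trans)
qed

text \<open>Smoothness is demanded of the chart and its inverse in the ambient Euclidean spaces, so
  that transition maps become compositions of smooth maps. The model type is independent of the
  ambient type.\<close>

definition embedded_chart :: "'a::euclidean_space set \<Rightarrow> ('a, 'e::euclidean_space) chart \<Rightarrow> bool" where
  "embedded_chart S c \<longleftrightarrow> chart_on (top_of_set S) c \<and> smooth_on (chart_dom c) (chart_map c) \<and>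
     smooth_on (chart_map c ` chart_dom c) (chart_inv c)"

lemma embedded_chartD:
  assumes "embedded_chart S c"
  shows "chart_on (top_of_set S) c" "smooth_on (chart_dom c) (chart_map c)"
    "smooth_on (chart_map c ` chart_dom c) (chart_inv c)" "subspace (chart_model c)"
    "openin (top_of_set S) (chart_dom c)" "chart_dom c \<subseteq> S"
    "openin (top_of_set (chart_model c)) (chart_map c ` chart_dom c)"
  using assms chart_on_dom[of "top_of_set S" c] unfolding embedded_chart_def chart_on_def by auto

lemma embedded_chartI:
  fixes h :: "'a::euclidean_space \<Rightarrow> 'e::euclidean_space"
  assumes D: "openin (top_of_set S) D" and F: "subspace F" "openin (top_of_set F) (h ` D)"
    and h: "smooth_on D h" and g: "smooth_on (h ` D) g" "\<And>x. x \<in> D \<Longrightarrow> g (h x) = x"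
  shows "embedded_chart S (Chart D h F)"
proof -
  have inj: "inj_on h D" using g(2) by (rule inj_on_inverseI)
  have inv: "g y = inv_into D h y" if "y \<in> h ` D" for y
    using that g(2) inj by auto
  have "D \<subseteq> S" using D openin_imp_subset by blast
  then have sub: "subtopology (top_of_set S) D = top_of_set D"
    by (simp add: subtopology_subtopology Int_absorb1)
  have "homeomorphic_maps (top_of_set D) (top_of_set (h ` D)) h g"
    using smooth_on_imp_continuous_on[OF h] smooth_on_imp_continuous_on[OF g(1)] g(2)
    by (auto simp: homeomorphic_maps_def)
  then have "homeomorphic_map (top_of_set D) (top_of_set (h ` D)) h"
    by (rule homeomorphic_maps_imp_map)
  then have "chart_on (top_of_set S) (Chart D h F)"
    using D F by (simp add: chart_on_def sub)
  moreover have "smooth_on (h ` D) (chart_inv (Chart D h F))"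
    using smooth_on_cong[OF g(1)] inv by (simp add: chart_inv_def)
  ultimately show ?thesis using h by (simp add: embedded_chart_def)
qed

section \<open>Restricting, re-modelling and comparing embedded charts\<close>

lemma embedded_chart_slice:
  assumes c: "embedded_chart S c" and S': "S' \<subseteq> S" and F: "subspace F" "F \<subseteq> chart_model c"
    and slice: "chart_map c ` (chart_dom c \<inter> S') = chart_map c ` chart_dom c \<inter> F"
  shows "embedded_chart S' (Chart (chart_dom c \<inter> S') (chart_map c) F)"
proof (rule embedded_chartI[where g = "chart_inv c"])
  note cD = embedded_chartD[OF c]
  obtain T where "open T" "chart_dom c = S \<inter> T" using cD(5) by (auto simp: openin_open)
  then show "openin (top_of_set S') (chart_dom c \<inter> S')"
    using S' by (auto simp: openin_open)
  obtain O1 where "open O1" "chart_map c ` chart_dom c = chart_model c \<inter> O1"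
    using cD(7) by (auto simp: openin_open)
  then show "openin (top_of_set F) (chart_map c ` (chart_dom c \<inter> S'))"
    using F(2) unfolding slice openin_open by blast
  show "smooth_on (chart_dom c \<inter> S') (chart_map c)"
    using cD(2) by (rule smooth_on_subset) simp
  show "smooth_on (chart_map c ` (chart_dom c \<inter> S')) (chart_inv c)"
    using cD(3) by (rule smooth_on_subset) auto
  show "chart_inv c (chart_map c x) = x" if "x \<in> chart_dom c \<inter> S'" for x
    using cD(1) that by simp
qed (rule F)

text \<open>Changes the type in which the model space lives: a linear left inverse of
  \<open>h\<close> on the model undoes the change smoothly.\<close>

lemma embedded_chart_linear:
  fixes h :: "'e::euclidean_space \<Rightarrow> 'f::euclidean_space"
  assumes c: "embedded_chart S c" and h: "linear h" "inj_on h (chart_model c)"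
  shows "embedded_chart S (Chart (chart_dom c) (h \<circ> chart_map c) (h ` chart_model c))"
proof -
  note cD = embedded_chartD[OF c]
  have im: "chart_map c ` chart_dom c \<subseteq> chart_model c" using chart_on_image[OF cD(1)] .
  obtain g where g: "linear g" "\<And>v. v \<in> chart_model c \<Longrightarrow> g (h v) = v"
    using linear_exists_left_inverse_on[OF h(1) cD(4) h(2)] by auto
  have bl: "bounded_linear h" "bounded_linear g"
    using h g by (simp_all add: linear_conv_bounded_linear)
  obtain T where T: "open T" "chart_map c ` chart_dom c = chart_model c \<inter> T"
    using cD(7) by (auto simp: openin_open)
  show ?thesis
  proof (rule embedded_chartI[where g = "\<lambda>y. chart_inv c (g y)"])
    have "h ` (chart_model c \<inter> T) = h ` chart_model c \<inter> g -` T" using g(2) by auto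
    moreover have "open (g -` T)"
      using T(1) by (intro open_vimage) (auto simp: linear_continuous_on bl)
    ultimately show "openin (top_of_set (h ` chart_model c)) ((h \<circ> chart_map c) ` chart_dom c)"
      unfolding image_comp[symmetric] T(2) by (simp add: openin_open_Int)
    show "subspace (h ` chart_model c)" using h(1) cD(4) by (rule linear_subspace_image)
    show "smooth_on (chart_dom c) (h \<circ> chart_map c)"
      unfolding o_def by (rule smooth_on_bounded_linear_compose[OF bl(1) cD(2)])
    show "smooth_on ((h \<circ> chart_map c) ` chart_dom c) (\<lambda>y. chart_inv c (g y))"
    proof (rule smooth_on_compose[OF smooth_on_bounded_linear[OF bl(2)] cD(3)])
      show "g ` (h \<circ> chart_map c) ` chart_dom c \<subseteq> chart_map c ` chart_dom c"
        using g(2) im by force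
    qed
    show "chart_inv c (g ((h \<circ> chart_map c) x)) = x" if "x \<in> chart_dom c" for x
      using that g(2) im cD(1) by auto
  qed (rule cD)
qed

lemma embedded_smooth_in_charts:
  fixes f :: "'a::euclidean_space \<Rightarrow> 'b::euclidean_space"
  assumes b: "embedded_chart S b" and c: "embedded_chart T c"
    and f: "smooth_on (chart_dom b \<inter> f -` chart_dom c) f"
  shows "smooth_in_charts f b c"
proof -
  note bD = embedded_chartD[OF b] and cD = embedded_chartD[OF c]
  let ?D = "chart_dom b \<inter> f -` chart_dom c"
  have "smooth_on (chart_map b ` ?D) (chart_inv b)"
    using bD(3) by (rule smooth_on_subset) auto
  moreover have inv: "chart_inv b ` chart_map b ` ?D \<subseteq> ?D" using bD(1) by auto
  ultimately have "smooth_on (chart_map b ` ?D) (\<lambda>y. f (chart_inv b y))"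
    using f by (intro smooth_on_compose[of _ "chart_inv b" ?D f])
  moreover have "(\<lambda>y. f (chart_inv b y)) ` chart_map b ` ?D \<subseteq> chart_dom c"
    using bD(1) by auto
  ultimately have "smooth_on (chart_map b ` ?D) (\<lambda>y. chart_map c (f (chart_inv b y)))"
    by (intro smooth_on_compose[of _ "\<lambda>y. f (chart_inv b y)" "chart_dom c" "chart_map c"] cD(2))
  then show ?thesis
    by (simp add: smooth_in_charts_def coord_dom_def coord_rep_def o_def)
qed

lemma embedded_compatible:
  "embedded_chart S b \<Longrightarrow> embedded_chart T c \<Longrightarrow> compatible b c"
  unfolding compatible_def id_def by (intro conjI embedded_smooth_in_charts smooth_on_ident)

text \<open>The transition map is continuous and injective on a nonempty open subset of one model,
  so topological invariance of dimension applies. The two models may live in different types, which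
  is how the dimension of the quotient gets compared with that of its image.\<close>

lemma embedded_chart_dim_le:
  fixes b :: "('a::euclidean_space, 'e::euclidean_space) chart"
    and c :: "('a, 'f::euclidean_space) chart"
  assumes b: "embedded_chart S b" and c: "embedded_chart S c" and ne: "chart_dom b \<inter> chart_dom c \<noteq> {}"
  shows "dim (chart_model b) \<le> dim (chart_model c)"
proof (rule invariance_of_dimension_subspaces[where f = "\<lambda>y. chart_map c (chart_inv b y)"])
  note bD = embedded_chartD[OF b] and cD = embedded_chartD[OF c]
  let ?A = "chart_map b ` (chart_dom b \<inter> chart_dom c)"
  show "openin (top_of_set (chart_model b)) ?A"
    by (rule chart_on_open_image[OF bD(1)]) (auto intro: bD cD)
  have inv: "chart_inv b ` ?A \<subseteq> chart_dom b \<inter> chart_dom c" using bD(1) by auto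
  have "smooth_on ?A (chart_inv b)" using bD(3) by (rule smooth_on_subset) auto
  then have "smooth_on ?A (\<lambda>y. chart_map c (chart_inv b y))"
    using cD(2) inv by (intro smooth_on_compose[of ?A "chart_inv b" "chart_dom c" "chart_map c"]) auto
  then show "continuous_on ?A (\<lambda>y. chart_map c (chart_inv b y))"
    by (rule smooth_on_imp_continuous_on)
  show "(\<lambda>y. chart_map c (chart_inv b y)) \<in> ?A \<rightarrow> chart_model c"
    using bD(1) chart_on_image[OF cD(1)] by (auto simp: image_subset_iff)
  show "inj_on (\<lambda>y. chart_map c (chart_inv b y)) ?A"
    using bD(1) chart_on_inj[OF cD(1)] by (auto simp: inj_on_def)
qed (use embedded_chartD[OF b] embedded_chartD[OF c] ne in auto)

lemma embedded_chart_dim_eq: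
  assumes "embedded_chart S b" "embedded_chart S c" "chart_dom b \<inter> chart_dom c \<noteq> {}"
  shows "dim (chart_model b) = dim (chart_model c)"
  using embedded_chart_dim_le[OF assms] embedded_chart_dim_le[OF assms(2,1)] assms(3)
  by (simp add: Int_commute)

text \<open>Contains what makes a smooth manifold apart from constancy of the dimension;
  Hausdorffness and second countability are inherited from the ambient space.\<close>

definition embedded_manifold :: "'a::euclidean_space set \<Rightarrow> ('a, 'e::euclidean_space) manifold \<Rightarrow> bool" where
  "embedded_manifold S M \<longleftrightarrow> mtop M = top_of_set S \<and> (\<forall>c\<in>atlas M. embedded_chart S c) \<and>
     (\<Union>c\<in>atlas M. chart_dom c) = S"

lemma embedded_manifold_euclidean: "embedded_manifold UNIV euclidean_manifold"
proof -
  have "embedded_chart UNIV (Chart UNIV (id :: 'a \<Rightarrow> 'a) UNIV)"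
    by (rule embedded_chartI[where g = id]) (auto simp: id_def smooth_on_ident)
  then show ?thesis by (simp add: embedded_manifold_def euclidean_manifold_def)
qed

lemma embedded_manifold_chart:
  assumes "embedded_manifold S M" "x \<in> S"
  obtains b where "b \<in> atlas M" "embedded_chart S b" "x \<in> chart_dom b"
  using assms unfolding embedded_manifold_def by blast

text \<open>Near a point, \<open>chart_map c\<close> is a transition map after some atlas chart
  \<open>b\<close>, and \<open>chart_inv c\<close> is \<open>chart_inv b\<close> after a transition
  map; both are therefore smooth in the ambient sense. This makes the slice charts of
  \<open>submanifold\<close>, taken from the maximal atlas, accessible.\<close>

lemma maximal_atlas_embedded:
  fixes M :: "('a::euclidean_space, 'e::euclidean_space) manifold"
  assumes M: "embedded_manifold S M"
  shows "maximal_atlas M = {c. embedded_chart S c}"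
proof (intro equalityI subsetI CollectI)
  fix c assume "c \<in> maximal_atlas M"
  then have c: "chart_on (top_of_set S) c" "\<And>b. b \<in> atlas M \<Longrightarrow> compatible b c"
    using M by (auto simp: maximal_atlas_def embedded_manifold_def)
  have domS: "chart_dom c \<subseteq> S" using chart_on_dom[OF c(1)] by simp
  have opD: "openin (top_of_set S) (chart_dom c)" using c(1) by (simp add: chart_on_def)
  have "smooth_on (chart_dom c) (chart_map c)"
  proof (rule smooth_on_local)
    fix x assume x: "x \<in> chart_dom c"
    then obtain b where b: "b \<in> atlas M" "embedded_chart S b" "x \<in> chart_dom b"
      using embedded_manifold_chart[OF M] domS by blast
    let ?D = "chart_dom b \<inter> chart_dom c"
    have "smooth_on (chart_map b ` ?D) (\<lambda>y. chart_map c (chart_inv b y))"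
      using c(2)[OF b(1)]
      by (simp add: compatible_def smooth_in_charts_def coord_dom_def coord_rep_def o_def)
    moreover have "smooth_on ?D (chart_map b)"
      using embedded_chartD(2)[OF b(2)] by (rule smooth_on_subset) simp
    ultimately have "smooth_on ?D (\<lambda>x. chart_map c (chart_inv b (chart_map b x)))"
      by (intro smooth_on_compose[of ?D "chart_map b" "chart_map b ` ?D"
            "\<lambda>y. chart_map c (chart_inv b y)"]) auto
    then have "smooth_on ?D (chart_map c)"
      by (rule smooth_on_cong) (use embedded_chartD(1)[OF b(2)] in simp)
    moreover have "openin (top_of_set (chart_dom c)) ?D"
      using embedded_chartD(5)[OF b(2)] domS
      by (intro openin_subset_trans[OF openin_Int[OF _ opD] _ domS]) auto
    ultimately show "\<exists>B. openin (top_of_set (chart_dom c)) B \<and> x \<in> B \<and> smooth_on B (chart_map c)"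
      using x b(3) by blast
  qed
  moreover have "smooth_on (chart_map c ` chart_dom c) (chart_inv c)"
  proof (rule smooth_on_local)
    fix y assume "y \<in> chart_map c ` chart_dom c"
    then obtain x where x: "x \<in> chart_dom c" "y = chart_map c x" by blast
    then obtain b where b: "b \<in> atlas M" "embedded_chart S b" "x \<in> chart_dom b"
      using embedded_manifold_chart[OF M] domS by blast
    note bD = embedded_chartD[OF b(2)]
    let ?D = "chart_dom c \<inter> chart_dom b"
    have "smooth_on (chart_map c ` ?D) (\<lambda>y. chart_map b (chart_inv c y))"
      using c(2)[OF b(1)]
      by (simp add: compatible_def smooth_in_charts_def coord_dom_def coord_rep_def o_def)
    then have "smooth_on (chart_map c ` ?D) (\<lambda>y. chart_inv b (chart_map b (chart_inv c y)))"
      by (rule smooth_on_compose[OF _ bD(3)]) (use c(1) in auto)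
    then have "smooth_on (chart_map c ` ?D) (chart_inv c)"
      by (rule smooth_on_cong) (use c(1) bD(1) in auto)
    moreover have "openin (top_of_set (chart_map c ` chart_dom c)) (chart_map c ` ?D)"
    proof (rule openin_subset_trans)
      show "openin (top_of_set (chart_model c)) (chart_map c ` ?D)"
        by (rule chart_on_open_image[OF c(1)]) (auto intro: opD bD)
    qed (use chart_on_image[OF c(1)] in auto)
    ultimately show "\<exists>B. openin (top_of_set (chart_map c ` chart_dom c)) B \<and> y \<in> B \<and>
        smooth_on B (chart_inv c)"
      using x b(3) by blast
  qed
  ultimately show "embedded_chart S c" using c(1) by (simp add: embedded_chart_def)
next
  fix c :: "('a, 'e) chart"
  assume "c \<in> {c. embedded_chart S c}"
  then show "c \<in> maximal_atlas M"
    using M embedded_compatible[of S _ S c]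
    by (auto simp: maximal_atlas_def embedded_manifold_def embedded_chart_def)
qed

lemma embedded_submanifold:
  fixes M :: "('a::euclidean_space, 'e::euclidean_space) manifold"
  assumes M: "embedded_manifold S M" and S': "S' \<subseteq> S"
    and slices: "\<And>x. x \<in> S' \<Longrightarrow> \<exists>(c :: ('a, 'e) chart) F. embedded_chart S c \<and> x \<in> chart_dom c \<and> subspace F \<and>
        F \<subseteq> chart_model c \<and> chart_map c ` (chart_dom c \<inter> S') = chart_map c ` chart_dom c \<inter> F"
  shows "embedded_manifold S' (submanifold M S')"
proof -
  have slice_iff: "slice_chart M S' c F \<longleftrightarrow> embedded_chart S c \<and> subspace F \<and> F \<subseteq> chart_model c \<and>
      chart_map c ` (chart_dom c \<inter> S') = chart_map c ` chart_dom c \<inter> F" for c F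
    using maximal_atlas_embedded[OF M] by (auto simp: slice_chart_def)
  have "mtop (submanifold M S') = top_of_set S'"
    using M S' by (simp add: submanifold_def embedded_manifold_def subtopology_subtopology Int_absorb1)
  moreover have "embedded_chart S' c" if "c \<in> atlas (submanifold M S')" for c
    using that S' unfolding submanifold_def manifold.sel slice_iff
    by (auto intro: embedded_chart_slice)
  moreover have "(\<Union>c\<in>atlas (submanifold M S'). chart_dom c) = S'"
  proof (intro equalityI subsetI)
    fix x assume "x \<in> S'"
    with slices obtain c F where "slice_chart M S' c F" "x \<in> chart_dom c"
      unfolding slice_iff by metis
    with \<open>x \<in> S'\<close> show "x \<in> (\<Union>c\<in>atlas (submanifold M S'). chart_dom c)"
      unfolding submanifold_def manifold.sel by force
  qed (auto simp: submanifold_def)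
  ultimately show ?thesis by (simp add: embedded_manifold_def)
qed

lemma smooth_manifold_embedded:
  assumes M: "embedded_manifold S M"
    and dim: "\<And>c. c \<in> atlas M \<Longrightarrow> chart_dom c \<noteq> {} \<Longrightarrow> dim (chart_model c) = d"
  shows "smooth_manifold M"
proof -
  have top: "mtop M = top_of_set S" and em: "\<And>c. c \<in> atlas M \<Longrightarrow> embedded_chart S c"
    and cover: "(\<Union>c\<in>atlas M. chart_dom c) = S"
    using M by (auto simp: embedded_manifold_def)
  obtain B :: "'a set set" where B: "countable B" "topological_basis B"
    using ex_countable_basis by blast
  have "second_countable (euclidean :: 'a topology)"
    unfolding second_countable_def
  proof (intro exI[of _ B] conjI ballI allI impI)
    show "openin euclidean V" if "V \<in> B" for V
      using that topological_basis_open[OF B(2)] by simp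
    show "\<exists>V\<in>B. x \<in> V \<and> V \<subseteq> U" if "openin euclidean U \<and> x \<in> U" for U x
      using that topological_basisE[OF B(2)] by (metis open_openin)
  qed (rule B)
  moreover have "compatible b c" if "b \<in> atlas M" "c \<in> atlas M" for b c
    using that em embedded_compatible by blast
  ultimately show ?thesis
    unfolding smooth_manifold_def
    using top cover em dim
    by (auto simp: second_countable_subtopology Hausdorff_space_subtopology embedded_chart_def)
qed


section \<open>Quotients by submersions with local sections\<close>

text \<open>Let \<open>P\<close> be a linear projection onto \<open>T\<close>. Since
  \<open>P \<circ> f = f\<close> on \<open>A\<close>, the map \<open>P \<circ> D\<close> is another
  derivative, and uniqueness along \<open>S\<close> gives \<open>D v = P (D v)\<close>.\<close>

lemma derivative_range_subspace:
  fixes f :: "'e::euclidean_space \<Rightarrow> 'f::euclidean_space"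
  assumes A: "openin (top_of_set S) A" "subspace S" "x \<in> A" and T: "subspace T" "f ` A \<subseteq> T"
    and D: "(f has_derivative D) (at x within A)" and v: "v \<in> S"
  shows "D v \<in> T"
proof -
  obtain P where P: "range P \<subseteq> T" "linear P" "\<And>v. v \<in> T \<Longrightarrow> P v = v"
    using linear_exists_left_inverse_on[OF linear_id T(1)] by auto
  have "((\<lambda>y. P (f y)) has_derivative (\<lambda>v. P (D v))) (at x within A)"
    using P(2) D unfolding linear_conv_bounded_linear by (rule bounded_linear.has_derivative)
  then have "(f has_derivative (\<lambda>v. P (D v))) (at x within A)"
  proof (rule has_derivative_transform[OF A(3), rotated])
    show "f y = P (f y)" if "y \<in> A" for y
      using P(3)[of "f y"] T(2) that by auto
  qed
  from has_derivative_unique_on_subspace[OF A D this v] show ?thesis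
    using P(1) by auto
qed

text \<open>Abstracts from matrices. That \<open>\<phi>\<close> is a submersion is expressed by
  smooth local sections through every point of \<open>V\<close>. The projection \<open>p\<close>
  maps into a bare type without structure; \<open>\<psi>_p\<close> makes \<open>\<phi>\<close>
  factor through \<open>p\<close>, and \<open>fibers\<close> makes the factor \<open>\<psi>\<close>
  injective.\<close>

locale submersion_quotient =
  fixes M :: "('a::euclidean_space, 'e::euclidean_space) manifold" and V :: "'a set"
    and N :: "'b::euclidean_space set" and \<phi> :: "'a \<Rightarrow> 'b" and p :: "'a \<Rightarrow> 'c" and \<psi> :: "'c \<Rightarrow> 'b"
  assumes M: "embedded_manifold V M"
    and \<phi>_smooth: "smooth_on V \<phi>" and \<phi>_image: "\<phi> ` V = N"
    and \<psi>_p: "\<And>x. x \<in> V \<Longrightarrow> \<psi> (p x) = \<phi> x"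
    and fibers: "\<And>x y. x \<in> V \<Longrightarrow> y \<in> V \<Longrightarrow> \<phi> x = \<phi> y \<Longrightarrow> p x = p y"
    and sections: "\<And>x. x \<in> V \<Longrightarrow> \<exists>W s. openin (top_of_set N) W \<and> \<phi> x \<in> W \<and> smooth_on W s \<and>
          s ` W \<subseteq> V \<and> s (\<phi> x) = x \<and> (\<forall>y\<in>W. \<phi> (s y) = y)"
begin

abbreviation "Q \<equiv> quotient_topology (top_of_set V) p"

abbreviation "\<theta> \<equiv> inv_into (p ` V) \<psi>"

lemma mtop_M: "mtop M = top_of_set V"
  using M by (simp add: embedded_manifold_def)

lemma inj_\<psi>: "inj_on \<psi> (p ` V)"
proof (rule inj_onI)
  fix q r assume "q \<in> p ` V" "r \<in> p ` V" and eq: "\<psi> q = \<psi> r"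
  then obtain x y where x: "x \<in> V" "q = p x" and y: "y \<in> V" "r = p y" by blast
  show "q = r"
    unfolding x(2) y(2) by (rule fibers[OF x(1) y(1)]) (use eq x y \<psi>_p in simp)
qed

lemma \<psi>_image: "\<psi> ` p ` V = N"
  unfolding image_image \<phi>_image[symmetric] by (rule image_cong) (simp_all add: \<psi>_p)

lemma \<theta>_\<phi>: "x \<in> V \<Longrightarrow> \<theta> (\<phi> x) = p x"
  using inv_into_f_f[OF inj_\<psi>, of "p x"] by (simp add: \<psi>_p)

lemma topspace_Q: "topspace Q = p ` V"
  by (simp add: topspace_quotient_topology)

text \<open>In the direction from left to right, pulling the open preimage back along a local
  section \<open>s\<close> gives an open set around a given point of \<open>U\<close>; it lies in
  \<open>U\<close> because \<open>\<phi> (s y) = y\<close>.\<close>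

lemma openin_preimage_iff:
  assumes U: "U \<subseteq> N"
  shows "openin (top_of_set V) {x \<in> V. \<phi> x \<in> U} \<longleftrightarrow> openin (top_of_set N) U"
proof
  assume L: "openin (top_of_set V) {x \<in> V. \<phi> x \<in> U}"
  show "openin (top_of_set N) U"
  proof (subst openin_subopen, intro ballI)
    fix y assume "y \<in> U"
    then obtain x where x: "x \<in> V" "y = \<phi> x" using U \<phi>_image by blast
    from sections[OF x(1)] obtain W s where W: "openin (top_of_set N) W" "y \<in> W" "smooth_on W s"
      "s ` W \<subseteq> V" "s y = x" "\<And>y. y \<in> W \<Longrightarrow> \<phi> (s y) = y"
      unfolding x(2) by blast
    have "openin (top_of_set W) (W \<inter> s -` {x \<in> V. \<phi> x \<in> U})"
      using W(4) L by (intro continuous_openin_preimage[OF smooth_on_imp_continuous_on[OF W(3)]]) auto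
    then have "openin (top_of_set N) (W \<inter> s -` {x \<in> V. \<phi> x \<in> U})"
      using W(1) openin_trans by blast
    moreover have "W \<inter> s -` {x \<in> V. \<phi> x \<in> U} \<subseteq> U" using W(6) by auto
    moreover have "y \<in> W \<inter> s -` {x \<in> V. \<phi> x \<in> U}" using W x \<open>y \<in> U\<close> by auto
    ultimately show "\<exists>T. openin (top_of_set N) T \<and> y \<in> T \<and> T \<subseteq> U" by blast
  qed
next
  assume "openin (top_of_set N) U"
  then have "openin (top_of_set V) (V \<inter> \<phi> -` U)"
    using \<phi>_image by (intro continuous_openin_preimage[OF smooth_on_imp_continuous_on[OF \<phi>_smooth]]) auto
  then show "openin (top_of_set V) {x \<in> V. \<phi> x \<in> U}" by (simp add: vimage_def Int_def)
qed

lemma homeomorphic_\<psi>: "homeomorphic_map Q (top_of_set N) \<psi>"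
  unfolding homeomorphic_map_def quotient_map_def
proof (intro conjI allI impI)
  fix U assume "U \<subseteq> topspace (top_of_set N)"
  moreover have "{x \<in> V. p x \<in> {q \<in> p ` V. \<psi> q \<in> U}} = {x \<in> V. \<phi> x \<in> U}"
    using \<psi>_p by (intro Collect_cong) (metis (mono_tags, lifting) imageI mem_Collect_eq)
  ultimately show "openin Q {x \<in> topspace Q. \<psi> x \<in> U} = openin (top_of_set N) U"
    using openin_preimage_iff[of U] by (auto simp: openin_quotient_topology topspace_Q)
qed (simp_all add: topspace_Q \<psi>_image inj_\<psi>)

section \<open>Charts of the quotient correspond to embedded charts of \<open>N\<close>\<close>

lemma quotient_chart_preimage_open:
  assumes "chart_on Q c"
  shows "openin (top_of_set V) {x \<in> V. p x \<in> chart_dom c}"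
  using assms unfolding chart_on_def openin_quotient_topology by simp

lemma quotient_chart_image_open:
  assumes c: "chart_on Q c"
  shows "openin (top_of_set N) (\<psi> ` chart_dom c)"
proof -
  have "openin Q (chart_dom c)" using c by (simp add: chart_on_def)
  then show ?thesis
    using homeomorphic_imp_open_map[OF homeomorphic_\<psi>] by (simp add: open_map_def)
qed

text \<open>Locally \<open>\<theta> = p \<circ> s\<close> for a section \<open>s\<close> of
  \<open>\<phi>\<close>. Hence \<open>chart_map c \<circ> \<theta>\<close> is the coordinate
  representation of \<open>p\<close> after \<open>chart_map b \<circ> s\<close>, and smoothness of
  \<open>p\<close> in charts suffices.\<close>

lemma smooth_chart_\<theta>:
  assumes c: "chart_on Q c" and sub: "\<And>b. b \<in> atlas M \<Longrightarrow> submersive_in_charts p b c"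
  shows "smooth_on (\<psi> ` chart_dom c) (\<lambda>y. chart_map c (\<theta> y))"
proof (rule smooth_on_local)
  fix y assume y: "y \<in> \<psi> ` chart_dom c"
  then obtain q where q: "q \<in> chart_dom c" "y = \<psi> q" by blast
  moreover have "q \<in> p ` V" using chart_on_dom[OF c] q(1) topspace_Q by blast
  ultimately obtain x where x: "x \<in> V" "p x \<in> chart_dom c" "y = \<phi> x"
    using \<psi>_p by blast
  from sections[OF x(1)] obtain W s where W: "openin (top_of_set N) W" "y \<in> W" "smooth_on W s"
    "s ` W \<subseteq> V" "s y = x" "\<And>y. y \<in> W \<Longrightarrow> \<phi> (s y) = y"
    unfolding x(3) by blast
  obtain b where b: "b \<in> atlas M" "embedded_chart V b" "x \<in> chart_dom b"
    using embedded_manifold_chart[OF M x(1)] by blast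
  note bD = embedded_chartD[OF b(2)]
  let ?B = "chart_dom b \<inter> {x \<in> V. p x \<in> chart_dom c}"
  define W' where "W' = W \<inter> s -` ?B"
  have "openin (top_of_set V) ?B"
    using bD(5) quotient_chart_preimage_open[OF c] by (rule openin_Int)
  then have "openin (top_of_set W) W'" unfolding W'_def
    using W(4) by (intro continuous_openin_preimage[OF smooth_on_imp_continuous_on[OF W(3)]]) auto
  then have opW': "openin (top_of_set N) W'" using W(1) openin_trans by blast
  have pW: "p (s z) \<in> chart_dom c" "s z \<in> V" "\<phi> (s z) = z" "s z \<in> chart_dom b" if "z \<in> W'" for z
    using that W(6) by (auto simp: W'_def)
  have W'sub: "W' \<subseteq> \<psi> ` chart_dom c" using pW \<psi>_p by (metis image_iff subsetI)
  have "openin (top_of_set (\<psi> ` chart_dom c)) W'"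
    by (rule openin_subset_trans[OF opW' W'sub openin_imp_subset[OF quotient_chart_image_open[OF c]]])
  moreover have "smooth_on W' (\<lambda>y. chart_map c (\<theta> y))"
  proof -
    have "smooth_on W' (\<lambda>z. chart_map b (s z))"
      by (rule smooth_on_compose[OF smooth_on_subset[OF W(3)] bD(2)]) (auto simp: W'_def)
    moreover have "smooth_on (coord_dom p b c) (coord_rep p b c)"
      using sub[OF b(1)] by (simp add: submersive_in_charts_def smooth_in_charts_def)
    ultimately have "smooth_on W' (\<lambda>z. coord_rep p b c (chart_map b (s z)))"
      by (rule smooth_on_compose) (auto simp: W'_def coord_dom_def)
    then show ?thesis
    proof (rule smooth_on_cong)
      fix z assume z: "z \<in> W'"
      then have "\<theta> z = p (s z)" using \<theta>_\<phi>[OF pW(2)[OF z]] pW(3)[OF z] by simp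
      then show "coord_rep p b c (chart_map b (s z)) = chart_map c (\<theta> z)"
        using bD(1) pW[OF z] by (simp add: coord_rep_def)
    qed
  qed
  moreover have "y \<in> W'" using W(2,5) x b(3) by (simp add: W'_def)
  ultimately show "\<exists>B. openin (top_of_set (\<psi> ` chart_dom c)) B \<and> y \<in> B \<and>
      smooth_on B (\<lambda>y. chart_map c (\<theta> y))"
    by blast
qed

text \<open>Here surjectivity of the differential of \<open>p\<close> enters: it provides a local
  section \<open>s\<close> of the coordinate representation, along which
  \<open>\<psi> \<circ> chart_inv c\<close> becomes
  \<open>\<phi> \<circ> chart_inv b \<circ> s\<close>.\<close>

lemma smooth_\<psi>_chart_inv:
  assumes c: "chart_on Q c" and sub: "\<And>b. b \<in> atlas M \<Longrightarrow> submersive_in_charts p b c"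
  shows "smooth_on (chart_map c ` chart_dom c) (\<lambda>z. \<psi> (chart_inv c z))"
proof (rule smooth_on_local)
  fix z assume "z \<in> chart_map c ` chart_dom c"
  then obtain q where q: "q \<in> chart_dom c" "z = chart_map c q" by blast
  moreover have "q \<in> p ` V" using chart_on_dom[OF c] q(1) topspace_Q by blast
  ultimately obtain x where x: "x \<in> V" "p x \<in> chart_dom c" "z = chart_map c (p x)"
    by blast
  obtain b where b: "b \<in> atlas M" "embedded_chart V b" "x \<in> chart_dom b"
    using embedded_manifold_chart[OF M x(1)] by blast
  note bD = embedded_chartD[OF b(2)]
  let ?f = "coord_rep p b c" and ?A = "coord_dom p b c"
  let ?B = "chart_dom b \<inter> {x \<in> V. p x \<in> chart_dom c}"
  have A: "?A = chart_map b ` ?B" using bD(6) by (auto simp: coord_dom_def)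
  have "openin (top_of_set V) ?B"
    using bD(5) quotient_chart_preimage_open[OF c] by (rule openin_Int)
  then have opA: "openin (top_of_set (chart_model b)) ?A"
    unfolding A by (intro chart_on_open_image[OF bD(1)]) auto
  have f_eq: "?f (chart_map b x') = chart_map c (p x')" if "x' \<in> chart_dom b" for x'
    using bD(1) that by (simp add: coord_rep_def)
  have fA: "?f ` ?A \<subseteq> chart_map c ` chart_dom c"
    unfolding A using f_eq by auto
  have mem: "chart_map b x \<in> ?A" using x b(3) by (auto simp: coord_dom_def)
  obtain D where D: "(?f has_derivative D) (at (chart_map b x) within ?A)"
    "D ` chart_model b = chart_model c"
    using sub[OF b(1)] mem by (auto simp: submersive_in_charts_def)
  have sf: "smooth_on ?A ?f"
    using sub[OF b(1)] by (simp add: submersive_in_charts_def smooth_in_charts_def)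
  have model: "subspace (chart_model c)" using c by (simp add: chart_on_def)
  obtain W s where W: "openin (top_of_set (chart_model c)) W" "?f (chart_map b x) \<in> W"
    "smooth_on W s" "s ` W \<subseteq> ?A" "s (?f (chart_map b x)) = chart_map b x"
    "\<And>z. z \<in> W \<Longrightarrow> ?f (s z) = z"
    by (rule smooth_local_section[OF opA bD(4) model sf order_trans[OF fA chart_on_image[OF c]] mem D])
      blast
  have Wsub: "W \<subseteq> chart_map c ` chart_dom c" using W(4,6) fA by (metis image_subset_iff subsetI)
  have sW: "\<exists>x'. x' \<in> chart_dom b \<and> x' \<in> V \<and> p x' \<in> chart_dom c \<and> s z = chart_map b x'" if "z \<in> W" for z
  proof -
    have "s z \<in> chart_map b ` ?B" using W(4) that unfolding A by (rule subsetD[OF _ imageI])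
    then show ?thesis by blast
  qed
  have "openin (top_of_set (chart_map c ` chart_dom c)) W"
    using W(1) Wsub chart_on_image[OF c] by (rule openin_subset_trans)
  moreover have "z \<in> W" using W(2) f_eq[OF b(3)] x(3) by simp
  moreover have "smooth_on W (\<lambda>z. \<psi> (chart_inv c z))"
  proof -
    have "smooth_on W (\<lambda>z. chart_inv b (s z))"
      by (rule smooth_on_compose[OF W(3) bD(3)]) (use W(4) A in auto)
    then have "smooth_on W (\<lambda>z. \<phi> (chart_inv b (s z)))"
    proof (rule smooth_on_compose[OF _ \<phi>_smooth])
      show "(\<lambda>z. chart_inv b (s z)) ` W \<subseteq> V"
      proof (rule image_subsetI)
        fix z assume "z \<in> W"
        from sW[OF this] show "chart_inv b (s z) \<in> V" using bD(1) by auto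
      qed
    qed
    then show ?thesis
    proof (rule smooth_on_cong)
      fix z assume z: "z \<in> W"
      obtain x' where x': "x' \<in> chart_dom b" "x' \<in> V" "p x' \<in> chart_dom c" "s z = chart_map b x'"
        using sW[OF z] by blast
      have "z = chart_map c (p x')" using W(6)[OF z] f_eq[OF x'(1)] x'(4) by simp
      then show "\<phi> (chart_inv b (s z)) = \<psi> (chart_inv c z)"
        using x' c bD(1) \<psi>_p by simp
    qed
  qed
  ultimately show "\<exists>B. openin (top_of_set (chart_map c ` chart_dom c)) B \<and> z \<in> B \<and>
      smooth_on B (\<lambda>z. \<psi> (chart_inv c z))"
    by blast
qed

lemma embedded_chart_of_quotient_chart:
  assumes c: "chart_on Q c" and sub: "\<And>b. b \<in> atlas M \<Longrightarrow> submersive_in_charts p b c"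
  shows "embedded_chart N (Chart (\<psi> ` chart_dom c) (\<lambda>y. chart_map c (\<theta> y)) (chart_model c))"
proof (rule embedded_chartI[where g = "\<lambda>z. \<psi> (chart_inv c z)"])
  have sub_pV: "chart_dom c \<subseteq> p ` V" using chart_on_dom[OF c] topspace_Q by simp
  have \<theta>\<psi>: "\<theta> (\<psi> q) = q" if "q \<in> chart_dom c" for q
    using that sub_pV by (intro inv_into_f_f inj_\<psi>) auto
  have im: "(\<lambda>y. chart_map c (\<theta> y)) ` \<psi> ` chart_dom c = chart_map c ` chart_dom c"
    unfolding image_image by (rule image_cong) (simp_all only: \<theta>\<psi>)
  show "subspace (chart_model c)"
    "openin (top_of_set (chart_model c)) ((\<lambda>y. chart_map c (\<theta> y)) ` \<psi> ` chart_dom c)"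
    using c unfolding im chart_on_def by blast+
  show "smooth_on ((\<lambda>y. chart_map c (\<theta> y)) ` \<psi> ` chart_dom c) (\<lambda>z. \<psi> (chart_inv c z))"
    unfolding im using assms by (rule smooth_\<psi>_chart_inv)
  show "\<psi> (chart_inv c (chart_map c (\<theta> y))) = y" if "y \<in> \<psi> ` chart_dom c" for y
    using that \<theta>\<psi> c by auto
qed (use assms in \<open>auto intro: quotient_chart_image_open smooth_chart_\<theta>\<close>)

text \<open>In the charts \<open>b\<close> and \<open>c\<close> the projection \<open>p\<close> has
  the same representation as \<open>\<phi>\<close> in \<open>b\<close> and \<open>a\<close>. The
  local sections of \<open>\<phi>\<close> force its derivative to be onto.\<close>

lemma quotient_chart_of_embedded_chart:
  fixes a :: "('b, 'f::euclidean_space) chart"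
  assumes a: "embedded_chart N a"
  defines "c \<equiv> Chart {q \<in> p ` V. \<psi> q \<in> chart_dom a} (chart_map a \<circ> \<psi>) (chart_model a)"
  shows "chart_on Q c" "b \<in> atlas M \<Longrightarrow> submersive_in_charts p b c"
proof -
  note aD = embedded_chartD[OF a]
  have \<psi>dom: "\<psi> ` chart_dom c = chart_dom a"
    using \<psi>_image aD(6) by (auto simp: c_def image_iff) blast
  have im: "chart_map c ` chart_dom c = chart_map a ` chart_dom a"
    unfolding \<psi>dom[symmetric] by (simp add: c_def image_image)
  have "homeomorphic_map (subtopology Q (chart_dom c)) (subtopology (top_of_set N) (chart_dom a)) \<psi>"
  proof (rule homeomorphic_map_subtopologies[OF homeomorphic_\<psi>])
    have "topspace Q \<inter> chart_dom c = chart_dom c" by (auto simp: topspace_Q c_def)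
    then show "\<psi> ` (topspace Q \<inter> chart_dom c) = topspace (top_of_set N) \<inter> chart_dom a"
      using \<psi>dom aD(6) by auto
  qed
  moreover have "homeomorphic_map (subtopology (top_of_set N) (chart_dom a))
      (top_of_set (chart_map a ` chart_dom a)) (chart_map a)"
    using aD(1) by (simp add: chart_on_def)
  ultimately have "homeomorphic_map (subtopology Q (chart_dom c)) (top_of_set (chart_map c ` chart_dom c))
      (chart_map c)"
    unfolding im by (auto simp: c_def intro: homeomorphic_map_compose)
  moreover have "openin Q (chart_dom c)"
    using openin_continuous_map_preimage[OF homeomorphic_imp_continuous_map[OF homeomorphic_\<psi>] aD(5)]
    by (simp add: c_def topspace_Q)
  ultimately show chart_c: "chart_on Q c"
    using aD(4,7) im by (simp add: chart_on_def c_def)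
  show "submersive_in_charts p b c" if "b \<in> atlas M"
  proof -
    have b: "embedded_chart V b" using M that by (simp add: embedded_manifold_def)
    note bD = embedded_chartD[OF b]
    let ?f = "coord_rep p b c" and ?A = "coord_dom p b c"
    let ?B = "chart_dom b \<inter> \<phi> -` chart_dom a"
    have dom: "p x \<in> chart_dom c \<longleftrightarrow> \<phi> x \<in> chart_dom a" if "x \<in> V" for x
      using that \<psi>_p by (auto simp: c_def)
    have A: "?A = coord_dom \<phi> b a"
      using dom bD(6) by (auto simp: coord_dom_def)
    then have A': "?A = chart_map b ` ?B" by (simp only: coord_dom_def[of \<phi>])
    have "smooth_in_charts \<phi> b a"
      using bD(6) by (intro embedded_smooth_in_charts[OF b a] smooth_on_subset[OF \<phi>_smooth]) auto
    then have sf\<phi>: "smooth_on ?A (coord_rep \<phi> b a)" by (simp add: smooth_in_charts_def A)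
    have f_eq: "coord_rep \<phi> b a (chart_map b x) = ?f (chart_map b x)"
      "?f (chart_map b x) = chart_map a (\<phi> x)" if "x \<in> ?B" for x
      using that bD(1,6) \<psi>_p by (auto simp: coord_rep_def c_def subset_iff)
    from sf\<phi> have sf: "smooth_on ?A ?f"
    proof (rule smooth_on_cong)
      fix u assume "u \<in> ?A"
      then have "u \<in> chart_map b ` ?B" by (simp only: A')
      then obtain x where x: "u = chart_map b x" "x \<in> ?B" by (rule imageE)
      show "coord_rep \<phi> b a u = ?f u" unfolding x(1) by (rule f_eq(1)[OF x(2)])
    qed
    have opA: "openin (top_of_set (chart_model b)) ?A"
    proof -
      have "openin (top_of_set V) (V \<inter> \<phi> -` chart_dom a)"
        using \<phi>_image aD(5)
        by (intro continuous_openin_preimage[OF smooth_on_imp_continuous_on[OF \<phi>_smooth]]) auto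
      from openin_Int[OF bD(5) this] have "openin (top_of_set V) ?B"
        using bD(6) by (simp add: Int_assoc[symmetric] Int_absorb2)
      then show ?thesis
        unfolding A' by (intro chart_on_open_image[OF bD(1)]) auto
    qed
    have fA: "?f ` ?A \<subseteq> chart_model a"
      using f_eq(2) chart_on_image[OF aD(1)] unfolding A' by auto
    show ?thesis
      unfolding submersive_in_charts_def smooth_in_charts_def
    proof (intro conjI sf ballI)
      fix u assume u: "u \<in> ?A"
      then obtain x where x: "x \<in> ?B" "u = chart_map b x" by (auto simp: A')
      have xV: "x \<in> V" using x(1) bD(6) by auto
      obtain D where D: "(?f has_derivative D) (at u within ?A)"
        using smooth_on_derivative[OF sf u] by blast
      have D_model: "D v \<in> chart_model a" if "v \<in> chart_model b" for v
        by (rule derivative_range_subspace[OF opA bD(4) u aD(4) fA D that])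
      from sections[OF xV] obtain W s where W: "openin (top_of_set N) W" "\<phi> x \<in> W" "smooth_on W s"
        "s ` W \<subseteq> V" "s (\<phi> x) = x" "\<And>y. y \<in> W \<Longrightarrow> \<phi> (s y) = y"
        by blast
      define W' where "W' = (W \<inter> s -` chart_dom b) \<inter> chart_dom a"
      have "openin (top_of_set W) (W \<inter> s -` chart_dom b)"
        using W(4) bD(5) by (intro continuous_openin_preimage[OF smooth_on_imp_continuous_on[OF W(3)]]) auto
      then have "openin (top_of_set N) W'" unfolding W'_def
        by (rule openin_Int[OF openin_trans[OF _ W(1)] aD(5)])
      then have opZ: "openin (top_of_set (chart_model a)) (chart_map a ` W')" (is "openin _ ?Z")
        by (rule chart_on_open_image[OF aD(1)]) (simp add: W'_def)
      \<comment> \<open>\<open>r\<close> is the section \<open>s\<close> read in the charts.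
        Differentiating \<open>?f (r z) = z\<close> by the chain rule shows that the derivative of
        \<open>r\<close> is a right inverse of \<open>D\<close> on the model of
        \<open>a\<close>.\<close>
      define r where "r z = chart_map b (s (chart_inv a z))" for z
      have r_eq: "r (chart_map a y) = chart_map b (s y)" if "y \<in> W'" for y
        using that aD(1) by (simp add: r_def W'_def)
      have rA: "r ` ?Z \<subseteq> ?A"
        using W(6) r_eq by (auto simp: A' W'_def)
      have fr: "?f (r z) = z" if "z \<in> ?Z" for z
        using that W(6) r_eq f_eq(2) by (auto simp: W'_def)
      have "smooth_on ?Z (\<lambda>z. s (chart_inv a z))"
        by (rule smooth_on_compose[OF smooth_on_subset[OF aD(3)] W(3)]) (use aD(1) in \<open>auto simp: W'_def\<close>)
      then have sr: "smooth_on ?Z r" unfolding r_def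
        by (rule smooth_on_compose[OF _ bD(2)]) (use aD(1) in \<open>auto simp: W'_def\<close>)
      have xW: "\<phi> x \<in> W'" using x W by (simp add: W'_def)
      then have mem: "?f u \<in> ?Z" using f_eq(2)[OF x(1)] x(2) by simp
      have ru: "r (?f u) = u" using f_eq(2)[OF x(1)] x(2) r_eq[OF xW] W(5) by simp
      obtain R where R: "(r has_derivative R) (at (?f u) within ?Z)"
        using smooth_on_derivative[OF sr mem] by blast
      have "(?f has_derivative D) (at (r (?f u)) within r ` ?Z)"
        using D rA unfolding ru by (rule has_derivative_subset)
      from diff_chain_within[OF R this]
      have "((\<lambda>z. z) has_derivative D \<circ> R) (at (?f u) within ?Z)"
        by (rule has_derivative_transform[OF mem, rotated]) (simp add: fr)
      then have DR: "D (R v) = v" if "v \<in> chart_model a" for v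
        using has_derivative_unique_on_subspace[OF opZ aD(4) mem _ _ that] has_derivative_ident
        by (metis comp_apply)
      have R_model: "R v \<in> chart_model b" if "v \<in> chart_model a" for v
        using rA openin_imp_subset[OF opA]
        by (intro derivative_range_subspace[OF opZ aD(4) mem bD(4) _ R that]) blast
      have "D ` chart_model b = chart_model a"
      proof (intro equalityI subsetI)
        fix w assume "w \<in> chart_model a"
        then show "w \<in> D ` chart_model b"
          using imageI[OF R_model, of w D] DR[of w] by simp
      qed (use D_model in blast)
      then show "\<exists>D. (?f has_derivative D) (at u within ?A) \<and> D ` chart_model b = chart_model c"
        using D by (auto simp: c_def)
    qed
  qed
qed

text \<open>\<open>MN\<close> may have its models in a type other than that of \<open>M\<close>,
  whereas the quotient inherits the model type of \<open>M\<close>. Accordingly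
  \<open>charts\<close> supplies charts of \<open>N\<close> in the latter type, which make the
  quotient atlas cover, and \<open>dims\<close> fixes the dimension through charts in the
  former.\<close>

theorem diffeomorphism_quotient:
  fixes MN :: "('b, 'f::euclidean_space) manifold"
  assumes MN: "embedded_manifold N MN"
    and dims: "\<And>y. y \<in> N \<Longrightarrow> \<exists>a::('b, 'f) chart. embedded_chart N a \<and> y \<in> chart_dom a \<and> dim (chart_model a) = d"
    and charts: "\<And>y. y \<in> N \<Longrightarrow> \<exists>a::('b, 'e) chart. embedded_chart N a \<and> y \<in> chart_dom a"
  shows "diffeomorphism (quotient_manifold M p) MN \<psi>"
proof -
  let ?Q = "quotient_manifold M p"
  have top: "mtop ?Q = Q" by (simp add: quotient_manifold_def mtop_M)
  have carrier: "mcarrier ?Q = p ` V" by (simp add: top topspace_Q)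
  have carrierN: "mcarrier MN = N" using MN by (simp add: embedded_manifold_def)
  have c: "chart_on Q c" "\<And>b. b \<in> atlas M \<Longrightarrow> submersive_in_charts p b c" if "c \<in> atlas ?Q" for c
    using that by (auto simp: quotient_manifold_def mtop_M)
  \<comment> \<open>The model type is left general because the fact is applied both to the charts of
    \<open>MN\<close> and to quotient charts transported to \<open>N\<close>.\<close>
  have dim_f: "dim (chart_model a) = d" if a: "embedded_chart N a" "chart_dom a \<noteq> {}"
    for a :: "('b, 'g::euclidean_space) chart"
  proof -
    obtain y where y: "y \<in> chart_dom a" using a(2) by blast
    then have "y \<in> N" using embedded_chartD(6)[OF a(1)] by blast
    then obtain a' :: "('b, 'f) chart" where a': "embedded_chart N a'" "y \<in> chart_dom a'"
      "dim (chart_model a') = d"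
      using dims by blast
    then show ?thesis using embedded_chart_dim_eq[OF a(1) a'(1)] y by blast
  qed
  have dim_e: "dim (chart_model c) = d" if cQ: "c \<in> atlas ?Q" and ne: "chart_dom c \<noteq> {}" for c
  proof -
    obtain q where q: "q \<in> chart_dom c" using ne by blast
    let ?a = "Chart (\<psi> ` chart_dom c) (\<lambda>y. chart_map c (\<theta> y)) (chart_model c)"
    have a: "embedded_chart N ?a" by (rule embedded_chart_of_quotient_chart[OF c[OF cQ]])
    have "dim (chart_model ?a) = d" by (rule dim_f[OF a]) (use q in auto)
    then show ?thesis by simp
  qed
  have homsp: "Q homeomorphic_space top_of_set N"
    by (rule homeomorphic_map_imp_homeomorphic_space[OF homeomorphic_\<psi>])
  have smN: "smooth_manifold MN"
  proof (rule smooth_manifold_embedded[OF MN])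
    fix a assume a: "a \<in> atlas MN" "chart_dom a \<noteq> {}"
    have ea: "embedded_chart N a" using MN a(1) by (simp add: embedded_manifold_def)
    show "dim (chart_model a) = d" by (rule dim_f[OF ea a(2)])
  qed
  have compat: "smooth_in_charts id c1 c2" if c1: "c1 \<in> atlas ?Q" and c2: "c2 \<in> atlas ?Q" for c1 c2
  proof -
    let ?A = "coord_dom id c1 c2"
    have "smooth_on ?A (\<lambda>z. \<psi> (chart_inv c1 z))"
      by (rule smooth_on_subset[OF smooth_\<psi>_chart_inv[OF c[OF c1]]]) (auto simp: coord_dom_def)
    moreover have "(\<lambda>z. \<psi> (chart_inv c1 z)) ` ?A \<subseteq> \<psi> ` chart_dom c2"
      using c(1)[OF c1] by (auto simp: coord_dom_def)
    ultimately have "smooth_on ?A (\<lambda>z. chart_map c2 (\<theta> (\<psi> (chart_inv c1 z))))"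
      by (intro smooth_on_compose[OF _ smooth_chart_\<theta>[OF c[OF c2]]])
    then have "smooth_on ?A (coord_rep id c1 c2)"
    proof (rule smooth_on_cong)
      fix z assume "z \<in> ?A"
      then have "chart_inv c1 z \<in> chart_dom c1"
        by (intro chart_inv_in_dom) (auto simp: coord_dom_def)
      then have "chart_inv c1 z \<in> p ` V" using chart_on_dom[OF c(1)[OF c1]] topspace_Q by auto
      then show "chart_map c2 (\<theta> (\<psi> (chart_inv c1 z))) = coord_rep id c1 c2 z"
        using inv_into_f_f[OF inj_\<psi>] by (simp add: coord_rep_def)
    qed
    then show ?thesis by (simp add: smooth_in_charts_def)
  qed
  have cover: "(\<Union>c\<in>atlas ?Q. chart_dom c) = p ` V"
  proof (intro equalityI subsetI)
    fix q assume q: "q \<in> p ` V"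
    then have "\<psi> q \<in> N" using \<psi>_image by blast
    then obtain a :: "('b, 'e) chart" where a: "embedded_chart N a" "\<psi> q \<in> chart_dom a"
      using charts by blast
    let ?c = "Chart {q \<in> p ` V. \<psi> q \<in> chart_dom a} (chart_map a \<circ> \<psi>) (chart_model a)"
    have "?c \<in> atlas ?Q"
      using quotient_chart_of_embedded_chart[OF a(1)] by (simp add: quotient_manifold_def mtop_M)
    then show "q \<in> (\<Union>c\<in>atlas ?Q. chart_dom c)" using q a(2) by force
  next
    fix q assume "q \<in> (\<Union>c\<in>atlas ?Q. chart_dom c)"
    then show "q \<in> p ` V" using chart_on_dom[OF c(1)] topspace_Q by blast
  qed
  have smN_top: "mtop MN = top_of_set N" using MN by (simp add: embedded_manifold_def)
  have smQ: "smooth_manifold ?Q"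
    unfolding smooth_manifold_def
  proof (intro conjI)
    show "Hausdorff_space (mtop ?Q)" "second_countable (mtop ?Q)"
      using smN homeomorphic_Hausdorff_space[OF homsp] homeomorphic_space_second_countability[OF homsp]
      by (simp_all add: top smooth_manifold_def smN_top)
  qed (use c compat cover dim_e in \<open>auto simp: top topspace_Q compatible_def\<close>)
  have "smooth_map ?Q MN \<psi>"
    unfolding smooth_map_def
  proof (intro conjI ballI)
    show "continuous_map (mtop ?Q) (mtop MN) \<psi>"
      unfolding top smN_top by (rule homeomorphic_imp_continuous_map[OF homeomorphic_\<psi>])
    fix b a assume b: "b \<in> atlas ?Q" and "a \<in> atlas MN"
    then have a: "embedded_chart N a" using MN by (simp add: embedded_manifold_def)
    let ?A = "coord_dom \<psi> b a"
    have "smooth_on ?A (\<lambda>z. \<psi> (chart_inv b z))"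
      by (rule smooth_on_subset[OF smooth_\<psi>_chart_inv[OF c[OF b]]]) (auto simp: coord_dom_def)
    then have "smooth_on ?A (\<lambda>z. chart_map a (\<psi> (chart_inv b z)))"
      by (rule smooth_on_compose[OF _ embedded_chartD(2)[OF a]])
        (use c(1)[OF b] in \<open>auto simp: coord_dom_def\<close>)
    then show "smooth_in_charts \<psi> b a" by (simp add: smooth_in_charts_def coord_rep_def o_def)
  qed
  moreover have "smooth_map MN ?Q \<theta>"
    unfolding smooth_map_def
  proof (intro conjI ballI)
    obtain g where g: "homeomorphic_maps Q (top_of_set N) \<psi> g"
      using homeomorphic_\<psi> homeomorphic_map_maps by blast
    have "g y = \<theta> y" if "y \<in> N" for y
    proof -
      have "g y \<in> p ` V" "\<psi> (g y) = y"
        using g that by (auto simp: homeomorphic_maps_def continuous_map_def topspace_Q)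
      then show ?thesis using inv_into_f_f[OF inj_\<psi>] by metis
    qed
    then show "continuous_map (mtop MN) (mtop ?Q) \<theta>"
      unfolding top smN_top using g continuous_map_eq[of "top_of_set N" Q g \<theta>]
      by (auto simp: homeomorphic_maps_def)
    fix a b assume b: "b \<in> atlas ?Q" and "a \<in> atlas MN"
    then have a: "embedded_chart N a" using MN by (simp add: embedded_manifold_def)
    note aD = embedded_chartD[OF a]
    let ?A = "coord_dom \<theta> a b"
    have "smooth_on ?A (chart_inv a)"
      by (rule smooth_on_subset[OF aD(3)]) (auto simp: coord_dom_def)
    then have "smooth_on ?A (\<lambda>z. chart_map b (\<theta> (chart_inv a z)))"
    proof (rule smooth_on_compose[OF _ smooth_chart_\<theta>[OF c[OF b]]])
      show "chart_inv a ` ?A \<subseteq> \<psi> ` chart_dom b"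
      proof clarify
        fix z assume "z \<in> ?A"
        then obtain y where y: "y \<in> chart_dom a" "\<theta> y \<in> chart_dom b" "z = chart_map a y"
          by (auto simp: coord_dom_def)
        then have "\<psi> (\<theta> y) = y" using aD(6) \<psi>_image by (intro f_inv_into_f) auto
        then show "chart_inv a z \<in> \<psi> ` chart_dom b" using y aD(1) by (metis chart_inv_map imageI)
      qed
    qed
    then show "smooth_in_charts \<theta> a b" by (simp add: smooth_in_charts_def coord_rep_def o_def)
  qed
  ultimately show ?thesis
    unfolding diffeomorphism_def carrier carrierN
    using smQ smN inj_\<psi> \<psi>_image by (simp add: bij_betw_def)
qed

end


section \<open>The Stiefel manifold\<close>

text \<open>The regular value theorem with the subspace \<open>range D\<close> in the role of the
  target, as the equation \<open>X\<^sup>T X = I\<close> takes values in symmetric matrices only.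
  The straightening satisfies \<open>D (\<psi> y) = f y\<close>, so it maps the zero set of
  \<open>f\<close> into the kernel of \<open>D\<close>.\<close>

lemma level_set_slice:
  fixes f :: "'e::euclidean_space \<Rightarrow> 'f::euclidean_space"
  assumes ck: "\<And>k. Ck_on k UNIV f" and D: "(f has_derivative D) (at x)" and fD: "range f \<subseteq> range D"
  shows "\<exists>(c :: ('e, 'e) chart) F. embedded_chart UNIV c \<and> x \<in> chart_dom c \<and> subspace F \<and>
    F \<subseteq> chart_model c \<and> chart_map c ` (chart_dom c \<inter> {y. f y = 0}) = chart_map c ` chart_dom c \<inter> F"
proof -
  obtain U V \<psi> g where U: "open U" "U \<subseteq> UNIV" "x \<in> U" "open V" and hom: "homeomorphism U V \<psi> g"
    and ck': "\<And>k. Ck_on k U \<psi>" "\<And>k. Ck_on k V g" and D\<psi>: "\<And>y. y \<in> U \<Longrightarrow> D (\<psi> y) = f y"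
    by (rule smooth_straightening[OF open_UNIV UNIV_I ck fD D]) blast
  have "embedded_chart UNIV (Chart U \<psi> UNIV)"
  proof (rule embedded_chartI[where g = g])
    show "smooth_on (\<psi> ` U) g"
      unfolding homeomorphism_image1[OF hom] by (rule smooth_on_open[OF U(4) ck'(2)])
  qed (use U hom homeomorphism_image1[OF hom] homeomorphism_apply1[OF hom] smooth_on_open[OF U(1) ck'(1)]
      in auto)
  moreover have "subspace {v. D v = 0}"
    using linear_subspace_kernel[OF has_derivative_linear[OF D]] .
  moreover have "\<psi> ` (U \<inter> {y. f y = 0}) = \<psi> ` U \<inter> {v. D v = 0}"
    using D\<psi> by auto
  ultimately show ?thesis
    using U(3) by (intro exI[of _ "Chart U \<psi> UNIV"] exI[of _ "{v. D v = 0}"]) simp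
qed

lemma embedded_stiefel: "embedded_manifold stiefel (stiefel_manifold :: (real^'k^'n, real^'k^'n) manifold)"
  unfolding stiefel_manifold_def
proof (rule embedded_submanifold[OF embedded_manifold_euclidean subset_UNIV])
  fix Y :: "real^'k^'n" assume "Y \<in> stiefel"
  then have Y: "transpose Y ** Y = mat 1" by (simp add: stiefel_def)
  define f where "f X = transpose X ** X - mat 1" for X :: "real^'k^'n"
  define D where "D H = transpose Y ** H + transpose H ** Y" for H :: "real^'k^'n"
  have ck: "Ck_on k UNIV f" for k
    unfolding f_def diff_conv_add_uminus
    by (intro Ck_on_add Ck_on_bilinear[OF bounded_bilinear_matrix_mult]
        Ck_on_bounded_linear[OF bounded_linear_transpose] Ck_on_bounded_linear[OF bounded_linear_ident]
        Ck_on_const open_UNIV)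
  have der: "(f has_derivative D) (at Y)"
    unfolding f_def D_def
    by (rule has_derivative_eq_rhs[OF has_derivative_diff[OF bounded_bilinear.FDERIV[OF
              bounded_bilinear_matrix_mult bounded_linear_imp_has_derivative[OF bounded_linear_transpose]
              has_derivative_ident] has_derivative_const]])
      simp
  \<comment> \<open>With \<open>Y\<^sup>T Y = I\<close> the two summands of \<open>D\<close>
    contribute \<open>M / 2\<close> and \<open>M\<^sup>T / 2\<close>; so \<open>D\<close> reaches
    every symmetric matrix.\<close>
  have "D ((1 / 2) *\<^sub>R (Y ** M)) = M" if "transpose M = M" for M
  proof -
    have "transpose Y ** (Y ** M) = M" "(M ** transpose Y) ** Y = M"
      using Y by (simp add: matrix_mul_assoc, simp add: matrix_mul_assoc[symmetric])
    then show ?thesis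
      by (simp add: D_def matrix_mult_algebra transpose_algebra that flip: scaleR_add_left)
  qed
  moreover have "transpose (f X) = f X" for X by (simp add: f_def transpose_algebra)
  ultimately have "f X = D ((1 / 2) *\<^sub>R (Y ** f X))" for X by simp
  then have "range f \<subseteq> range D" by blast
  from level_set_slice[OF ck der this]
  have *: "\<exists>(c :: (real^'k^'n, real^'k^'n) chart) F. embedded_chart UNIV c \<and> Y \<in> chart_dom c \<and> subspace F \<and>
    F \<subseteq> chart_model c \<and> chart_map c ` (chart_dom c \<inter> {y. f y = 0}) = chart_map c ` chart_dom c \<inter> F" .
  have "{y. f y = 0} = stiefel" by (simp add: f_def stiefel_def)
  with * show "\<exists>(c :: (real^'k^'n, real^'k^'n) chart) F. embedded_chart UNIV c \<and> Y \<in> chart_dom c \<and> subspace F \<and>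
      F \<subseteq> chart_model c \<and> chart_map c ` (chart_dom c \<inter> stiefel) = chart_map c ` chart_dom c \<inter> F"
    by simp
qed

lemma embedded_orthogonal:
  "embedded_manifold {Q. orthogonal_matrix Q} (orthogonal_manifold :: (real^'n^'n, real^'n^'n) manifold)"
proof -
  have "{Q :: real^'n^'n. orthogonal_matrix Q} = stiefel"
    by (simp add: stiefel_def orthogonal_matrix)
  then show ?thesis
    using embedded_stiefel[where 'k = 'n and 'n = 'n]
    by (simp add: orthogonal_manifold_def stiefel_manifold_def)
qed


section \<open>The Cayley transform\<close>

text \<open>An involution exchanging the skew matrices with the orthogonal matrices that lack the
  eigenvalue -1; it sends the identity to 0.\<close>

definition cayley :: "real^'n^'n \<Rightarrow> real^'n^'n" where
  "cayley B = (mat 1 - B) ** matrix_inv (mat 1 + B)"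

lemma matrix_cancel_right:
  fixes A :: "real^'n^'n"
  assumes "invertible A" "X ** A = Y ** A"
  shows "X = Y"
  using arg_cong[OF assms(2), of "\<lambda>Z. Z ** matrix_inv A"] matrix_inv_mult[OF assms(1)]
  by (simp add: matrix_mul_assoc[symmetric])

lemma matrix_cancel_left:
  fixes A :: "real^'n^'n"
  assumes "invertible A" "A ** X = A ** Y"
  shows "X = Y"
  using arg_cong[OF assms(2), of "\<lambda>Z. matrix_inv A ** Z"] matrix_inv_mult[OF assms(1)]
  by (simp add: matrix_mul_assoc)

lemma cayley_mult:
  assumes "invertible (mat 1 + B)"
  shows "cayley B ** (mat 1 + B) = mat 1 - B" "(mat 1 + B) ** cayley B = mat 1 - B"
proof -
  show 1: "cayley B ** (mat 1 + B) = mat 1 - B"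
    using matrix_inv_mult[OF assms] by (simp add: cayley_def matrix_mul_assoc[symmetric])
  have "(mat 1 + B) ** cayley B ** (mat 1 + B) = (mat 1 + B) ** (mat 1 - B)"
    by (simp add: matrix_mul_assoc[symmetric] 1)
  also have "\<dots> = (mat 1 - B) ** (mat 1 + B)"
    by (simp add: matrix_mult_algebra)
  finally show "(mat 1 + B) ** cayley B = mat 1 - B"
    by (rule matrix_cancel_right[OF assms])
qed

lemma cayley_eqI:
  assumes "invertible (mat 1 + B)" "X ** (mat 1 + B) = mat 1 - B"
  shows "cayley B = X"
  by (rule matrix_cancel_right[OF assms(1)]) (simp add: assms(2) cayley_mult(1)[OF assms(1)])

lemma cayley_eqI':
  assumes "invertible (mat 1 + B)" "(mat 1 + B) ** X = mat 1 - B"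
  shows "cayley B = X"
  by (rule matrix_cancel_left[OF assms(1)]) (simp add: assms(2) cayley_mult(2)[OF assms(1)])

text \<open>With \<open>C = cayley B\<close>, expanding gives
  \<open>(I + C)(I + B) = (I + B) + (I - B) = 2I\<close>.\<close>

lemma invertible_add_cayley:
  assumes "invertible (mat 1 + B)"
  shows "invertible (mat 1 + cayley B)"
proof -
  have "(mat 1 + cayley B) ** (mat 1 + B) = 2 *\<^sub>R mat 1" "(mat 1 + B) ** (mat 1 + cayley B) = 2 *\<^sub>R mat 1"
    using cayley_mult[OF assms] by (simp_all add: matrix_mult_algebra algebra_simps scaleR_2)
  then show ?thesis
    unfolding invertible_def
    by (intro exI[of _ "(1 / 2) *\<^sub>R (mat 1 + B)"])
      (simp add: bounded_bilinear.scaleR_left[OF bounded_bilinear_matrix_mult]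
        bounded_bilinear.scaleR_right[OF bounded_bilinear_matrix_mult])
qed

lemma cayley_cayley:
  assumes "invertible (mat 1 + B)"
  shows "cayley (cayley B) = B"
proof (rule cayley_eqI[OF invertible_add_cayley[OF assms]])
  have "B ** (mat 1 + cayley B) ** X = B ** X + B ** (cayley B ** X)"
    "(mat 1 - cayley B) ** X = X - cayley B ** X" for X
    by (simp_all add: matrix_mult_algebra matrix_mul_assoc)
  from this[of "mat 1 + B"]
  have "(B ** (mat 1 + cayley B)) ** (mat 1 + B) = (mat 1 - cayley B) ** (mat 1 + B)"
    unfolding cayley_mult(1)[OF assms] by (simp add: matrix_mult_algebra)
  then show "B ** (mat 1 + cayley B) = mat 1 - cayley B"
    by (rule matrix_cancel_right[OF assms])
qed

text \<open>A skew matrix satisfies \<open>v \<bullet> (B *v v) = 0\<close>, hence -1 is not an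
  eigenvalue.\<close>

lemma invertible_add_skew:
  fixes B :: "real^'n^'n"
  assumes "transpose B = - B"
  shows "invertible (mat 1 + B)"
proof -
  have "v = 0" if "(mat 1 + B) *v v = 0" for v :: "real^'n"
  proof -
    have "B *v v = - v" using that by (simp add: matrix_vector_mult_add_rdistrib eq_neg_iff_add_eq_0 add.commute)
    moreover have "v \<bullet> (B *v v) = (transpose B *v v) \<bullet> v"
      by (simp add: dot_lmul_matrix)
    moreover have "(- B) *v v = - (B *v v)"
      using matrix_vector_mult_diff_rdistrib[of 0 B v] by simp
    ultimately have "v \<bullet> v = 0" unfolding assms by simp
    then show ?thesis by simp
  qed
  then have "\<exists>C. C ** (mat 1 + B) = mat 1"
    by (simp add: matrix_left_invertible_ker)
  then show ?thesis by (simp add: invertible_left_inverse)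
qed

text \<open>With \<open>C = cayley B\<close>, the transposed defining equation is
  \<open>(I - B) C\<^sup>T = I + B\<close>. Therefore
  \<open>(I - B) C\<^sup>T C (I + B) = (I + B)(I - B)\<close>; these factors commute, and both are
  invertible and cancel.\<close>

lemma orthogonal_cayley:
  assumes B: "transpose B = - B"
  shows "orthogonal_matrix (cayley B)"
proof -
  have inv: "invertible (mat 1 + B)" "invertible (mat 1 - B)"
    using invertible_add_skew[OF B] invertible_add_skew[of "- B"] B by (simp_all add: transpose_algebra)
  note 1 = cayley_mult(1)[OF inv(1)]
  have 2: "(mat 1 - B) ** transpose (cayley B) = mat 1 + B"
    using arg_cong[OF 1, of transpose] by (simp add: transpose_algebra B)
  have "(mat 1 - B) ** (transpose (cayley B) ** cayley B) ** (mat 1 + B)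
      = ((mat 1 - B) ** transpose (cayley B)) ** (cayley B ** (mat 1 + B))"
    by (simp add: matrix_mul_assoc)
  also have "\<dots> = (mat 1 - B) ** mat 1 ** (mat 1 + B)"
    unfolding 1 2 by (simp add: matrix_mult_algebra)
  finally have "(mat 1 - B) ** (transpose (cayley B) ** cayley B) = (mat 1 - B) ** mat 1"
    by (rule matrix_cancel_right[OF inv(1)])
  then have "transpose (cayley B) ** cayley B = mat 1"
    by (rule matrix_cancel_left[OF inv(2)])
  then show ?thesis by (simp add: orthogonal_matrix)
qed

text \<open>Multiplying the transposed defining equation by \<open>R\<close> turns
  \<open>I + R\<^sup>T\<close> into \<open>R + I\<close>, so that
  \<open>- transpose (cayley R)\<close> solves the equation that determines
  \<open>cayley R\<close>.\<close>

lemma skew_cayley: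
  assumes R: "orthogonal_matrix R" and inv: "invertible (mat 1 + R)"
  shows "transpose (cayley R) = - cayley R"
proof -
  have RR: "R ** transpose R = mat 1" using R by (simp add: orthogonal_matrix_def)
  have "(mat 1 + transpose R) ** transpose (cayley R) = mat 1 - transpose R"
    using arg_cong[OF cayley_mult(1)[OF inv], of transpose] by (simp add: transpose_algebra)
  then have "R ** ((mat 1 + transpose R) ** transpose (cayley R)) = R ** (mat 1 - transpose R)"
    by simp
  then have "(mat 1 + R) ** (- transpose (cayley R)) = mat 1 - R"
    by (simp add: matrix_mult_algebra matrix_mul_assoc RR algebra_simps)
  then have "cayley R = - transpose (cayley R)" by (rule cayley_eqI'[OF inv])
  then show ?thesis by (metis add.inverse_inverse)
qed


section \<open>The involution model\<close>

lemma involution_modelD: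
  fixes Q :: "real^'n^'n"
  assumes "Q \<in> involution_model k"
  shows "transpose Q = Q" "Q ** Q = mat 1" "orthogonal_matrix Q"
    "trace Q = 2 * real k - real CARD('n)"
  using assms unfolding involution_model_def orthogonal_matrix_def by auto

text \<open>For a symmetric orthogonal \<open>Q\<close> this is \<open>Q\<close> times the tangent
  space at \<open>Q\<close> of the symmetric orthogonal matrices. With respect to the two
  eigenspaces of \<open>Q\<close> it consists of the skew matrices with vanishing diagonal
  blocks.\<close>

definition anticommuting_skew :: "real^'n^'n \<Rightarrow> (real^'n^'n) set" where
  "anticommuting_skew Q = {B. transpose B = - B \<and> Q ** B = - (B ** Q)}"

lemma subspace_anticommuting_skew: "subspace (anticommuting_skew Q)"
  unfolding subspace_def anticommuting_skew_def
  by (auto simp: transpose_algebra matrix_mult_algebra bounded_bilinear.zero_left[OF bounded_bilinear_matrix_mult]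
      bounded_bilinear.zero_right[OF bounded_bilinear_matrix_mult])

text \<open>Multiplication by \<open>Q\<close> moves the centre \<open>Q\<close> to the identity, as
  \<open>Q ** Q = mat 1\<close> in all uses; the chart therefore sends \<open>Q\<close> to
  0.\<close>

definition cayley_chart :: "real^'n^'n \<Rightarrow> (real^'n^'n, real^'n^'n) chart" where
  "cayley_chart Q = Chart {A. orthogonal_matrix A \<and> invertible (mat 1 + Q ** A)}
     (\<lambda>A. cayley (Q ** A)) {B. transpose B = - B}"

lemma cayley_chart_point:
  assumes "Q ** Q = mat 1" "orthogonal_matrix Q"
  shows "Q \<in> chart_dom (cayley_chart Q)"
proof -
  have "(mat 1 + mat 1 :: real^'n^'n) ** ((1 / 2) *\<^sub>R mat 1) = mat 1"
    by (simp add: matrix_mult_algebra flip: scaleR_add_left)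
  then have "invertible (mat 1 + mat 1 :: real^'n^'n)"
    using invertible_right_inverse by blast
  then show ?thesis using assms by (simp add: cayley_chart_def)
qed

lemma cayley_chart_inverse:
  assumes Q: "Q ** Q = mat 1" "orthogonal_matrix Q" and B: "transpose B = - B"
  shows "Q ** cayley B \<in> chart_dom (cayley_chart Q)"
    "chart_map (cayley_chart Q) (Q ** cayley B) = B"
  using Q orthogonal_cayley[OF B] invertible_add_skew[OF B]
  by (simp_all add: cayley_chart_def orthogonal_matrix_mul matrix_mul_assoc invertible_add_cayley
      cayley_cayley)

lemma cayley_chart_image:
  fixes Q :: "real^'n^'n"
  assumes Q: "Q ** Q = mat 1" "orthogonal_matrix Q"
  shows "chart_map (cayley_chart Q) ` chart_dom (cayley_chart Q) = {B. transpose B = - B}"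
proof (intro equalityI subsetI)
  fix B :: "real^'n^'n" assume "B \<in> {B. transpose B = - B}"
  then have "transpose B = - B" by simp
  from cayley_chart_inverse[OF Q this]
  show "B \<in> chart_map (cayley_chart Q) ` chart_dom (cayley_chart Q)"
    by (metis imageI)
next
  fix B assume "B \<in> chart_map (cayley_chart Q) ` chart_dom (cayley_chart Q)"
  then show "B \<in> {B. transpose B = - B}"
    using Q by (auto simp: cayley_chart_def intro!: skew_cayley orthogonal_matrix_mul)
qed

lemma embedded_cayley_chart:
  fixes Q :: "real^'n^'n"
  assumes Q: "Q ** Q = mat 1" "orthogonal_matrix Q"
  shows "embedded_chart {A. orthogonal_matrix A} (cayley_chart Q)"
proof -
  let ?D = "{A :: real^'n^'n. orthogonal_matrix A \<and> invertible (mat 1 + Q ** A)}"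
  let ?F = "{B :: real^'n^'n. transpose B = - B}"
  have im: "(\<lambda>A. cayley (Q ** A)) ` ?D = ?F"
    using cayley_chart_image[OF Q] by (simp add: cayley_chart_def)
  have smQ: "smooth_on S (\<lambda>A. Q ** A)" for S
    by (intro smooth_on_matrix_mult smooth_on_const smooth_on_ident)
  show ?thesis
    unfolding cayley_chart_def
  proof (rule embedded_chartI[where g = "\<lambda>B. Q ** cayley B"], unfold im)
    have "continuous_on UNIV (\<lambda>A. mat 1 + Q ** A)"
      by (intro smooth_on_imp_continuous_on smooth_on_add smooth_on_const smQ)
    then have "open ((\<lambda>A. mat 1 + Q ** A) -` {A. invertible A})"
      using open_invertible by (intro open_vimage)
    then have "openin (top_of_set {A. orthogonal_matrix A})
        ({A. orthogonal_matrix A} \<inter> (\<lambda>A. mat 1 + Q ** A) -` {A. invertible A})"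
      by (rule openin_open_Int)
    then show "openin (top_of_set {A. orthogonal_matrix A}) ?D"
      by (simp add: vimage_def Int_def)
    show "smooth_on ?D (\<lambda>A. cayley (Q ** A))"
      unfolding cayley_def
      by (intro smooth_on_matrix_mult smooth_on_matrix_inv smooth_on_diff smooth_on_add smooth_on_const smQ)
        auto
    show "smooth_on ?F (\<lambda>B. Q ** cayley B)"
      unfolding cayley_def
      by (intro smooth_on_matrix_mult smooth_on_matrix_inv smooth_on_diff smooth_on_add smooth_on_const
          smooth_on_ident) (auto intro: invertible_add_skew)
    show "Q ** cayley (cayley (Q ** A)) = A" if "A \<in> ?D" for A
      using that Q by (simp add: cayley_cayley matrix_mul_assoc)
    show "subspace ?F"
      by (auto simp: subspace_def transpose_algebra)
  qed simp
qed

text \<open>Both inclusions rest on multiplying the Cayley equation by involutions. In the backward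
  one the whole of \<open>involution_model k\<close>, including the trace, comes from a single
  conjugation.\<close>

lemma cayley_chart_slice:
  fixes Q :: "real^'n^'n"
  assumes QS: "Q \<in> involution_model k"
  shows "chart_map (cayley_chart Q) ` (chart_dom (cayley_chart Q) \<inter> involution_model k) =
    chart_map (cayley_chart Q) ` chart_dom (cayley_chart Q) \<inter> anticommuting_skew Q"
proof -
  note Q = involution_modelD[OF QS]
  have "cayley (Q ** A) \<in> anticommuting_skew Q"
    if A: "A \<in> chart_dom (cayley_chart Q)" "A \<in> involution_model k" for A
  proof -
    note AD = involution_modelD[OF A(2)]
    let ?R = "Q ** A" and ?C = "cayley (Q ** A)"
    have inv: "invertible (mat 1 + ?R)" using A(1) by (simp add: cayley_chart_def)
    \<comment> \<open>Multiplying by \<open>A\<close> on the right and by \<open>Q\<close> on the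
      left, with \<open>A ** A = mat 1\<close>, gives \<open>Q C Q (I + R) = R - I\<close>. So
      \<open>- Q C Q\<close> satisfies the equation that characterizes
      \<open>C = cayley R\<close>.\<close>
    have "?C ** (mat 1 + ?R) ** A = (mat 1 - ?R) ** A" by (simp add: cayley_mult(1)[OF inv])
    then have "?C ** A + ?C ** Q = A - Q"
      by (simp add: matrix_mult_algebra matrix_mul_assoc[symmetric] AD(2))
    then have "Q ** (?C ** A + ?C ** Q) = Q ** (A - Q)" by simp
    then have "Q ** (?C ** A) + Q ** (?C ** Q) = ?R - mat 1"
      by (simp add: matrix_mult_algebra Q(2))
    moreover have "(Q ** ?C ** Q) ** (mat 1 + ?R) = Q ** (?C ** Q) + Q ** (?C ** ((Q ** Q) ** A))"
      by (simp only: matrix_mult_algebra matrix_mul_assoc matrix_mul_rid)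
    ultimately have "(- (Q ** ?C ** Q)) ** (mat 1 + ?R) = mat 1 - ?R"
      by (simp add: Q(2) bounded_bilinear.minus_left[OF bounded_bilinear_matrix_mult] add.commute)
    then have "?C = - (Q ** ?C ** Q)" by (rule cayley_eqI[OF inv])
    then have "?C ** Q = - (Q ** ?C ** Q) ** Q" by (rule arg_cong)
    also have "\<dots> = - (Q ** ?C)"
      by (simp add: bounded_bilinear.minus_left[OF bounded_bilinear_matrix_mult]
          matrix_mul_assoc[symmetric] Q(2))
    finally have "?C ** Q = - (Q ** ?C)" .
    moreover have "transpose ?C = - ?C"
      using inv Q(3) AD(3) by (intro skew_cayley orthogonal_matrix_mul)
    ultimately show ?thesis by (simp add: anticommuting_skew_def)
  qed
  moreover have "Q ** cayley B \<in> involution_model k" if "B \<in> anticommuting_skew Q" for B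
  proof -
    have B: "transpose B = - B" "Q ** B = - (B ** Q)" using that by (auto simp: anticommuting_skew_def)
    note inv = invertible_add_skew[OF B(1)]
    let ?A = "Q ** cayley B" and ?K = "matrix_inv (mat 1 + B)"
    have KB: "X ** ?K ** (mat 1 + B) = X" for X
      using matrix_inv_mult[OF inv] by (simp add: matrix_mul_assoc[symmetric])
    \<comment> \<open>Anticommutation lets \<open>Q\<close> pass the numerator of
      \<open>cayley B\<close>, whence \<open>Q ** cayley B\<close> is \<open>Q\<close> conjugated by
      \<open>mat 1 + B\<close>. It is thus an involution with the trace of \<open>Q\<close>, and an
      orthogonal involution is symmetric.\<close>
    have "Q ** (mat 1 - B) = (mat 1 + B) ** Q" by (simp add: matrix_mult_algebra B)
    then have A: "?A = (mat 1 + B) ** Q ** ?K" by (simp add: cayley_def matrix_mul_assoc)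
    have orth: "orthogonal_matrix ?A" by (intro orthogonal_matrix_mul Q orthogonal_cayley B)
    have "?A ** ?A = (mat 1 + B) ** Q ** (?K ** (mat 1 + B)) ** Q ** ?K"
      unfolding A by (simp only: matrix_mul_assoc)
    also have "\<dots> = (mat 1 + B) ** (Q ** Q) ** ?K"
      using matrix_inv_mult[OF inv] by (simp add: matrix_mul_assoc)
    finally have AA: "?A ** ?A = mat 1" using Q(2) matrix_inv_mult[OF inv] by simp
    have "transpose ?A = transpose ?A ** (?A ** ?A)" using AA by simp
    also have "\<dots> = (transpose ?A ** ?A) ** ?A" by (simp only: matrix_mul_assoc)
    also have "\<dots> = ?A" using orth by (simp add: orthogonal_matrix_def)
    finally have sym: "transpose ?A = ?A" .
    have "trace ?A = trace (?K ** ((mat 1 + B) ** Q))" unfolding A by (rule trace_mul_sym)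
    also have "\<dots> = trace Q" using matrix_inv_mult[OF inv] by (simp add: matrix_mul_assoc)
    finally show ?thesis using orth sym Q(4) by (simp add: involution_model_def)
  qed
  moreover have "B \<in> chart_map (cayley_chart Q) ` (chart_dom (cayley_chart Q) \<inter> involution_model k)"
    if "B \<in> anticommuting_skew Q" "Q ** cayley B \<in> involution_model k" for B
  proof -
    have "transpose B = - B" using that(1) by (simp add: anticommuting_skew_def)
    note inv = cayley_chart_inverse[OF Q(2,3) this]
    then show ?thesis using that(2) by (intro image_eqI[of _ _ "Q ** cayley B"]) (simp_all add: inv)
  qed
  moreover have "chart_map (cayley_chart Q) A = cayley (Q ** A)" for A
    by (simp add: cayley_chart_def)
  ultimately show ?thesis by auto
qed

lemma embedded_involution:
  "embedded_manifold (involution_model k) (involution_manifold k :: (real^'n^'n, real^'n^'n) manifold)"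
  unfolding involution_manifold_def
proof (rule embedded_submanifold[OF embedded_orthogonal])
  show "involution_model k \<subseteq> {Q :: real^'n^'n. orthogonal_matrix Q}"
    by (auto simp: involution_model_def)
  fix Q :: "real^'n^'n" assume QS: "Q \<in> involution_model k"
  note Q = involution_modelD[OF QS]
  have "anticommuting_skew Q \<subseteq> chart_model (cayley_chart Q)"
    by (auto simp: anticommuting_skew_def cayley_chart_def)
  then show "\<exists>(c :: (real^'n^'n, real^'n^'n) chart) F. embedded_chart {Q. orthogonal_matrix Q} c \<and>
      Q \<in> chart_dom c \<and> subspace F \<and> F \<subseteq> chart_model c \<and>
      chart_map c ` (chart_dom c \<inter> involution_model k) = chart_map c ` chart_dom c \<inter> F"
    using embedded_cayley_chart[OF Q(2,3)] cayley_chart_point[OF Q(2,3)] cayley_chart_slice[OF QS]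
      subspace_anticommuting_skew[of Q] by blast
qed

lemma involution_chart:
  fixes Q :: "real^'n^'n"
  assumes QS: "Q \<in> involution_model k"
  shows "\<exists>a :: (real^'n^'n, real^'n^'n) chart. embedded_chart (involution_model k) a \<and>
    Q \<in> chart_dom a \<and> chart_model a = anticommuting_skew Q"
proof -
  note Q = involution_modelD[OF QS]
  let ?c = "cayley_chart Q"
  have "embedded_chart (involution_model k)
      (Chart (chart_dom ?c \<inter> involution_model k) (chart_map ?c) (anticommuting_skew Q))"
    by (rule embedded_chart_slice[OF embedded_cayley_chart[OF Q(2,3)] _ subspace_anticommuting_skew _
          cayley_chart_slice[OF QS]])
      (auto simp: involution_model_def anticommuting_skew_def cayley_chart_def)
  then show ?thesis
    using cayley_chart_point[OF Q(2,3)] QS by (metis IntI chart.sel(1,3))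
qed

text \<open>If \<open>B ** Y = 0\<close>, then \<open>B Q = - B\<close>. Anticommutation gives
  \<open>Q B = B\<close>, transposition gives \<open>Q B = - B\<close>, so \<open>B = 0\<close>. The
  lemma embeds the model space of the target into the matrix type of the frames.\<close>

lemma inj_on_anticommuting_skew:
  fixes Y :: "real^'k^'n"
  defines "Q \<equiv> 2 *\<^sub>R (Y ** transpose Y) - mat 1"
  shows "inj_on (\<lambda>B. B ** Y) (anticommuting_skew Q)"
proof -
  have "B = 0" if B: "B \<in> anticommuting_skew Q" "B ** Y = 0" for B
  proof -
    have BD: "transpose B = - B" "Q ** B = - (B ** Q)" using B by (auto simp: anticommuting_skew_def)
    have BQ: "B ** Q = - B"
      by (simp add: Q_def matrix_mult_algebra matrix_mul_assoc B
          bounded_bilinear.zero_left[OF bounded_bilinear_matrix_mult])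
    then have QB: "Q ** B = B" using BD(2) by simp
    have "transpose Q = Q" by (simp add: Q_def transpose_algebra)
    then have "- (Q ** B) = B"
      using arg_cong[OF BQ, of transpose] by (simp add: transpose_algebra BD(1) matrix_mult_algebra)
    then have "B + B = 0" using QB by (metis add.right_inverse)
    then have "2 *\<^sub>R B = 0" by (simp only: scaleR_2)
    then show "B = 0" by simp
  qed
  moreover have "linear (\<lambda>B. B ** Y)"
    by (intro bounded_linear.linear bounded_bilinear.bounded_linear_left[OF bounded_bilinear_matrix_mult])
  ultimately show ?thesis
    using linear_inj_on_iff_eq_0[OF _ subspace_anticommuting_skew] by blast
qed


section \<open>Reflections and orthonormal frames\<close>

definition reflection :: "real^'k^'n \<Rightarrow> real^'n^'n" where
  "reflection Y = 2 *\<^sub>R (Y ** transpose Y) - mat 1"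

lemma stiefelD: "Y \<in> stiefel \<Longrightarrow> transpose Y ** Y = mat 1"
  by (simp add: stiefel_def)

lemma trace_scaleR: "trace (c *\<^sub>R A) = c * trace (A :: real^'n^'n)"
  by (simp add: trace_def sum_distrib_left)

lemma trace_mat_1: "trace (mat 1 :: real^'n^'n) = real CARD('n)"
  by (simp add: trace_def mat_def)

lemma reflection_in_involution_model:
  fixes Y :: "real^'k^'n"
  assumes Y: "Y \<in> stiefel"
  shows "reflection Y \<in> involution_model CARD('k)"
proof -
  have sym: "transpose (reflection Y) = reflection Y"
    by (simp add: reflection_def transpose_algebra)
  have YY: "(Y ** transpose Y) ** (Y ** transpose Y) = Y ** transpose Y"
  proof -
    have "(Y ** transpose Y) ** (Y ** transpose Y) = Y ** (transpose Y ** Y) ** transpose Y"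
      by (simp only: matrix_mul_assoc)
    then show ?thesis by (simp add: stiefelD[OF Y])
  qed
  have "(2 *\<^sub>R Z - mat 1) ** (2 *\<^sub>R Z - mat 1) = mat 1" if "Z ** Z = Z" for Z :: "real^'n^'n"
    by (simp only: matrix_mult_algebra that matrix_mul_lid matrix_mul_rid) (simp add: vec_eq_iff)
  from this[OF YY] have "orthogonal_matrix (reflection Y)"
    by (simp add: orthogonal_matrix sym) (simp add: reflection_def)
  moreover have "trace (Y ** transpose Y) = real CARD('k)"
    using trace_mul_sym[of Y "transpose Y"] by (simp add: stiefelD[OF Y] trace_mat_1)
  then have "trace (reflection Y) = 2 * real CARD('k) - real CARD('n)"
    by (simp add: reflection_def trace_sub trace_scaleR trace_mat_1)
  ultimately show ?thesis by (simp add: involution_model_def sym)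
qed

text \<open>\<open>P\<close> is the orthogonal projection onto the 1-eigenspace. Its trace is its
  rank, which is how \<open>trace Q = 2k - n\<close> encodes the multiplicity
  \<open>k\<close>.\<close>

lemma eigenprojection:
  fixes Q :: "real^'n^'n"
  assumes QS: "Q \<in> involution_model k"
  defines "P \<equiv> (1 / 2) *\<^sub>R (Q + mat 1)"
  shows "transpose P = P" "P ** P = P" "trace P = real k" "Q = 2 *\<^sub>R P - mat 1"
    "range ((*v) P) = {v. Q *v v = v}"
proof -
  note Q = involution_modelD[OF QS]
  show "transpose P = P" by (simp add: P_def transpose_algebra Q)
  show "trace P = real k" by (simp add: P_def trace_scaleR trace_add trace_mat_1 Q)
  show QP: "Q = 2 *\<^sub>R P - mat 1" by (simp add: P_def)
  have "(Q + mat 1) ** (Q + mat 1) = 2 *\<^sub>R (Q + mat 1)"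
    by (simp add: matrix_mult_algebra Q(2) scaleR_2)
  then show "P ** P = P"
    by (simp add: P_def bounded_bilinear.scaleR_left[OF bounded_bilinear_matrix_mult]
        bounded_bilinear.scaleR_right[OF bounded_bilinear_matrix_mult])
  have "Q ** P = P"
    by (simp add: P_def matrix_mult_algebra Q(2) add.commute)
  then have 1: "Q *v (P *v v) = P *v v" for v by (simp add: matrix_vector_mul_assoc)
  have 2: "P *v v = v" if "Q *v v = v" for v
    by (simp add: P_def that matrix_vector_mult_add_rdistrib flip: scaleR_matrix_vector_assoc)
  show "range ((*v) P) = {v. Q *v v = v}"
  proof (intro equalityI subsetI)
    fix v assume "v \<in> {v. Q *v v = v}"
    then have "v = P *v v" using 2 by simp
    then show "v \<in> range ((*v) P)" by blast
  qed (use 1 in auto)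
qed

lemma stiefel_eigenbasis_iff: "(\<forall>i j. column i Y \<bullet> column j Y = (if i = j then 1 else 0)) \<longleftrightarrow> Y \<in> stiefel"
  by (simp add: stiefel_def vec_eq_iff matrix_mult_transpose_dot_column mat_def)

lemma range_eq_span_columns: "range ((*v) (Y :: real^'k^'n)) = span (columns Y)"
proof
  show "range ((*v) Y) \<subseteq> span (columns Y)"
    using matrix_vector_mult_in_columnspace by blast
  have "columns Y \<subseteq> range ((*v) Y)"
    unfolding columns_def by (auto simp: matrix_vector_mult_basis[symmetric])
  then show "span (columns Y) \<subseteq> range ((*v) Y)"
    by (intro span_minimal linear_subspace_image) auto
qed

text \<open>\<open>Y Y\<^sup>T\<close> and \<open>P\<close> are orthogonal projections with the same
  range, hence equal: each fixes the range of the other, and one of the two resulting identities is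
  transposed.\<close>

lemma one_eigenbasisD:
  fixes Q :: "real^'n^'n" and Y :: "real^'k^'n"
  assumes QS: "Q \<in> involution_model m" and Y: "one_eigenbasis Q Y"
  shows "Y \<in> stiefel" "reflection Y = Q"
proof -
  show YS: "Y \<in> stiefel"
    using Y unfolding one_eigenbasis_def stiefel_eigenbasis_iff by blast
  define P where "P = (1 / 2) *\<^sub>R (Q + mat 1)"
  note P = eigenprojection[OF QS, folded P_def]
  have "range ((*v) Y) = {v. Q *v v = v}"
    using Y by (simp add: one_eigenbasis_def range_eq_span_columns)
  then have range: "range ((*v) Y) = range ((*v) P)" using P(5) by simp
  have "P ** Y = Y"
  proof (subst matrix_eq, rule allI)
    fix x
    have "Y *v x \<in> range ((*v) P)" using range by blast
    then obtain u where u: "Y *v x = P *v u" by blast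
    then show "(P ** Y) *v x = Y *v x"
      by (simp add: matrix_vector_mul_assoc[symmetric] u) (simp add: matrix_vector_mul_assoc P(2))
  qed
  then have PE: "P ** (Y ** transpose Y) = Y ** transpose Y" by (simp add: matrix_mul_assoc)
  have "(Y ** transpose Y) ** P = P"
  proof (subst matrix_eq, rule allI)
    fix x
    have "P *v x \<in> range ((*v) Y)" using range by blast
    then obtain u where u: "P *v x = Y *v u" by blast
    have "((Y ** transpose Y) ** P) *v x = (Y ** transpose Y) *v (P *v x)"
      by (simp only: matrix_vector_mul_assoc)
    also have "\<dots> = (Y ** (transpose Y ** Y)) *v u"
      by (simp only: u matrix_vector_mul_assoc matrix_mul_assoc)
    finally show "((Y ** transpose Y) ** P) *v x = P *v x"
      by (simp add: stiefelD[OF YS] u)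
  qed
  from arg_cong[OF this, of transpose] have "P ** (Y ** transpose Y) = P"
    by (simp add: transpose_algebra P(1) matrix_mul_assoc)
  with PE have "Y ** transpose Y = P" by simp
  then show "reflection Y = Q" using P(4) by (simp add: reflection_def)
qed

text \<open>Take an orthonormal basis \<open>B\<close> of the eigenspace. The projection is the sum
  of the \<open>b b\<^sup>T\<close>, so its trace is the sum of the squared norms, that is
  \<open>card B\<close>. As the trace is \<open>CARD('k)\<close>, the basis can be indexed by the
  type \<open>'k\<close>.\<close>

lemma ex_one_eigenbasis:
  fixes Q :: "real^'n^'n"
  assumes QS: "Q \<in> involution_model CARD('k::finite)"
  shows "\<exists>Y :: real^'k^'n. one_eigenbasis Q Y"
proof -
  define P where "P = (1 / 2) *\<^sub>R (Q + mat 1)"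
  note P = eigenprojection[OF QS, folded P_def]
  let ?E = "{v. Q *v v = v}"
  have "subspace ?E" unfolding P(5)[symmetric] by (intro linear_subspace_image) auto
  from this obtain B where B: "B \<subseteq> ?E" "pairwise orthogonal B" "\<And>x. x \<in> B \<Longrightarrow> norm x = 1"
    "independent B" "span B = ?E"
    by (rule orthonormal_basis_subspace) blast
  have fin: "finite B" using B(4) independent_imp_finite by blast
  have ortho: "b \<bullet> c = (if b = c then 1 else 0)" if "b \<in> B" "c \<in> B" for b c
    using that B(2,3) by (auto simp: pairwise_def orthogonal_def norm_eq_1)
  have PB: "P *v b = b" if "b \<in> B" for b
  proof -
    have "b \<in> range ((*v) P)" using B(1) that P(5) by blast
    then obtain u where "b = P *v u" by blast
    then show ?thesis by (simp add: matrix_vector_mul_assoc P(2))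
  qed
  have expand: "v = (\<Sum>b\<in>B. (v \<bullet> b) *\<^sub>R b)" if "v \<in> ?E" for v
  proof -
    have "v \<in> span B" using that B(5) by simp
    then obtain a where a: "v = (\<Sum>b\<in>B. a b *\<^sub>R b)" using fin by (auto simp: span_finite)
    have "v \<bullet> c = a c" if c: "c \<in> B" for c
    proof -
      have "v \<bullet> c = (\<Sum>b\<in>B. a b * (b \<bullet> c))" by (simp add: a inner_sum_left)
      also have "\<dots> = (\<Sum>b\<in>B. if b = c then a b else 0)"
        by (intro sum.cong refl) (simp add: ortho[OF _ c])
      finally show ?thesis using fin c by simp
    qed
    then have "(\<Sum>b\<in>B. (v \<bullet> b) *\<^sub>R b) = (\<Sum>b\<in>B. a b *\<^sub>R b)"
      by (intro sum.cong refl) simp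
    with a show ?thesis by (rule trans[OF _ sym])
  qed
  have Pv: "P *v v = (\<Sum>b\<in>B. (v \<bullet> b) *\<^sub>R b)" for v
  proof -
    have "P *v v \<in> ?E" using P(5) by blast
    then have "P *v v = (\<Sum>b\<in>B. ((P *v v) \<bullet> b) *\<^sub>R b)" by (rule expand)
    also have "\<dots> = (\<Sum>b\<in>B. (v \<bullet> b) *\<^sub>R b)"
    proof (intro sum.cong refl)
      fix b assume "b \<in> B"
      have "P *v v = v v* P" using transpose_matrix_vector[of P v] P(1) by simp
      then have "(P *v v) \<bullet> b = v \<bullet> (P *v b)" by (simp only: dot_lmul_matrix)
      then show "((P *v v) \<bullet> b) *\<^sub>R b = (v \<bullet> b) *\<^sub>R b" using PB[OF \<open>b \<in> B\<close>] by simp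
    qed
    finally show ?thesis .
  qed
  have "P $ i $ i = (\<Sum>b\<in>B. (b $ i)\<^sup>2)" for i
  proof -
    have "P $ i $ i = (P *v axis i 1) $ i"
      by (simp add: matrix_vector_mult_basis column_def)
    also have "\<dots> = (\<Sum>b\<in>B. (b $ i)\<^sup>2)"
      by (simp add: Pv inner_axis' power2_eq_square)
    finally show ?thesis .
  qed
  then have "trace P = (\<Sum>i\<in>UNIV. \<Sum>b\<in>B. (b $ i)\<^sup>2)" by (simp add: trace_def)
  also have "\<dots> = (\<Sum>b\<in>B. \<Sum>i\<in>UNIV. (b $ i)\<^sup>2)" by (rule sum.swap)
  also have "\<dots> = (\<Sum>b\<in>B. b \<bullet> b)" by (simp add: inner_vec_def power2_eq_square)
  also have "\<dots> = real (card B)" using ortho by simp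
  finally have "card B = CARD('k)" using P(3) by simp
  then obtain h where h: "bij_betw h (UNIV :: 'k set) B"
    using fin by (metis bij_betw_iff_card finite_class.finite_UNIV)
  define Y :: "real^'k^'n" where "Y = (\<chi> i j. h j $ i)"
  have col: "column j Y = h j" for j by (simp add: Y_def column_def vec_eq_iff)
  have "columns Y = B"
    using h by (auto simp: columns_def col bij_betw_def)
  moreover have "column i Y \<bullet> column j Y = (if i = j then 1 else 0)" for i j
    using h ortho[of "h i" "h j"] by (auto simp: col bij_betw_def inj_eq)
  ultimately have "one_eigenbasis Q Y" using B(5) by (simp add: one_eigenbasis_def)
  then show ?thesis ..
qed

section \<open>Classes of frames as fibres of the reflection map\<close>

lemma stiefel_class_reflection:
  assumes "Y' \<in> stiefel_class Y"
  shows "reflection Y' = reflection Y"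
proof -
  obtain Q where Q: "orthogonal_matrix Q" "Y' = Y ** Q" using assms by (auto simp: stiefel_class_def)
  have "Y' ** transpose Y' = Y ** (Q ** transpose Q) ** transpose Y"
    by (simp add: Q(2) transpose_algebra matrix_mul_assoc)
  then show ?thesis using Q(1) by (simp add: reflection_def orthogonal_matrix_def)
qed

lemma stiefel_class_self: "Y \<in> stiefel_class Y"
  by (auto simp: stiefel_class_def orthogonal_matrix_id intro!: exI[of _ "mat 1"])

lemma reflection_eq_imp_class_subset:
  assumes Y: "Y \<in> stiefel" "Y' \<in> stiefel" and eq: "reflection Y = reflection Y'"
  shows "stiefel_class Y' \<subseteq> stiefel_class Y"
proof -
  have E: "Y ** transpose Y = Y' ** transpose Y'" using eq by (simp add: reflection_def)
  \<comment> \<open>The only candidate: \<open>Y' = Y Q\<close> forces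
    \<open>Q = Y\<^sup>T Y'\<close>. It works since \<open>Y Y\<^sup>T = Y' Y'\<^sup>T\<close> fixes
    the columns of \<open>Y'\<close>.\<close>
  let ?Q = "transpose Y ** Y'"
  have "Y ** ?Q = Y' ** (transpose Y' ** Y')" by (simp add: matrix_mul_assoc E)
  then have YQ: "Y ** ?Q = Y'" using stiefelD[OF Y(2)] by simp
  have "transpose ?Q ** ?Q = transpose Y' ** (Y ** ?Q)" by (simp add: transpose_algebra matrix_mul_assoc)
  then have orth: "orthogonal_matrix ?Q" using YQ stiefelD[OF Y(2)] by (simp add: orthogonal_matrix)
  show ?thesis
  proof
    fix Z assume "Z \<in> stiefel_class Y'"
    then obtain R where R: "orthogonal_matrix R" "Z = Y' ** R" by (auto simp: stiefel_class_def)
    then have "Z = Y ** (?Q ** R)" using YQ by (metis matrix_mul_assoc)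
    then show "Z \<in> stiefel_class Y"
      using orthogonal_matrix_mul[OF orth R(1)] by (auto simp: stiefel_class_def)
  qed
qed

lemma phi3_stiefel_class: "phi3 (stiefel_class Y) = reflection Y"
proof -
  have "reflection ` stiefel_class Y = {reflection Y}"
    using stiefel_class_reflection stiefel_class_self by blast
  then show ?thesis by (simp add: phi3_def reflection_def[abs_def])
qed

lemma reflection_image: "reflection ` (stiefel :: (real^'k^'n) set) = involution_model CARD('k)"
proof (intro equalityI subsetI)
  fix Q :: "real^'n^'n" assume "Q \<in> involution_model CARD('k)"
  moreover from this obtain Y :: "real^'k^'n" where "one_eigenbasis Q Y" using ex_one_eigenbasis by blast
  ultimately show "Q \<in> reflection ` (stiefel :: (real^'k^'n) set)"
    using one_eigenbasisD by blast
qed (auto intro: reflection_in_involution_model)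

lemma smooth_on_reflection: "smooth_on S (reflection :: real^'k^'n \<Rightarrow> real^'n^'n)"
  unfolding reflection_def
  by (intro smooth_on_diff smooth_on_scaleR smooth_on_matrix_mult smooth_on_transpose smooth_on_ident
      smooth_on_const)


section \<open>Dimension of the involution model\<close>

text \<open>Transitivity of O(n) on frames, needed only to compare dimensions at different points.
  The orthogonal complements \<open>K Y0\<close> and \<open>K Y1\<close> of the column spaces have
  equal dimension and are therefore isometric.\<close>

lemma orthogonal_matrix_between_frames:
  fixes Y0 Y1 :: "real^'k^'n"
  assumes Y: "Y0 \<in> stiefel" "Y1 \<in> stiefel"
  shows "\<exists>P. orthogonal_matrix P \<and> P ** Y0 = Y1"
proof -
  define K where "K Y = {v. transpose Y *v v = 0}" for Y :: "real^'k^'n"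
  have sub: "subspace (K Y)" for Y
    unfolding K_def by (rule linear_subspace_kernel) (rule matrix_vector_mul_linear)
  have YY: "transpose Y *v (Y *v x) = x" if "Y \<in> stiefel" for Y :: "real^'k^'n" and x
    by (simp add: matrix_vector_mul_assoc stiefelD[OF that] del: transpose_matrix_vector)
  have inner: "(Y *v x) \<bullet> v = x \<bullet> (transpose Y *v v)" for Y :: "real^'k^'n" and x v
    by (metis dot_lmul_matrix inner_commute transpose_matrix_vector)
  have dimK: "dim (K Y) = CARD('n) - CARD('k)" if "Y \<in> stiefel" for Y :: "real^'k^'n"
  proof -
    have "inj ((*v) Y)" by (metis YY[OF that] injI)
    then have "dim (range ((*v) Y)) = CARD('k)"
      using dim_image_eq[of "(*v) Y" UNIV] by (simp add: dim_UNIV matrix_vector_mul_linear)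
    moreover have "K Y = {y \<in> UNIV. \<forall>x\<in>range ((*v) Y). orthogonal x y}"
      unfolding K_def orthogonal_def
      by (auto simp: inner simp del: transpose_matrix_vector) (metis inner_eq_zero_iff)
    ultimately show ?thesis
      using dim_subspace_orthogonal_to_vectors[of "range ((*v) Y)" "UNIV :: (real^'n) set"]
      by (simp add: dim_UNIV linear_subspace_image)
  qed
  obtain f where f: "linear f" "f ` K Y0 = K Y1" "\<And>x. x \<in> K Y0 \<Longrightarrow> norm (f x) = norm x"
    using isometries_subspaces[OF sub sub, of Y0 Y1] dimK Y by metis
  \<comment> \<open>\<open>T\<close> sends the frame \<open>Y0\<close> to \<open>Y1\<close> and uses
    \<open>f\<close> on the complement; Pythagoras on both sides makes it an isometry.\<close>
  define T where "T v = Y1 *v (transpose Y0 *v v) + f (v - Y0 *v (transpose Y0 *v v))" for v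
  have linT: "linear T"
    unfolding T_def using f(1)
    by (intro linear_compose_add linear_compose[unfolded o_def, OF _ f(1)] linear_compose_sub
        linear_ident linear_compose[unfolded o_def, OF matrix_vector_mul_linear matrix_vector_mul_linear])
  have "norm (T v) = norm v" for v
  proof -
    define a where "a = transpose Y0 *v v"
    define w where "w = v - Y0 *v a"
    have w: "w \<in> K Y0"
      unfolding K_def w_def using YY[OF Y(1)]
      by (simp add: matrix_vector_mult_diff_distrib a_def del: transpose_matrix_vector)
    then have fw: "f w \<in> K Y1" using f(2) by blast
    have nY: "norm (Y *v a) = norm a" if "Y \<in> stiefel" for Y :: "real^'k^'n"
      using inner[of Y a "Y *v a"] YY[OF that] by (simp add: norm_eq_sqrt_inner)
    have "(norm (T v))\<^sup>2 = (norm (Y1 *v a))\<^sup>2 + (norm (f w))\<^sup>2"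
      unfolding T_def a_def[symmetric] w_def[symmetric]
      using fw by (intro norm_add_Pythagorean) (simp add: orthogonal_def inner K_def)
    also have "\<dots> = (norm (Y0 *v a))\<^sup>2 + (norm w)\<^sup>2"
      using nY Y f(3)[OF w] by simp
    also have "\<dots> = (norm (Y0 *v a + w))\<^sup>2"
      using w by (intro norm_add_Pythagorean[symmetric]) (simp add: orthogonal_def inner K_def)
    finally show ?thesis by (simp add: w_def)
  qed
  then have "orthogonal_matrix (matrix T)"
    using linT orthogonal_transformation orthogonal_transformation_matrix by blast
  moreover have "matrix T ** Y0 = Y1"
  proof (subst matrix_eq, rule allI)
    fix x
    have "(matrix T ** Y0) *v x = T (Y0 *v x)"
      using matrix_works[of T] linT
      by (simp add: matrix_vector_mul_assoc[symmetric] linear_matrix_vector_mul_eq)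
    also have "\<dots> = Y1 *v x"
      using YY[OF Y(1)] f(1) by (simp add: T_def linear_0 del: transpose_matrix_vector)
    finally show "(matrix T ** Y0) *v x = Y1 *v x" .
  qed
  ultimately show ?thesis by blast
qed

lemma dim_anticommuting_skew_le:
  fixes P :: "real^'n^'n"
  assumes P: "orthogonal_matrix P" and Q1: "Q1 = P ** Q0 ** transpose P"
  shows "dim (anticommuting_skew Q0) \<le> dim (anticommuting_skew Q1)"
proof -
  let ?h = "\<lambda>B. P ** B ** transpose P"
  have PP: "transpose P ** P = mat 1" "P ** transpose P = mat 1"
    using P by (auto simp: orthogonal_matrix_def)
  have cancel: "X ** transpose P ** P = X" for X :: "real^'n^'n"
    using PP by (simp add: matrix_mul_assoc[symmetric])
  have lin: "linear ?h"
    by (intro linearI) (simp_all add: matrix_mult_algebra)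
  have "transpose P ** ?h B ** P = B" for B
    using PP by (simp add: matrix_mul_assoc cancel)
  then have "inj_on ?h (span (anticommuting_skew Q0))"
    by (intro inj_on_inverseI[of _ "\<lambda>B. transpose P ** B ** P"])
  then have dim: "dim (?h ` anticommuting_skew Q0) = dim (anticommuting_skew Q0)"
    by (rule dim_image_eq[OF lin])
  have "?h B \<in> anticommuting_skew Q1" if "B \<in> anticommuting_skew Q0" for B
  proof -
    have B: "transpose B = - B" "Q0 ** B = - (B ** Q0)" using that by (auto simp: anticommuting_skew_def)
    have "Q1 ** ?h B = P ** (Q0 ** B) ** transpose P"
      by (simp add: Q1 matrix_mul_assoc cancel)
    moreover have "?h B ** Q1 = P ** (B ** Q0) ** transpose P"
      by (simp add: Q1 matrix_mul_assoc cancel)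
    ultimately have "Q1 ** ?h B = - (?h B ** Q1)"
      by (simp add: B(2) bounded_bilinear.minus_left[OF bounded_bilinear_matrix_mult]
          bounded_bilinear.minus_right[OF bounded_bilinear_matrix_mult])
    moreover have "transpose (?h B) = - ?h B"
      by (simp add: transpose_algebra B(1) matrix_mul_assoc
          bounded_bilinear.minus_left[OF bounded_bilinear_matrix_mult]
          bounded_bilinear.minus_right[OF bounded_bilinear_matrix_mult])
    ultimately show ?thesis by (simp add: anticommuting_skew_def)
  qed
  then have "?h ` anticommuting_skew Q0 \<subseteq> anticommuting_skew Q1" by blast
  from dim_subset[OF this] show ?thesis by (simp only: dim)
qed

text \<open>An orthogonal \<open>P\<close> with \<open>P ** Y0 = Y1\<close> conjugates one
  reflection into the other and hence one model space into the other. The roles of the frames can be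
  exchanged, so inequality of dimensions in one direction is enough.\<close>

lemma dim_anticommuting_skew_eq:
  fixes Y0 Y1 :: "real^'k^'n"
  assumes Y: "Y0 \<in> stiefel" "Y1 \<in> stiefel"
  shows "dim (anticommuting_skew (reflection Y0)) = dim (anticommuting_skew (reflection Y1))"
proof -
  have "dim (anticommuting_skew (reflection X)) \<le> dim (anticommuting_skew (reflection Z))"
    if X: "X \<in> stiefel" and Z: "Z \<in> stiefel" for X Z :: "real^'k^'n"
  proof -
    obtain P where P: "orthogonal_matrix P" "P ** X = Z"
      using orthogonal_matrix_between_frames[OF X Z] by blast
    have "P ** transpose P = mat 1" using P(1) by (simp add: orthogonal_matrix_def)
    then have "reflection Z = P ** reflection X ** transpose P"
      by (simp add: reflection_def P(2)[symmetric] matrix_mult_algebra transpose_algebra matrix_mul_assoc)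
    then show ?thesis by (rule dim_anticommuting_skew_le[OF P(1)])
  qed
  then show ?thesis using Y by (metis order_antisym)
qed


section \<open>Local frames of the eigenspace\<close>

text \<open>For such \<open>X\<close> the trace is that of \<open>X\<^sup>T X\<close>, the squared
  Frobenius norm.\<close>

lemma symmetric_idempotent_trace_0:
  fixes X :: "real^'n^'n"
  assumes "transpose X = X" "X ** X = X" "trace X = 0"
  shows "X = 0"
proof -
  have "trace (transpose X ** X) = X \<bullet> X"
    unfolding trace_def matrix_matrix_mult_def transpose_def inner_vec_def
    by (simp, rule sum.swap)
  then show ?thesis using assms by simp
qed

text \<open>Squaring maps the symmetric matrices to themselves and has derivative
  \<open>H \<mapsto> 2H\<close> at the identity, which is onto; a smooth local section through the
  identity is a square root.\<close>

lemma smooth_matrix_sqrt: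
  obtains V r where "openin (top_of_set {X :: real^'k^'k. transpose X = X}) V" "mat 1 \<in> V"
    "smooth_on V r" "r (mat 1) = mat 1" "\<And>X. X \<in> V \<Longrightarrow> transpose (r X) = r X \<and> r X ** r X = X"
proof -
  let ?S = "{X :: real^'k^'k. transpose X = X}"
  have S: "subspace ?S" by (auto simp: subspace_def transpose_algebra)
  have der: "((\<lambda>X. X ** X) has_derivative (\<lambda>H. mat 1 ** H + H ** mat 1)) (at (mat 1) within ?S)"
    by (intro bounded_bilinear.FDERIV[OF bounded_bilinear_matrix_mult] has_derivative_ident)
  have im: "(\<lambda>H. mat 1 ** H + H ** mat 1) ` ?S = ?S"
  proof (intro equalityI subsetI)
    fix X assume "X \<in> ?S"
    then show "X \<in> (\<lambda>H. mat 1 ** H + H ** mat 1) ` ?S"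
      by (intro image_eqI[of _ _ "(1 / 2) *\<^sub>R X"])
        (auto simp: transpose_algebra simp flip: scaleR_add_left)
  next
    fix X assume "X \<in> (\<lambda>H. mat 1 ** H + H ** mat 1) ` ?S"
    then obtain H where H: "transpose H = H" "X = mat 1 ** H + H ** mat 1" by blast
    show "X \<in> ?S"
      unfolding H(2) mem_Collect_eq by (simp only: transpose_algebra H(1) matrix_mul_lid matrix_mul_rid)
  qed
  have sm: "smooth_on ?S (\<lambda>X. X ** X)" by (intro smooth_on_matrix_mult smooth_on_ident)
  have sq: "(\<lambda>X. X ** X) ` ?S \<subseteq> ?S" by (auto simp: transpose_algebra)
  have one: "mat 1 \<in> ?S" by simp
  have op: "openin (top_of_set ?S) ?S" by simp
  obtain V r where V: "openin (top_of_set ?S) V" "mat 1 ** mat 1 \<in> V" "smooth_on V r" "r ` V \<subseteq> ?S"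
    "r (mat 1 ** mat 1) = mat 1" "\<And>X. X \<in> V \<Longrightarrow> r X ** r X = X"
    by (rule smooth_local_section[OF op S S sm sq one der im]) blast
  show thesis
    by (rule that[OF V(1) _ V(3)]) (use V in auto)
qed

text \<open>For \<open>Q\<close> near \<open>reflection Y\<close> the columns of \<open>Z = P Y\<close>, where \<open>P\<close> is the projection onto the
  1-eigenspace of \<open>Q\<close>, form a basis of that eigenspace, which \<open>(Z\<^sup>T Z)\<^sup>-\<^sup>1\<^sup>/\<^sup>2\<close> orthonormalizes.\<close>

lemma reflection_local_section:
  fixes Y :: "real^'k^'n"
  assumes Y: "Y \<in> stiefel"
  shows "\<exists>W s. openin (top_of_set (involution_model CARD('k))) W \<and> reflection Y \<in> W \<and> smooth_on W s \<and>
    s ` W \<subseteq> stiefel \<and> s (reflection Y) = Y \<and> (\<forall>Q\<in>W. reflection (s Q) = Q)"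
proof -
  obtain V r where V: "openin (top_of_set {X :: real^'k^'k. transpose X = X}) V" "mat 1 \<in> V"
    "smooth_on V r" "r (mat 1) = mat 1" "\<And>X. X \<in> V \<Longrightarrow> transpose (r X) = r X \<and> r X ** r X = X"
    by (rule smooth_matrix_sqrt) blast
  obtain T where T: "open T" "V = {X. transpose X = X} \<inter> T" using V(1) by (auto simp: openin_open)
  define Z where "Z Q = ((1 / 2) *\<^sub>R (Q + mat 1)) ** Y" for Q :: "real^'n^'n"
  define G where "G Q = transpose (Z Q) ** Z Q" for Q
  \<comment> \<open>\<open>G Q\<close> is symmetric, so membership in the open set \<open>T\<close>
    places it in the domain \<open>V\<close> of the root; invertibility of \<open>G Q\<close> passes
    to \<open>r (G Q)\<close>.\<close>
  define U where "U = {Q. G Q \<in> T \<and> invertible (G Q)}"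
  define s where "s Q = Z Q ** matrix_inv (r (G Q))" for Q
  let ?N = "involution_model CARD('k) :: (real^'n^'n) set"
  let ?W = "?N \<inter> U"
  have smZ: "smooth_on S Z" for S
    unfolding Z_def
    by (intro smooth_on_matrix_mult smooth_on_scaleR smooth_on_add smooth_on_ident smooth_on_const)
  have smG: "smooth_on S G" for S
    unfolding G_def by (intro smooth_on_matrix_mult smooth_on_transpose smZ)
  have "open (G -` (T \<inter> {X. invertible X}))"
    using T(1) open_invertible smooth_on_imp_continuous_on[OF smG, of UNIV] by (intro open_vimage open_Int)
  then have opW: "openin (top_of_set ?N) ?W"
    unfolding U_def by (intro openin_open_Int) (simp add: vimage_def)
  have GV: "G Q \<in> V" "invertible (r (G Q))" if QU: "Q \<in> U" for Q
  proof -
    show GV: "G Q \<in> V" using QU T(2) by (simp add: U_def G_def transpose_algebra)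
    obtain X where "X ** G Q = mat 1" using QU by (auto simp: U_def invertible_def)
    then have "(X ** r (G Q)) ** r (G Q) = mat 1"
      using V(5)[OF GV] by (simp add: matrix_mul_assoc[symmetric])
    then show "invertible (r (G Q))" using invertible_left_inverse by blast
  qed
  have sms: "smooth_on ?W s"
    unfolding s_def
  proof (intro smooth_on_matrix_mult smooth_on_matrix_inv smZ)
    show "smooth_on ?W (\<lambda>Q. r (G Q))"
      by (rule smooth_on_compose[OF smG V(3)]) (use GV in auto)
  qed (use GV in auto)
  have props: "s Q \<in> stiefel \<and> reflection (s Q) = Q" if Q: "Q \<in> ?W" for Q
  proof -
    have QN: "Q \<in> ?N" and QU: "Q \<in> U" using Q by auto
    define P where "P = (1 / 2) *\<^sub>R (Q + mat 1)"
    note P = eigenprojection[OF QN, folded P_def]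
    let ?R = "r (G Q)" and ?J = "matrix_inv (r (G Q))" and ?E = "s Q ** transpose (s Q)"
    have R: "transpose ?R = ?R" "?R ** ?R = G Q" using V(5)[OF GV(1)[OF QU]] by auto
    note J = matrix_inv_mult[OF GV(2)[OF QU]]
    have "transpose ?J ** ?R = mat 1"
      using arg_cong[OF J(1), of transpose] by (simp add: transpose_algebra R)
    then have Jsym: "transpose ?J = ?J"
      using J matrix_cancel_right[OF GV(2)[OF QU]] by metis
    have "transpose (s Q) ** s Q = transpose ?J ** (transpose (Z Q) ** Z Q) ** ?J"
      by (simp add: s_def transpose_algebra matrix_mul_assoc)
    also have "\<dots> = ?J ** G Q ** ?J"
      unfolding Jsym G_def[symmetric] ..
    also have "\<dots> = (?J ** ?R) ** (?R ** ?J)"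
    proof -
      have "?J ** (?R ** ?R) ** ?J = (?J ** ?R) ** (?R ** ?J)" by (simp only: matrix_mul_assoc)
      then show ?thesis unfolding R(2) .
    qed
    finally have st: "transpose (s Q) ** s Q = mat 1" by (simp add: J)
    have PZ: "P ** Z Q = Z Q" by (simp add: Z_def P_def[symmetric] matrix_mul_assoc P(2))
    have PE: "P ** ?E = ?E" by (simp add: s_def matrix_mul_assoc PZ)
    have Esym: "transpose ?E = ?E" by (simp add: transpose_algebra)
    have EP: "?E ** P = ?E"
      using arg_cong[OF PE, of transpose] by (simp add: matrix_transpose_mul[of P ?E] Esym P(1))
    have "?E ** ?E = s Q ** (transpose (s Q) ** s Q) ** transpose (s Q)"
      by (simp only: matrix_mul_assoc)
    then have EE: "?E ** ?E = ?E" by (simp add: st)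
    have "trace ?E = real CARD('k)"
      using trace_mul_sym[of "s Q" "transpose (s Q)"] by (simp add: st trace_mat_1)
    \<comment> \<open>\<open>?E\<close> projects onto a subspace of the eigenspace and has the same
      trace as \<open>P\<close>. The difference is again an orthogonal projection, of trace 0, so
      the columns of \<open>s Q\<close> span the whole eigenspace.\<close>
    then have "trace (P - ?E) = 0" by (simp add: trace_sub P(3))
    moreover have "(P - ?E) ** (P - ?E) = P - ?E"
      by (simp only: bounded_bilinear.diff_left[OF bounded_bilinear_matrix_mult]
          bounded_bilinear.diff_right[OF bounded_bilinear_matrix_mult] P(2) PE EP EE) simp
    moreover have "transpose (P - ?E) = P - ?E"
      using P(1) Esym by (simp add: transpose_algebra)
    ultimately have "P - ?E = 0" by (intro symmetric_idempotent_trace_0)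
    then have "reflection (s Q) = Q" using P(4) by (simp add: reflection_def)
    then show ?thesis using st by (simp add: stiefel_def)
  qed
  have "(1 / 2) *\<^sub>R (reflection Y + mat 1) = Y ** transpose Y" by (simp add: reflection_def)
  then have ZY: "Z (reflection Y) = Y"
    using stiefelD[OF Y] by (simp add: Z_def matrix_mul_assoc[symmetric])
  then have GY: "G (reflection Y) = mat 1" using stiefelD[OF Y] by (simp add: G_def)
  have inv1: "invertible (mat 1 :: real^'k^'k)" by (auto simp: invertible_def intro!: exI[of _ "mat 1"])
  have "matrix_inv (mat 1 :: real^'k^'k) = mat 1" using matrix_inv_mult(1)[OF inv1] by simp
  then have sY: "s (reflection Y) = Y" by (simp add: s_def ZY GY V(4))
  have "reflection Y \<in> ?W"
    using reflection_in_involution_model[OF Y] V(2) T(2) inv1 by (simp add: U_def GY)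
  with opW sms sY props show ?thesis
    by (intro exI[of _ ?W] exI[of _ s]) blast
qed


section \<open>The diffeomorphism\<close>

interpretation stiefel_submersion: submersion_quotient
  "stiefel_manifold :: (real^'k^'n, real^'k^'n) manifold" stiefel
  "involution_model CARD('k) :: (real^'n^'n) set" reflection stiefel_class phi3
proof
  show "stiefel_class Y = stiefel_class Y'"
    if "Y \<in> stiefel" "Y' \<in> stiefel" "reflection Y = reflection Y'" for Y Y' :: "real^'k^'n"
    using that by (intro equalityI reflection_eq_imp_class_subset) auto
qed (use embedded_stiefel smooth_on_reflection reflection_image phi3_stiefel_class
    reflection_local_section in auto)

theorem diffeomorphism_phi3:
  "diffeomorphism (stiefel_quotient :: ((real^'k^'n) set, real^'k^'n) manifold)
     (involution_manifold CARD('k) :: (real^'n^'n, real^'n^'n) manifold) phi3"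
  unfolding stiefel_quotient_def
proof (rule stiefel_submersion.diffeomorphism_quotient[OF embedded_involution])
  let ?N = "involution_model CARD('k) :: (real^'n^'n) set"
  \<comment> \<open>The dimension has to be fixed before \<open>Q\<close>. The choice is harmless:
    any \<open>Q\<close> in \<open>?N\<close> supplies a frame, and the value does not depend on
    which frame is taken.\<close>
  define d where "d = dim (anticommuting_skew (reflection (SOME Y :: real^'k^'n. Y \<in> stiefel)))"
  fix Q assume Q: "Q \<in> ?N"
  then obtain Y :: "real^'k^'n" where Y: "Y \<in> stiefel" "Q = reflection Y"
    using reflection_image by blast
  obtain a :: "(real^'n^'n, real^'n^'n) chart" where a: "embedded_chart ?N a" "Q \<in> chart_dom a"
    "chart_model a = anticommuting_skew Q"
    using involution_chart[OF Q] by blast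
  have "dim (chart_model a) = d"
    unfolding a(3) Y(2) d_def by (intro dim_anticommuting_skew_eq Y(1) someI[of "\<lambda>Y. Y \<in> stiefel" Y])
  with a show "\<exists>a :: (real^'n^'n, real^'n^'n) chart. embedded_chart ?N a \<and> Q \<in> chart_dom a \<and>
      dim (chart_model a) = d"
    by blast
  \<comment> \<open>Multiplication by the frame over \<open>Q\<close> re-models the Cayley chart in
    n x k matrices, the type required of charts of the quotient.\<close>
  have "linear (\<lambda>B :: real^'n^'n. B ** Y)"
    by (intro bounded_linear.linear bounded_bilinear.bounded_linear_left[OF bounded_bilinear_matrix_mult])
  moreover have "inj_on (\<lambda>B. B ** Y) (chart_model a)"
    using inj_on_anticommuting_skew[of Y] unfolding a(3) Y(2) reflection_def .
  ultimately have "embedded_chart ?N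
      (Chart (chart_dom a) ((\<lambda>B. B ** Y) \<circ> chart_map a) ((\<lambda>B. B ** Y) ` chart_model a))"
    by (rule embedded_chart_linear[OF a(1)])
  then show "\<exists>a :: (real^'n^'n, real^'k^'n) chart. embedded_chart ?N a \<and> Q \<in> chart_dom a"
    using a(2) by (metis chart.sel(1))
qed

theorem proposition2p4:
  assumes "CARD('k::finite) \<le> CARD('n::finite)"
  shows "(\<forall>Y \<in> (stiefel :: (real^'k^'n) set).
            \<forall>Y' \<in> stiefel_class Y.
              2 *\<^sub>R (Y' ** transpose Y') - mat 1 = 2 *\<^sub>R (Y ** transpose Y) - mat 1) \<and>
         (\<forall>Y \<in> (stiefel :: (real^'k^'n) set).
            phi3 (stiefel_class Y) = 2 *\<^sub>R (Y ** transpose Y) - mat 1) \<and>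
         diffeomorphism
           (stiefel_quotient :: ((real^'k^'n) set, real^'k^'n) manifold)
           (involution_manifold CARD('k) :: (real^'n^'n, real^'n^'n) manifold)
           phi3 \<and>
         (\<forall>Q \<in> (involution_model CARD('k) :: (real^'n^'n) set).
            (\<exists>Y :: real^'k^'n. one_eigenbasis Q Y) \<and>
            (\<forall>Y :: real^'k^'n. one_eigenbasis Q Y \<longrightarrow>
               inv_into (mcarrier (stiefel_quotient :: ((real^'k^'n) set, real^'k^'n) manifold)) phi3 Q
                 = stiefel_class Y))"
proof -
  have carrier: "mcarrier (stiefel_quotient :: ((real^'k^'n) set, real^'k^'n) manifold)
      = stiefel_class ` stiefel"
    by (simp add: stiefel_quotient_def quotient_manifold_def stiefel_submersion.mtop_M
        topspace_quotient_topology)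
  have "inv_into (stiefel_class ` stiefel) phi3 Q = stiefel_class Y"
    if "Q \<in> involution_model CARD('k)" "one_eigenbasis Q Y" for Q :: "real^'n^'n" and Y :: "real^'k^'n"
    using one_eigenbasisD[OF that] stiefel_submersion.\<theta>_\<phi> by metis
  then show ?thesis
    unfolding carrier
    using stiefel_class_reflection phi3_stiefel_class ex_one_eigenbasis diffeomorphism_phi3
    unfolding reflection_def by blast
qed

end
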